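(* Let $\alpha_0=\frac{\log 2}{\log\lambda_0}\approx 0.7674$, where $\lambda_0$ is the positive root of $X^3-X^2-2X-4$ (this is the volume exponent of the first Grigorchuk group $G_{012}$). For any $\alpha,\beta$ such that $\alpha_0\le\alpha\le\beta\le 1$, there exists $\omega\in\{\mathbf 0,\mathbf 1,\mathbf 2\}^\infty$ such that the Grigorchuk group $G_\omega$, with generating set $S=\{a,b_\omega,c_\omega,d_\omega\}$, satisfies $$\liminf_{n\to\infty}\frac{\log\log v_{G_\omega,S}(n)}{\log n}=\alpha,\qquad \limsup_{n\to\infty}\frac{\log\log v_{G_\omega,S}(n)}{\log n}=\beta.$$
   Context: Grigorchuk groups: the rooted binary tree has the finite words over $\{0,1\}$ as vertices. Its automorphism group acts from the right. An automorphism is written $g=(g_0,g_1)\tau$ with $\tau$ a permutation of $\{0,1\}$, meaning $(iw)\cdot g=(i\cdot\tau)(w\cdot g_i)$. Let $\varepsilon$ be the transposition of $0,1$ and $a=(id,id)\varepsilon$. Let $\{id,b,c,d\}$ be the Klein four-group. The letters $\mathbf{0},\mathbf{1},\mathbf{2}$ denote the three non-trivial homomorphisms $\{id,b,c,d\}\to\{id,a\}\cong\mathbb{Z}/2\mathbb{Z}$, with $\mathbf{0},\mathbf{1},\mathbf{2}$ vanishing on $d,c,b$ respectively. For $\omega=\omega_0\omega_1\ldots\in\{\mathbf 0,\mathbf 1,\mathbf 2\}^\infty$ let $\mathfrak{s}\omega=\omega_1\omega_2\ldots$. The automorphisms $b_\omega,c_\omega,d_\omega$ are defined recursively by $x_\omega=(\omega_0(x),x_{\mathfrak{s}\omega})$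 for $x\in\{b,c,d\}$. The Grigorchuk group $G_\omega$ is generated by $S=\{a,b_\omega,c_\omega,d_\omega\}$. The first Grigorchuk group $G_{012}$ is $G_\omega$ for $\omega=(\mathbf{012})^\infty$. $v_{G_\omega,S}(n)$ is the number of elements of $G_\omega$ of word length at most $n$ with respect to $S$. *)

theory Defs
  imports Complex_Main "HOL-Library.Extended_Real" "HOL-Algebra.Generated_Groups"
begin

section \<open>Word growth of a group\<close>

definition word_length :: "('a, 'm) monoid_scheme \<Rightarrow> 'a set \<Rightarrow> 'a \<Rightarrow> nat" where
  "word_length G S g =
     (LEAST n. \<exists>ws. set ws \<subseteq> S \<union> m_inv G ` S \<and> length ws = n \<and>
                    foldr (mult G) ws (one G) = g)"

text \<open>The \<open>LEAST\<close> above is arbitrary on elements that are not products of generators, so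
  the following is intended for \<open>S\<close> generating \<open>G\<close>.\<close>

definition growth :: "('a, 'm) monoid_scheme \<Rightarrow> 'a set \<Rightarrow> nat \<Rightarrow> nat" where
  "growth G S n = card {g \<in> carrier G. word_length G S g \<le> n}"


section \<open>Automorphisms of the rooted binary tree\<close>

text \<open>Vertices are finite words over \<open>{0,1}\<close>, with \<open>False\<close> for \<open>0\<close> and \<open>True\<close> for \<open>1\<close>;
  the root is the empty word.  The image of a word \<open>w\<close> under the right action of \<open>g\<close> is
  the application \<open>g w\<close>.\<close>

type_synonym word = "bool list"

definition child :: "word \<Rightarrow> word \<Rightarrow> bool" where
  "child u v \<longleftrightarrow> (\<exists>i. v = u @ [i])"

text \<open>As the action is from the right, the product \<open>g h\<close> acts by \<open>g\<close> first.\<close>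

definition tree_aut :: "(word \<Rightarrow> word) monoid" where
  "tree_aut =
     \<lparr>carrier = {g. bij g \<and> g [] = [] \<and> (\<forall>u v. child (g u) (g v) \<longleftrightarrow> child u v)},
      mult = (\<lambda>g h. h \<circ> g), one = id\<rparr>"

text \<open>\<open>wreath g\<^sub>0 g\<^sub>1 \<tau>\<close> is the automorphism written \<open>(g\<^sub>0, g\<^sub>1)\<tau>\<close>.\<close>

fun wreath :: "(word \<Rightarrow> word) \<Rightarrow> (word \<Rightarrow> word) \<Rightarrow> (bool \<Rightarrow> bool) \<Rightarrow> word \<Rightarrow> word" where
  "wreath g\<^sub>0 g\<^sub>1 \<tau> [] = []"
| "wreath g\<^sub>0 g\<^sub>1 \<tau> (i # w) = \<tau> i # (if i then g\<^sub>1 w else g\<^sub>0 w)"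

definition aut_a :: "word \<Rightarrow> word" where
  "aut_a = wreath id id Not"

lemma tree_aut_group: "group tree_aut"
proof (rule groupI)
  fix g assume g: "g \<in> carrier tree_aut"
  then have b: "bij g" by (simp add: tree_aut_def)
  have s: "g (inv_into UNIV g x) = x" for x
    using b by (simp add: bij_is_surj surj_f_inv_f)
  have "inv_into UNIV g [] = []"
    using g b by (metis (mono_tags, lifting) bij_inv_eq_iff mem_Collect_eq
        partial_object.select_convs(1) tree_aut_def)
  moreover have "child (inv_into UNIV g u) (inv_into UNIV g v) \<longleftrightarrow> child u v" for u v
  proof -
    have "child (g (inv_into UNIV g u)) (g (inv_into UNIV g v))
        \<longleftrightarrow> child (inv_into UNIV g u) (inv_into UNIV g v)"
      using g by (simp add: tree_aut_def)
    then show ?thesis by (simp add: s)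
  qed
  ultimately have "inv_into UNIV g \<in> carrier tree_aut"
    using b by (simp add: tree_aut_def bij_imp_bij_inv)
  moreover have "inv_into UNIV g \<otimes>\<^bsub>tree_aut\<^esub> g = \<one>\<^bsub>tree_aut\<^esub>"
    by (auto simp: tree_aut_def s)
  ultimately show "\<exists>y \<in> carrier tree_aut. y \<otimes>\<^bsub>tree_aut\<^esub> g = \<one>\<^bsub>tree_aut\<^esub>" by blast
qed (auto simp: tree_aut_def bij_comp comp_assoc)


section \<open>Grigorchuk groups\<close>

datatype klein = K_id | K_b | K_c | K_d

definition klein_mult :: "klein \<Rightarrow> klein \<Rightarrow> klein" where
  "klein_mult x y =
     (if x = K_id then y else if y = K_id then x else if x = y then K_id
      else if {x, y} = {K_b, K_c} then K_d else if {x, y} = {K_b, K_d} then K_c else K_b)"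

datatype letter = L0 | L1 | L2

fun vanishes_on :: "letter \<Rightarrow> klein" where
  "vanishes_on L0 = K_d"
| "vanishes_on L1 = K_c"
| "vanishes_on L2 = K_b"

definition letter_hom :: "letter \<Rightarrow> klein \<Rightarrow> word \<Rightarrow> word" where
  "letter_hom l x = (if x = K_id \<or> x = vanishes_on l then id else aut_a)"

definition shift :: "(nat \<Rightarrow> letter) \<Rightarrow> nat \<Rightarrow> letter" where
  "shift \<omega> = (\<lambda>n. \<omega> (Suc n))"

fun klein_aut :: "(nat \<Rightarrow> letter) \<Rightarrow> klein \<Rightarrow> word \<Rightarrow> word" where
  "klein_aut \<omega> x [] = []"
| "klein_aut \<omega> x (i # w) = i # (if i then klein_aut (shift \<omega>) x w else letter_hom (\<omega> 0) x w)"

lemma klein_aut_rec: "klein_aut \<omega> x = wreath (letter_hom (\<omega> 0) x) (klein_aut (shift \<omega>) x) id"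
proof
  fix w show "klein_aut \<omega> x w = wreath (letter_hom (\<omega> 0) x) (klein_aut (shift \<omega>) x) id w"
    by (cases w) auto
qed

definition grig_gens :: "(nat \<Rightarrow> letter) \<Rightarrow> (word \<Rightarrow> word) set" where
  "grig_gens \<omega> = {aut_a, klein_aut \<omega> K_b, klein_aut \<omega> K_c, klein_aut \<omega> K_d}"

definition grig :: "(nat \<Rightarrow> letter) \<Rightarrow> (word \<Rightarrow> word) monoid" where
  "grig \<omega> = tree_aut \<lparr>carrier := generate tree_aut (grig_gens \<omega>)\<rparr>"

lemma aut_a_invol: "aut_a (aut_a w) = w"
  by (cases w) (auto simp: aut_a_def)

lemma aut_a_neq_id: "aut_a \<noteq> id"
  by (rule notI, drule fun_cong[of _ _ "[True]"]) (simp add: aut_a_def)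

text \<open>The letters are precisely the non-trivial homomorphisms from the Klein four-group
  to \<open>{id, a}\<close>.\<close>

lemma range_letter_hom_iff:
  "f \<in> range letter_hom \<longleftrightarrow>
     range f \<subseteq> {id, aut_a} \<and> (\<exists>x. f x \<noteq> id) \<and>
     (\<forall>x y. f (klein_mult x y) = f x \<otimes>\<^bsub>tree_aut\<^esub> f y)"
  (is "?L \<longleftrightarrow> ?R")
proof
  have aa: "aut_a \<circ> aut_a = id" by (simp add: fun_eq_iff aut_a_invol)
  assume ?L
  then obtain l where f: "f = letter_hom l" by blast
  have "f (klein_mult x y) = f x \<otimes>\<^bsub>tree_aut\<^esub> f y" for x y
    by (cases l; cases x; cases y)
       (simp_all add: f letter_hom_def klein_mult_def tree_aut_def aa doubleton_eq_iff)
  moreover have "f K_b \<noteq> id \<or> f K_c \<noteq> id"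
    by (cases l) (simp_all add: f letter_hom_def aut_a_neq_id)
  ultimately show ?R by (auto simp: f letter_hom_def)
next
  have aa: "aut_a \<circ> aut_a = id" by (simp add: fun_eq_iff aut_a_invol)
  assume R: ?R
  have m: "f (klein_mult x y) = f y \<circ> f x" for x y using R by (simp add: tree_aut_def)
  have v: "f x = id \<or> f x = aut_a" for x using R by blast
  have i: "f K_id = id" using m[of K_id K_id] v[of K_id] aa aut_a_neq_id
    by (auto simp: klein_mult_def)
  have d: "f K_d = f K_c \<circ> f K_b" using m[of K_b K_c] by (simp add: klein_mult_def)
  obtain x where "f x \<noteq> id" using R by blast
  then have "f K_b \<noteq> id \<or> f K_c \<noteq> id" using i d by (cases x) auto
  then consider "f K_b = aut_a" "f K_c = aut_a" | "f K_b = aut_a" "f K_c = id"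
    | "f K_b = id" "f K_c = aut_a"
    using v by blast
  then obtain l where "f K_b = letter_hom l K_b" "f K_c = letter_hom l K_c"
    "f K_d = letter_hom l K_d"
  proof cases
    case 1 then show ?thesis using that[of L0] d aa by (simp add: letter_hom_def)
  next
    case 2 then show ?thesis using that[of L1] d by (simp add: letter_hom_def)
  next
    case 3 then show ?thesis using that[of L2] d by (simp add: letter_hom_def)
  qed
  then have "f x = letter_hom l x" for x
    using i by (cases x) (simp_all add: letter_hom_def)
  then have "f = letter_hom l" by (rule ext)
  then show ?L by blast
qed

lemma invol_in_tree_aut:
  assumes "\<And>w. g (g w) = w" "g [] = []" "\<And>w i. \<exists>j. g (w @ [i]) = g w @ [j]"
  shows "g \<in> carrier tree_aut"
proof -
  have "child (g u) (g v)" if "child u v" for u v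
    using that assms(3) by (auto simp: child_def)
  then have "child (g u) (g v) \<longleftrightarrow> child u v" for u v
    using assms(1) by metis
  moreover have "bij g" using assms(1) by (metis bijI')
  ultimately show ?thesis using assms(2) by (simp add: tree_aut_def)
qed

lemma aut_a_append: "\<exists>j. aut_a (w @ [i]) = aut_a w @ [j]"
  by (cases w) (auto simp: aut_a_def)

lemma klein_aut_invol: "klein_aut \<omega> x (klein_aut \<omega> x w) = w"
  by (induction w arbitrary: \<omega>) (auto simp: letter_hom_def aut_a_invol)

lemma klein_aut_append: "\<exists>j. klein_aut \<omega> x (w @ [i]) = klein_aut \<omega> x w @ [j]"
proof (induction w arbitrary: \<omega>)
  case Nil
  show ?case by (auto simp: letter_hom_def aut_a_def)
next
  case (Cons k w)
  then show ?case using aut_a_append[of w i] by (auto simp: letter_hom_def)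
qed

lemma grig_gens_subset: "grig_gens \<omega> \<subseteq> carrier tree_aut"
proof -
  have "aut_a \<in> carrier tree_aut"
    using aut_a_append by (intro invol_in_tree_aut) (auto simp: aut_a_invol, simp add: aut_a_def)
  moreover have "klein_aut \<omega> x \<in> carrier tree_aut" for x
    using klein_aut_append by (intro invol_in_tree_aut) (auto simp: klein_aut_invol)
  ultimately show ?thesis by (auto simp: grig_gens_def)
qed

lemma grig_group: "group (grig \<omega>)"
  unfolding grig_def
  using group.generate_is_subgroup[OF tree_aut_group grig_gens_subset] tree_aut_group
  by (rule subgroup.subgroup_is_group)


definition lambda0 :: real where
  "lambda0 = (THE x. x > 0 \<and> x ^ 3 - x ^ 2 - 2 * x - 4 = 0)"

lemma ex1_lambda0: "\<exists>!x::real. x > 0 \<and> x ^ 3 - x ^ 2 - 2 * x - 4 = 0"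
proof -
  have "\<exists>x\<ge>2. x \<le> 3 \<and> x ^ 3 - x ^ 2 - 2 * x - 4 = (0::real)"
    by (rule IVT) (auto intro!: continuous_intros simp: power3_eq_cube power2_eq_square)
  then obtain x :: real where x: "x > 0" "x ^ 3 - x ^ 2 - 2 * x - 4 = 0"
    by (metis less_le_trans zero_less_numeral)
  have "y = x" if y: "y > 0" "y ^ 3 - y ^ 2 - 2 * y - 4 = 0" for y :: real
  proof -
    have "(y - x) * (x ^ 2 * y ^ 2 + 2 * x * y * (x + y) + 4 * (y ^ 2 + x * y + x ^ 2)) = 0"
      using x(2) y(2) by algebra
    moreover have "x ^ 2 * y ^ 2 + 2 * x * y * (x + y) + 4 * (y ^ 2 + x * y + x ^ 2) > 0"
      using x(1) y(1) by (intro add_pos_pos mult_pos_pos) auto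
    ultimately show ?thesis by simp
  qed
  with x show ?thesis by blast
qed

end

theory Submission
  imports Defs "HOL-Library.Discrete_Functions" "HOL-Real_Asymp.Real_Asymp"
begin

text \<open>
  Only sequences \<open>\<omega>\<close> made of triples \<open>012\<close> and \<open>000\<close> are used. Put
  \<open>T(I) = I ln 8 + c(I) ln \<xi>\<close>, where \<open>c(I)\<close> counts the triples \<open>012\<close> among the first \<open>I\<close> and
  \<open>\<xi> = (\<lambda>\<^sub>0/2)\<^sup>3\<close>. If the type of the triple changes rarely, a ball of radius about \<open>e\<^bsup>T(I)\<^esup>\<close> has
  about \<open>exp (8\<^bsup>I\<^esup>)\<close> elements, up to errors that are invisible after taking two logarithms
  (\<open>growth_upper\<close> and \<open>growth_lower\<close>). The exponent at scale \<open>I\<close> is therefore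
  \<open>I ln 8 / T(I)\<close>, which decreases from \<open>1\<close> to \<open>ln 2 / ln \<lambda>\<^sub>0\<close> as the density \<open>c(I)/I\<close> increases from
  \<open>0\<close> to \<open>1\<close>. Letting the density oscillate slowly between two values gives the two limits.

  Upper bound. With Bartholdi's weights on the letters, the two sections of a word weigh together at
  most \<open>\<eta> = 2/\<lambda>\<^sub>0\<close> times the weight of the word at a level of a triple \<open>012\<close>, up to a constant
  (\<open>section_words\<close>). Below level \<open>3I\<close> an element of length \<open>e\<^bsup>T(I)\<^esup>\<close> thus leaves \<open>8\<^bsup>I\<^esup>\<close> sections of
  bounded average length, apart from the factor paid at each change of type, and there are few such
  families (\<open>sum_total_len_pow\<close>).

  Lower bound. A substitution on words inverts the passage to sections without loss
  (\<open>act_subst\<close>). Iterated on one letter it yields elements \<open>\<Gamma>\<^sub>r\<close>, of length about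
  \<open>e\<^bsup>T(r/3)\<^esup>\<close>, that fix level \<open>r\<close>, flip the coordinate below every vertex of
  level \<open>r\<close>, and carry just one Klein letter per vertex. Take a product of \<open>8\<^bsup>I\<^esup>\<close> copies of the
  generator \<open>b\<close> interleaved with the \<open>\<Gamma>\<^sub>r\<close>, each factor raised to an independent random exponent
  \<open>0\<close> or \<open>1\<close>. The point \<open>1\<^sup>\<infinity>\<close> is fixed by \<open>b\<close> and scattered by the \<open>\<Gamma>\<^sub>r\<close>: a path that has met
  the \<open>\<Gamma>\<^sub>r\<close> for \<open>r\<close> in a set \<open>A\<close> has all coordinates in \<open>A\<close> equal to \<open>1\<close> with probability at
  most \<open>2\<^bsup>-|A|\<^esup>\<close> (\<open>card_run_prescribed\<close>). So if \<open>\<Gamma>\<^sub>r\<close> is used with frequency about \<open>2\<^bsup>-r\<^esup>\<close>, which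
  keeps the total length near \<open>e\<^bsup>T(I)\<^esup>\<close>, the path hardly ever returns, and
  the exponent of each \<open>b\<close> can be guessed from the germ at \<open>1\<^sup>\<infinity>\<close> of the product from that factor
  on. Few errors in the guesses mean that the products take at least \<open>exp (8\<^bsup>I\<^esup>/8)\<close> values
  (\<open>card_run_ge\<close>).

  The germ is read modulo the letter \<open>c\<close>, by watching a coordinate where \<open>c\<close> acts
  trivially. Hence a \<open>\<Gamma>\<^sub>r\<close> built from \<open>c\<close> never disturbs the reading. For \<open>r mod 3 = 2\<close> the letter \<open>c\<close>
  may vanish at the level above and \<open>b\<close> has to be used instead; these \<open>\<Gamma>\<^sub>r\<close> could spoil every guess.
  They are a minority, so it suffices to use the other \<open>\<Gamma>\<^sub>r\<close> more often, by a factor \<open>8\<^bsup>2s\<^esup>\<close>: then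
  a path meets enough of them before it can be disturbed, and a guess fails with probability at most
  about \<open>I\<^sup>2 16\<^bsup>-s\<^esup>\<close>. With \<open>s\<close> of order \<open>\<surd>I\<close> this is small, and the length grows only by a factor
  \<open>exp (O(\<surd>I))\<close>.
\<close>

section \<open>Words in the generators\<close>

text \<open>
  \<open>None\<close> is the letter for \<open>a\<close>. The trivial letter \<open>Some K_id\<close> is admitted so that the product of
  two Klein letters is always a single letter.
\<close>
primrec gen :: "(nat \<Rightarrow> letter) \<Rightarrow> klein option \<Rightarrow> word \<Rightarrow> word" where
  "gen \<omega> None = aut_a"
| "gen \<omega> (Some x) = klein_aut \<omega> x"

primrec ev :: "(nat \<Rightarrow> letter) \<Rightarrow> klein option list \<Rightarrow> word \<Rightarrow> word" where
  "ev \<omega> [] p = p"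
| "ev \<omega> (l # ws) p = ev \<omega> ws (gen \<omega> l p)"

lemma ev_Nil: "ev \<omega> [] = id" by auto

lemma ev_Cons: "ev \<omega> (l # ws) = ev \<omega> ws \<circ> gen \<omega> l" by auto

lemma ev_append: "ev \<omega> (us @ ws) p = ev \<omega> ws (ev \<omega> us p)"
  by (induction us arbitrary: p) auto

lemma aut_a_Nil [simp]: "aut_a [] = []" by (simp add: aut_a_def)
lemma aut_a_Cons [simp]: "aut_a (i # q) = (\<not> i) # q" by (simp add: aut_a_def)

lemma letter_hom_K_id [simp]: "letter_hom l K_id = id" by (simp add: letter_hom_def)

lemma klein_aut_K_id [simp]: "klein_aut \<omega> K_id = id"
proof
  show "klein_aut \<omega> K_id p = id p" for p by (induction p arbitrary: \<omega>) auto
qed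

lemma letter_hom_mult: "letter_hom l y (letter_hom l x p) = letter_hom l (klein_mult x y) p"
  by (cases l; cases x; cases y)
     (simp_all add: letter_hom_def klein_mult_def aut_a_invol doubleton_eq_iff)

lemma klein_aut_mult: "klein_aut \<omega> y (klein_aut \<omega> x p) = klein_aut \<omega> (klein_mult x y) p"
  by (induction p arbitrary: \<omega>) (auto simp: letter_hom_mult)

lemma gen_invol: "gen \<omega> l (gen \<omega> l p) = p"
  by (cases l) (auto simp: aut_a_invol klein_aut_invol)

lemma grig_gens_gen: "g \<in> grig_gens \<omega> \<Longrightarrow> \<exists>l. g = gen \<omega> l"
  unfolding grig_gens_def using gen.simps by (metis insertE empty_iff)

lemma gen_cases: "gen \<omega> l \<in> grig_gens \<omega> \<or> gen \<omega> l = id"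
proof (cases l)
  case (Some x) then show ?thesis by (cases x) (auto simp: grig_gens_def)
qed (auto simp: grig_gens_def)

lemma grig_mult [simp]: "mult (grig \<omega>) = (\<lambda>g h. h \<circ> g)" and grig_one [simp]: "one (grig \<omega>) = id"
  by (simp_all add: grig_def tree_aut_def)

lemma foldr_gens_ev:
  assumes "set gs \<subseteq> grig_gens \<omega>"
  shows "\<exists>ws. length ws = length gs \<and> foldr (\<lambda>g h. h \<circ> g) gs id = ev \<omega> ws"
  using assms
proof (induction gs)
  case Nil then show ?case by (auto intro!: exI[of _ "[]"])
next
  case (Cons g gs)
  then obtain ws l where "length ws = length gs" "foldr (\<lambda>g h. h \<circ> g) gs id = ev \<omega> ws" "g = gen \<omega> l"
    using grig_gens_gen by fastforce
  then show ?case by (intro exI[of _ "l # ws"]) (simp add: ev_Cons comp_def id_def del: ev.simps)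
qed

lemma ev_foldr_gens:
  "\<exists>gs. set gs \<subseteq> grig_gens \<omega> \<and> length gs \<le> length ws \<and> foldr (\<lambda>g h. h \<circ> g) gs id = ev \<omega> ws"
proof (induction ws)
  case Nil then show ?case by (auto intro!: exI[of _ "[]"])
next
  case (Cons l ws)
  then obtain gs where gs: "set gs \<subseteq> grig_gens \<omega>" "length gs \<le> length ws"
      "foldr (\<lambda>g h. h \<circ> g) gs id = ev \<omega> ws" by blast
  from gen_cases[of \<omega> l] show ?case
  proof
    assume "gen \<omega> l \<in> grig_gens \<omega>"
    then show ?thesis using gs by (intro exI[of _ "gen \<omega> l # gs"]) (simp add: ev_Cons comp_def id_def del: ev.simps)
  next
    assume "gen \<omega> l = id"
    then show ?thesis using gs by (intro exI[of _ gs]) (simp add: ev_Cons comp_def id_def del: ev.simps)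
  qed
qed

lemma inv_grig_gens:
  assumes "g \<in> grig_gens \<omega>"
  shows "inv\<^bsub>tree_aut\<^esub> g = g" "inv\<^bsub>grig \<omega>\<^esub> g = g"
proof -
  obtain l where l: "g = gen \<omega> l" using grig_gens_gen[OF assms] by blast
  then have 1: "g \<circ> g = id" by (auto simp: gen_invol)
  have g: "g \<in> carrier tree_aut" using assms grig_gens_subset by blast
  show "inv\<^bsub>tree_aut\<^esub> g = g"
    by (rule group.inv_equality[OF tree_aut_group _ g g]) (use 1 in \<open>simp add: tree_aut_def\<close>)
  have g': "g \<in> carrier (grig \<omega>)" using assms by (simp add: grig_def generate.incl)
  show "inv\<^bsub>grig \<omega>\<^esub> g = g"
    by (rule group.inv_equality[OF grig_group _ g' g']) (use 1 in simp)
qed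

lemma carrier_grig: "carrier (grig \<omega>) = range (ev \<omega>)"
proof
  have "\<exists>ws. g = ev \<omega> ws" if "g \<in> generate tree_aut (grig_gens \<omega>)" for g
    using that
  proof (induction rule: generate.induct)
    case one then show ?case by (auto simp: tree_aut_def intro!: exI[of _ "[]"])
  next
    case (incl h) then obtain l where "h = gen \<omega> l" using grig_gens_gen by blast
    then show ?case by (intro exI[of _ "[l]"]) auto
  next
    case (inv h) then obtain l where "h = gen \<omega> l" using grig_gens_gen by blast
    then show ?case using inv inv_grig_gens(1) by (intro exI[of _ "[l]"]) auto
  next
    case (eng h1 h2)
    then obtain u v where "h1 = ev \<omega> u" "h2 = ev \<omega> v" by blast
    then show ?case by (intro exI[of _ "u @ v"]) (auto simp: ev_append tree_aut_def)
  qed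
  then show "carrier (grig \<omega>) \<subseteq> range (ev \<omega>)" by (auto simp: grig_def)
next
  have one: "one tree_aut = id" and mult: "mult tree_aut = (\<lambda>g h. h \<circ> g)"
    by (simp_all add: tree_aut_def)
  have "ev \<omega> ws \<in> generate tree_aut (grig_gens \<omega>)" for ws
  proof (induction ws)
    case Nil then show ?case
      using generate.one[of tree_aut "grig_gens \<omega>"] by (metis one ev_Nil)
  next
    case (Cons l ws)
    have "gen \<omega> l \<in> generate tree_aut (grig_gens \<omega>)"
      using gen_cases[of \<omega> l] generate.incl[of "gen \<omega> l" _ tree_aut]
        generate.one[of tree_aut "grig_gens \<omega>"] by (metis one)
    from generate.eng[OF this Cons] show ?case unfolding mult ev_Cons .
  qed
  then show "range (ev \<omega>) \<subseteq> carrier (grig \<omega>)" by (auto simp: grig_def)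
qed

text \<open>
  The generators are involutions, so words need no inverse letters, and deleting trivial letters only
  shortens a word.
\<close>
lemma growth_eq: "growth (grig \<omega>) (grig_gens \<omega>) n = card (ev \<omega> ` {ws. length ws \<le> n})"
proof -
  let ?S = "grig_gens \<omega> \<union> m_inv (grig \<omega>) ` grig_gens \<omega>"
  let ?P = "\<lambda>g m. \<exists>gs. set gs \<subseteq> ?S \<and> length gs = m \<and> foldr (mult (grig \<omega>)) gs (one (grig \<omega>)) = g"
  have S: "?S = grig_gens \<omega>" using inv_grig_gens(2) by fastforce
  have wl: "word_length (grig \<omega>) (grig_gens \<omega>) g = (LEAST m. ?P g m)" for g
    by (simp add: word_length_def)
  have "{g \<in> carrier (grig \<omega>). word_length (grig \<omega>) (grig_gens \<omega>) g \<le> n}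
        = ev \<omega> ` {ws. length ws \<le> n}" (is "?A = ?B")
  proof
    show "?A \<subseteq> ?B"
    proof
      fix g assume g: "g \<in> ?A"
      then obtain ws where "g = ev \<omega> ws" by (auto simp: carrier_grig)
      then have "\<exists>m. ?P g m" using ev_foldr_gens[of \<omega> ws] unfolding S by auto
      then have "?P g (LEAST m. ?P g m)" by (rule LeastI_ex)
      then obtain gs where gs: "set gs \<subseteq> grig_gens \<omega>" "length gs \<le> n"
         "foldr (\<lambda>g h. h \<circ> g) gs id = g" using g unfolding wl S by auto
      then show "g \<in> ?B" using foldr_gens_ev[OF gs(1)] by auto
    qed
    show "?B \<subseteq> ?A"
    proof
      fix g assume "g \<in> ?B"
      then obtain ws where ws: "g = ev \<omega> ws" "length ws \<le> n" by auto
      obtain gs where gs: "set gs \<subseteq> grig_gens \<omega>" "length gs \<le> length ws"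
        "foldr (\<lambda>g h. h \<circ> g) gs id = g" using ev_foldr_gens ws by blast
      then have "?P g (length gs)" unfolding S by auto
      then have "(LEAST m. ?P g m) \<le> length gs" by (rule Least_le)
      then show "g \<in> ?A" using gs ws unfolding wl by (auto simp: carrier_grig)
    qed
  qed
  then show ?thesis by (simp add: growth_def)
qed

instance klein :: finite
proof
  have "UNIV = {K_id, K_b, K_c, K_d}" using klein.exhaust by auto
  then show "finite (UNIV :: klein set)" by (metis finite.simps)
qed

lemma card_klein_option: "card (UNIV :: klein option set) = 5"
proof -
  have "UNIV = {K_id, K_b, K_c, K_d}" using klein.exhaust by auto
  then have "card (UNIV :: klein set) = card {K_id, K_b, K_c, K_d}" by metis
  then have "card (UNIV :: klein set) = 4" by simp
  then show ?thesis by (simp add: UNIV_option_conv card_image)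
qed

lemma finite_words: "finite {ws :: klein option list. length ws \<le> n}"
  using finite_lists_length_le[of "UNIV :: klein option set" n] by simp

section \<open>Sections and their weights\<close>

definition twist :: "bool \<Rightarrow> word \<Rightarrow> word" where
  "twist e = (if e then aut_a else id)"

lemma twist_simps [simp]: "twist False p = p" "twist True p = aut_a p"
  "twist e [] = []" "twist e (i # q) = (i \<noteq> e) # q"
  by (auto simp: twist_def)

lemma twist_invol [simp]: "twist e (twist e p) = p"
  by (auto simp: twist_def aut_a_invol)

text \<open>
  The product \<open>a x\<^sub>1 a x\<^sub>2 \<dots> a x\<^sub>m\<close>, leftmost factor first.
\<close>
primrec act :: "(nat \<Rightarrow> letter) \<Rightarrow> klein list \<Rightarrow> word \<Rightarrow> word" where
  "act \<omega> [] p = p"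
| "act \<omega> (x # xs) p = act \<omega> xs (klein_aut \<omega> x (aut_a p))"

lemma act_append: "act \<omega> (xs @ ys) p = act \<omega> ys (act \<omega> xs p)"
  by (induction xs arbitrary: p) auto

definition weight :: "(klein option \<Rightarrow> real) \<Rightarrow> klein option list \<Rightarrow> real" where
  "weight wt ws = (\<Sum>l\<leftarrow>ws. wt l)"

lemma weight_simps [simp]: "weight wt [] = 0" "weight wt (l # ws) = wt l + weight wt ws"
  "weight wt (us @ ws) = weight wt us + weight wt ws"
  by (auto simp: weight_def)

text \<open>
  Cancelling \<open>a a\<close> and multiplying adjacent Klein letters does not increase the weight, by the
  triangle inequality. Each letter \<open>x\<close> is charged together with one \<open>a\<close>; as only \<open>m - 1\<close> letters \<open>a\<close>
  need occur between \<open>m\<close> Klein letters, one weight of \<open>a\<close> is left over on the right.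
\<close>
lemma alternating_form:
  fixes wt :: "klein option \<Rightarrow> real"
  assumes tri: "\<And>x y. wt (Some (klein_mult x y)) \<le> wt (Some x) + wt (Some y)"
    and a: "wt None \<ge> 0"
  shows "\<exists>e xs f. (\<forall>p. ev \<omega> ws p = twist f (act \<omega> xs (twist e p))) \<and>
     (\<Sum>x\<leftarrow>xs. wt (Some x) + wt None) \<le> weight wt ws + wt None"
proof -
  \<comment> \<open>A leading \<open>a\<close> is credited against the first letter of \<open>xs\<close>, so an empty \<open>xs\<close> keeps its \<open>a\<close> in \<open>f\<close>.\<close>
  have "\<exists>e xs f. (\<forall>p. ev \<omega> ws p = twist f (act \<omega> xs (twist e p))) \<and> (xs = [] \<longrightarrow> \<not> e) \<and>
     (\<Sum>x\<leftarrow>xs. wt (Some x) + wt None) + (if f then wt None else 0)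
       \<le> weight wt ws + (if e then wt None else 0)" (is "\<exists>e xs f. ?P ws e xs f")
  proof (induction ws rule: rev_induct)
    case Nil
    have "?P [] False [] False" by auto
    then show ?case by blast
  next
    case (snoc l ws)
    then obtain e xs f where IH: "?P ws e xs f" by blast
    show ?case
    proof (cases l)
      case None
      have "?P (ws @ [l]) e xs (\<not> f)"
        using IH None a by (auto simp: ev_append aut_a_invol)
      then show ?thesis by blast
    next
      case (Some y)
      show ?thesis
      proof (cases f)
        case True
        have "?P (ws @ [l]) e (xs @ [y]) False"
          using IH Some True a by (auto simp: ev_append act_append)
        then show ?thesis by blast
      next
        case f: False
        show ?thesis
        proof (cases xs rule: rev_cases)
          case Nil
          have "?P (ws @ [l]) True [y] False"
            using IH Some f Nil a by (auto simp: ev_append aut_a_invol)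
          then show ?thesis by blast
        next
          case (snoc xs' z)
          have "?P (ws @ [l]) e (xs' @ [klein_mult z y]) False"
            using IH Some f snoc tri[of z y] by (auto simp: ev_append act_append klein_aut_mult)
          then show ?thesis by blast
        qed
      qed
    qed
  qed
  then obtain e xs f where P: "?P ws e xs f" by blast
  show ?thesis
    by (rule exI[of _ e], rule exI[of _ xs], rule exI[of _ f])
       (use P a in \<open>auto split: if_splits\<close>)
qed

definition hom_letter :: "letter \<Rightarrow> klein \<Rightarrow> klein option" where
  "hom_letter l x = (if x = K_id \<or> x = vanishes_on l then Some K_id else None)"

lemma gen_hom_letter: "gen \<omega> (hom_letter l x) = letter_hom l x"
  by (auto simp: hom_letter_def letter_hom_def fun_eq_iff)

text \<open>
  In \<open>act\<close> the root bit is toggled before every letter. The section at the vertex \<open>i\<close> therefore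
  receives in turn the letters themselves, when the bit is \<open>True\<close>, and their images under the
  homomorphism of the current level.
\<close>
primrec act_section :: "letter \<Rightarrow> bool \<Rightarrow> klein list \<Rightarrow> klein option list" where
  "act_section l i [] = []"
| "act_section l i (x # xs) = (if i then hom_letter l x else Some x) # act_section l (\<not> i) xs"

lemma act_Cons: "act \<omega> xs (i # q) = (i \<noteq> odd (length xs)) # ev (shift \<omega>) (act_section (\<omega> 0) i xs) q"
  by (induction xs arbitrary: i q) (auto simp: gen_hom_letter)

lemma act_section_weight:
  "weight wt (act_section l i xs) + weight wt (act_section l (\<not> i) xs)
     = (\<Sum>x\<leftarrow>xs. wt (Some x) + wt (hom_letter l x))"
proof (induction xs arbitrary: i)
  case (Cons x xs)
  show ?case using Cons.IH[of i] by (cases i) simp_all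
qed simp

text \<open>
  The contraction step. A letter together with one \<open>a\<close> leaves one letter in one section and at most
  one \<open>a\<close> in the other; \<open>contr\<close> says that these weigh less by the factor \<open>\<kappa>\<close>.
\<close>
lemma section_words:
  fixes wt wt' :: "klein option \<Rightarrow> real"
  assumes tri: "\<And>x y. wt (Some (klein_mult x y)) \<le> wt (Some x) + wt (Some y)"
    and a: "wt None \<ge> 0" and k: "\<kappa> \<ge> 0"
    and contr: "\<And>x. wt' (Some x) + wt' (hom_letter (\<omega> 0) x) \<le> \<kappa> * (wt (Some x) + wt None)"
  shows "\<exists>t w. (\<forall>i q. ev \<omega> ws (i # q) = (i \<noteq> t) # ev (shift \<omega>) (w i) q) \<and>
     weight wt' (w False) + weight wt' (w True) \<le> \<kappa> * (weight wt ws + wt None)"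
proof -
  obtain e xs f where ev: "\<And>p. ev \<omega> ws p = twist f (act \<omega> xs (twist e p))"
    and le: "(\<Sum>x\<leftarrow>xs. wt (Some x) + wt None) \<le> weight wt ws + wt None"
    using alternating_form[of wt \<omega> ws, OF tri a] by blast
  define w where "w i = act_section (\<omega> 0) (i \<noteq> e) xs" for i
  have "weight wt' (w False) + weight wt' (w True)
        = (\<Sum>x\<leftarrow>xs. wt' (Some x) + wt' (hom_letter (\<omega> 0) x))"
    using act_section_weight[of wt' "\<omega> 0" e xs] by (simp add: w_def)
  also have "\<dots> \<le> (\<Sum>x\<leftarrow>xs. \<kappa> * (wt (Some x) + wt None))"
    by (intro sum_list_mono contr)
  also have "\<dots> = \<kappa> * (\<Sum>x\<leftarrow>xs. wt (Some x) + wt None)" by (rule sum_list_const_mult)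
  also have "\<dots> \<le> \<kappa> * (weight wt ws + wt None)" using le k by (rule mult_left_mono)
  finally have "weight wt' (w False) + weight wt' (w True) \<le> \<kappa> * (weight wt ws + wt None)" .
  moreover have "ev \<omega> ws (i # q) = (i \<noteq> (e \<noteq> (odd (length xs) \<noteq> f))) # ev (shift \<omega>) (w i) q" for i q
    by (auto simp: ev act_Cons w_def)
  ultimately show ?thesis by blast
qed

definition sec :: "bool \<Rightarrow> (word \<Rightarrow> word) \<Rightarrow> word \<Rightarrow> word" where
  "sec i g q = tl (g (i # q))"

definition len :: "(nat \<Rightarrow> letter) \<Rightarrow> (word \<Rightarrow> word) \<Rightarrow> nat" where
  "len \<omega> g = (LEAST n. \<exists>ws. length ws = n \<and> ev \<omega> ws = g)"

primrec total_len :: "nat \<Rightarrow> (nat \<Rightarrow> letter) \<Rightarrow> (word \<Rightarrow> word) \<Rightarrow> nat" where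
  "total_len 0 \<omega> g = len \<omega> g"
| "total_len (Suc k) \<omega> g = total_len k (shift \<omega>) (sec False g) + total_len k (shift \<omega>) (sec True g)"

lemma len_le: "len \<omega> (ev \<omega> ws) \<le> length ws"
  unfolding len_def by (rule Least_le) auto

lemma len_word: "g \<in> range (ev \<omega>) \<Longrightarrow> \<exists>ws. length ws = len \<omega> g \<and> ev \<omega> ws = g"
  unfolding len_def by (rule LeastI_ex) auto

lemma root_and_sections:
  assumes "g \<in> range (ev \<omega>)"
  shows "\<exists>t. \<forall>i q. g (i # q) = (i \<noteq> t) # sec i g q" "sec i g \<in> range (ev (shift \<omega>))" "g [] = []"
proof -
  obtain ws where g: "g = ev \<omega> ws" using assms by blast
  obtain t w where t: "\<And>i q. ev \<omega> ws (i # q) = (i \<noteq> t) # ev (shift \<omega>) (w i) q"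
    using section_words[of "\<lambda>_. 0" 0 "\<lambda>_. 0" \<omega> ws] by auto
  have s: "sec i g = ev (shift \<omega>) (w i)" for i by (auto simp: sec_def g t)
  show "\<exists>t. \<forall>i q. g (i # q) = (i \<noteq> t) # sec i g q" unfolding s using t g by blast
  show "sec i g \<in> range (ev (shift \<omega>))" unfolding s by blast
  have "gen \<omega> l [] = []" for l by (cases l) auto
  then have "ev \<omega> ws [] = []" by (induction ws) auto
  then show "g [] = []" by (simp add: g)
qed

lemma sum_words_pow:
  "(\<Sum>ws \<in> {ws :: klein option list. length ws \<le> n}. (1/10::real) ^ length ws) \<le> 2"
proof -
  have "(\<Sum>ws \<in> {ws :: klein option list. length ws \<le> n}. (1/10::real) ^ length ws)
     = (\<Sum>m\<in>{..n}. \<Sum>ws | ws \<in> {ws :: klein option list. length ws \<le> n} \<and> length ws = m. (1/10) ^ length ws)"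
    by (rule sum.group[symmetric]) (auto simp: finite_words)
  also have "\<dots> = (\<Sum>m\<in>{..n}. (1/2) ^ m)"
  proof (rule sum.cong[OF refl])
    fix m assume m: "m \<in> {..n}"
    have "{ws. ws \<in> {ws :: klein option list. length ws \<le> n} \<and> length ws = m}
        = {ws. set ws \<subseteq> UNIV \<and> length ws = m}" using m by auto
    moreover have "card {ws :: klein option list. set ws \<subseteq> UNIV \<and> length ws = m} = 5 ^ m"
      using card_lists_length_eq[of "UNIV :: klein option set" m] by (simp add: card_klein_option)
    ultimately show "(\<Sum>ws | ws \<in> {ws :: klein option list. length ws \<le> n} \<and> length ws = m. (1/10) ^ length ws)
         = (1/2::real) ^ m" by (simp add: power_divide power_mult_distrib[symmetric])
       (simp add: power_mult_distrib[symmetric] field_simps)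
  qed
  also have "\<dots> = 2 - (1/2) ^ n" by (induction n) auto
  also have "\<dots> \<le> 2" by simp
  finally show ?thesis .
qed

text \<open>
  A generating function evaluated at \<open>1/10\<close>: there are \<open>5\<^bsup>n\<^esup>\<close> words of length \<open>n\<close>, so words alone
  contribute at most \<open>2\<close>. An element is determined by its action on the first level and its two
  sections, hence a bound \<open>B\<close> at one level becomes \<open>2 B\<^sup>2\<close> at the previous one.
\<close>
lemma sum_total_len_pow:
  assumes "finite A" "A \<subseteq> range (ev \<omega>)"
  shows "(\<Sum>g\<in>A. (1/10::real) ^ total_len k \<omega> g) \<le> 2 ^ (2 ^ Suc k - 1)"
  using assms
proof (induction k arbitrary: \<omega> A)
  case 0
  have "\<forall>g\<in>A. \<exists>ws. length ws = len \<omega> g \<and> ev \<omega> ws = g" using 0 len_word by blast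
  then obtain w where w: "\<And>g. g \<in> A \<Longrightarrow> length (w g) = len \<omega> g \<and> ev \<omega> (w g) = g" by metis
  have inj: "inj_on w A" by (rule inj_onI) (metis w)
  define N where "N = Max (len \<omega> ` A)"
  have "(\<Sum>g\<in>A. (1/10::real) ^ total_len 0 \<omega> g) = (\<Sum>ws\<in>w ` A. (1/10) ^ length ws)"
    using w by (simp add: sum.reindex[OF inj])
  also have "\<dots> \<le> (\<Sum>ws \<in> {ws :: klein option list. length ws \<le> N}. (1/10) ^ length ws)"
    by (intro sum_mono2 finite_words) (use 0 w in \<open>auto simp: N_def\<close>)
  also have "\<dots> \<le> 2" by (rule sum_words_pow)
  finally show ?case by simp
next
  case (Suc k)
  let ?B = "\<lambda>i. sec i ` A"
  let ?f = "\<lambda>g. (1/10::real) ^ total_len k (shift \<omega>) g"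
  let ?h = "\<lambda>g. (g [False] = [True], sec False g, sec True g)"
  have B: "finite (?B i)" "?B i \<subseteq> range (ev (shift \<omega>))" for i
    using Suc.prems root_and_sections(2) by blast+
  have inj: "inj_on ?h A"
  proof (rule inj_onI, rule ext)
    fix g h p assume gh: "g \<in> A" "h \<in> A" "?h g = ?h h"
    obtain t where t: "\<And>i q. g (i # q) = (i \<noteq> t) # sec i g q"
      using root_and_sections(1) gh(1) Suc.prems(2) by (meson subsetD)
    obtain u where u: "\<And>i q. h (i # q) = (i \<noteq> u) # sec i h q"
      using root_and_sections(1) gh(2) Suc.prems(2) by (meson subsetD)
    have n: "g [] = []" "h [] = []" using root_and_sections(3) gh(1,2) Suc.prems(2) by blast+
    have "sec i g = sec i h" for i using gh(3) by (cases i) auto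
    moreover have "sec False g [] = []" "sec False h [] = []"
      using root_and_sections(2,3) gh(1,2) Suc.prems(2) by (meson subsetD)+
    then have "t = u" using gh(3) t[of False "[]"] u[of False "[]"] by auto
    ultimately show "g p = h p" using n t u by (cases p) auto
  qed
  have "(\<Sum>g\<in>A. (1/10::real) ^ total_len (Suc k) \<omega> g)
      = (\<Sum>(t, g0, g1)\<in>?h ` A. ?f g0 * ?f g1)"
    by (simp add: sum.reindex[OF inj] power_add)
  also have "\<dots> \<le> (\<Sum>(t, g0, g1)\<in>(UNIV :: bool set) \<times> ?B False \<times> ?B True. ?f g0 * ?f g1)"
    by (intro sum_mono2) (use B in auto)
  also have "\<dots> = 2 * ((\<Sum>g\<in>?B False. ?f g) * (\<Sum>g\<in>?B True. ?f g))"
    by (simp add: sum.cartesian_product[symmetric] sum_product UNIV_bool)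
  also have "\<dots> \<le> 2 * (2 ^ (2 ^ Suc k - 1) * 2 ^ (2 ^ Suc k - 1))"
    by (intro mult_left_mono mult_mono Suc.IH B sum_nonneg) auto
  also have "\<dots> = 2 ^ (2 ^ Suc (Suc k) - 1)"
  proof -
    have "(2::nat) ^ Suc (Suc k) - 1 = Suc ((2 ^ Suc k - 1) + (2 ^ Suc k - 1))"
      unfolding power_Suc using one_le_power[of "2::nat" k] by arith
    then show ?thesis by (simp only: power_Suc power_add)
  qed
  finally show ?case .
qed

lemma card_total_len_le:
  assumes "finite A" "A \<subseteq> range (ev \<omega>)" "\<And>g. g \<in> A \<Longrightarrow> real (total_len k \<omega> g) \<le> S"
  shows "real (card A) \<le> 10 powr S * 2 powr (2 * 2 ^ k)"
proof -
  have "real (card A) * 10 powr (- S) = (\<Sum>g\<in>A. 10 powr (- S))" by simp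
  also have "\<dots> \<le> (\<Sum>g\<in>A. (1/10) ^ total_len k \<omega> g)"
  proof (rule sum_mono)
    fix g assume "g \<in> A"
    then have "10 powr (- S) \<le> 10 powr (- real (total_len k \<omega> g))" using assms(3) by simp
    also have "\<dots> = (1/10::real) ^ total_len k \<omega> g"
      by (simp add: powr_minus powr_realpow power_one_over inverse_eq_divide)
    finally show "10 powr (- S) \<le> (1/10::real) ^ total_len k \<omega> g" .
  qed
  also have "\<dots> \<le> 2 ^ (2 ^ Suc k - 1)" by (rule sum_total_len_pow[OF assms(1,2)])
  also have "\<dots> \<le> 2 ^ (2 ^ Suc k)" by (intro power_increasing) auto
  also have "\<dots> = 2 powr (2 * 2 ^ k)" using powr_realpow[of 2 "2 ^ Suc k"] by simp
  finally have "real (card A) * 10 powr (- S) * 10 powr S \<le> 2 powr (2 * 2 ^ k) * 10 powr S"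
    by (rule mult_right_mono) simp
  moreover have "real (card A) * 10 powr (- S) * 10 powr S = real (card A)"
    by (simp add: powr_minus)
  ultimately show ?thesis by (metis mult.commute)
qed

section \<open>The upper bound\<close>

text \<open>
  The contraction factor per level along \<open>012\<close>.
\<close>
definition eta :: real where "eta = 2 / lambda0"

lemma lambda0_root: "lambda0 > 0" "lambda0 ^ 3 - lambda0 ^ 2 - 2 * lambda0 - 4 = 0"
  using theI'[OF ex1_lambda0] by (auto simp: lambda0_def)

lemma eta_pos: "eta > 0" by (simp add: eta_def lambda0_root)

lemma eta_cubic: "eta ^ 3 + eta ^ 2 + eta = 2"
proof -
  have "eta * lambda0 = 2" using lambda0_root(1) by (simp add: eta_def)
  then have "eta ^ 3 * lambda0 ^ 3 = 2 ^ 3" "eta ^ 2 * lambda0 ^ 2 = 2 ^ 2" "eta * lambda0 = 2"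
    by (metis power_mult_distrib)+
  then have "eta ^ 3 * lambda0 ^ 3 = 8" "eta ^ 2 * lambda0 ^ 3 = 4 * lambda0" "eta * lambda0 ^ 3 = 2 * lambda0 ^ 2"
    by (simp_all add: power3_eq_cube power2_eq_square flip: mult.assoc)
  then have "(eta ^ 3 + eta ^ 2 + eta) * lambda0 ^ 3 = 2 * lambda0 ^ 3"
    using lambda0_root(2) by (simp add: distrib_right)
  then show ?thesis using lambda0_root(1) by simp
qed

lemma eta_bounds: "4/5 < eta" "eta < 5/6"
proof -
  show "4/5 < eta"
  proof (rule ccontr)
    assume *: "\<not> 4/5 < eta"
    then have "eta ^ 3 \<le> (4/5) ^ 3" "eta ^ 2 \<le> (4/5) ^ 2"
      using eta_pos by (intro power_mono; simp)+
    then show False using eta_cubic * by (simp add: power_divide)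
  qed
  show "eta < 5/6"
  proof (rule ccontr)
    assume *: "\<not> eta < 5/6"
    then have "eta ^ 3 \<ge> (5/6) ^ 3" "eta ^ 2 \<ge> (5/6) ^ 2"
      by (intro power_mono; simp)+
    then show False using eta_cubic * by (simp add: power_divide)
  qed
qed

definition omega :: "(nat \<Rightarrow> bool) \<Rightarrow> nat \<Rightarrow> letter" where
  "omega \<tau> n = (if \<tau> (n div 3) then (if n mod 3 = 0 then L0 else if n mod 3 = 1 then L1 else L2) else L0)"

definition drop_triple :: "(nat \<Rightarrow> bool) \<Rightarrow> nat \<Rightarrow> bool" where "drop_triple \<tau> = (\<lambda>q. \<tau> (Suc q))"

lemma shift_omega: "shift (shift (shift (omega \<tau>))) = omega (drop_triple \<tau>)"
proof
  fix n
  have "Suc (Suc (Suc n)) = n + 3" by simp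
  then show "shift (shift (shift (omega \<tau>))) n = omega (drop_triple \<tau>) n"
    unfolding shift_def omega_def drop_triple_def by (simp only: div_add_self2 mod_add_self2) simp
qed

lemma omega_first: "omega \<tau> 0 = L0" "shift (omega \<tau>) 0 = (if \<tau> 0 then L1 else L0)"
  "shift (shift (omega \<tau>)) 0 = (if \<tau> 0 then L2 else L0)"
  by (auto simp: omega_def shift_def)

primrec count_012 :: "(nat \<Rightarrow> bool) \<Rightarrow> nat \<Rightarrow> nat" where
  "count_012 \<tau> 0 = 0"
| "count_012 \<tau> (Suc I) = (if \<tau> 0 then 1 else 0) + count_012 (drop_triple \<tau>) I"

primrec switches :: "(nat \<Rightarrow> bool) \<Rightarrow> nat \<Rightarrow> nat" where
  "switches \<tau> 0 = 0"
| "switches \<tau> (Suc I) = (if \<tau> 0 \<noteq> \<tau> 1 then 1 else 0) + switches (drop_triple \<tau>) I"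

fun letter_weights :: "real \<Rightarrow> real \<Rightarrow> real \<Rightarrow> real \<Rightarrow> klein option \<Rightarrow> real" where
  "letter_weights wa wb wc wd None = wa"
| "letter_weights wa wb wc wd (Some K_id) = 0"
| "letter_weights wa wb wc wd (Some K_b) = wb"
| "letter_weights wa wb wc wd (Some K_c) = wc"
| "letter_weights wa wb wc wd (Some K_d) = wd"

lemma letter_weights_mult:
  assumes "wb \<ge> 0" "wc \<ge> 0" "wd \<ge> 0" "wb \<le> wc + wd" "wc \<le> wb + wd" "wd \<le> wb + wc"
  shows "letter_weights wa wb wc wd (Some (klein_mult x y))
     \<le> letter_weights wa wb wc wd (Some x) + letter_weights wa wb wc wd (Some y)"
  using assms by (cases x; cases y) (auto simp: klein_mult_def doubleton_eq_iff)

lemma total_len_step: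
  fixes wt wt' :: "klein option \<Rightarrow> real"
  assumes tri: "\<And>x y. wt (Some (klein_mult x y)) \<le> wt (Some x) + wt (Some y)"
    and a: "0 \<le> wt None" "wt None \<le> 1" and k: "0 \<le> \<kappa>" "\<kappa> \<le> 1"
    and contr: "\<And>x. wt' (Some x) + wt' (hom_letter (\<omega> 0) x) \<le> \<kappa> * (wt (Some x) + wt None)"
    and A: "A \<ge> 0"
    and H: "\<And>ws. real (total_len k (shift \<omega>) (ev (shift \<omega>) ws)) \<le> A * weight wt' ws + B"
  shows "real (total_len (Suc k) \<omega> (ev \<omega> ws)) \<le> A * \<kappa> * weight wt ws + (A + 2 * B)"
proof -
  obtain t w where t: "\<And>i q. ev \<omega> ws (i # q) = (i \<noteq> t) # ev (shift \<omega>) (w i) q"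
    and le: "weight wt' (w False) + weight wt' (w True) \<le> \<kappa> * (weight wt ws + wt None)"
    using section_words[of wt \<kappa> wt' \<omega> ws, OF tri a(1) k(1) contr] by blast
  have s: "sec i (ev \<omega> ws) = ev (shift \<omega>) (w i)" for i by (auto simp: sec_def t)
  have "real (total_len (Suc k) \<omega> (ev \<omega> ws))
      \<le> (A * weight wt' (w False) + B) + (A * weight wt' (w True) + B)"
    using H[of "w False"] H[of "w True"] by (simp add: s)
  also have "\<dots> = A * (weight wt' (w False) + weight wt' (w True)) + 2 * B"
    by (simp add: algebra_simps)
  also have "\<dots> \<le> A * (\<kappa> * (weight wt ws + wt None)) + 2 * B"
    using mult_left_mono[OF le A] by simp
  also have "\<dots> = A * \<kappa> * weight wt ws + A * (\<kappa> * wt None) + 2 * B"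
    by (simp add: algebra_simps)
  also have "A * (\<kappa> * wt None) \<le> A * 1"
    using A a k by (intro mult_left_mono mult_le_one) auto
  finally show ?thesis by simp
qed

text \<open>
  Bartholdi's weights at the first level of a triple \<open>012\<close>: the letter vanishing at this level
  weighs \<open>1 - \<eta>\<close>, the one vanishing next \<open>1 - \<eta>\<^sup>2\<close>, the last one \<open>\<eta>\<^sup>3\<close>, and \<open>a\<close> weighs
  \<open>1 - \<eta>\<^sup>3\<close>. By the equation for \<open>\<eta>\<close>, passing to sections multiplies by \<open>\<eta>\<close> and rotates these roles.
  Along \<open>000\<close> the sections get no shorter in total, and plain length serves.
\<close>
definition triple_weight :: "bool \<Rightarrow> klein option \<Rightarrow> real" where
  "triple_weight t = (if t then letter_weights (1 - eta^3) (eta^3) (1 - eta^2) (1 - eta)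
     else letter_weights 1 1 1 1)"

definition triple_rate :: "bool \<Rightarrow> real" where
  "triple_rate t = (if t then eta else 1)"

lemma eta_powers: "eta ^ 2 < eta" "eta ^ 3 < eta ^ 2" "0 < eta ^ 3" "eta ^ 3 < 5/6"
proof -
  show *: "eta ^ 2 < eta" "eta ^ 3 < eta ^ 2" "0 < eta ^ 3"
    using eta_bounds eta_pos power_strict_decreasing[of 1 2 eta] power_strict_decreasing[of 2 3 eta]
    by auto
  show "eta ^ 3 < 5/6" using * eta_bounds by linarith
qed

text \<open>
  Three contraction steps; for \<open>012\<close> the weights are back in their initial position after the third.
\<close>
lemma total_len_triple:
  assumes A: "A \<ge> 0"
    and H: "\<And>ws. real (total_len k (omega (drop_triple \<tau>)) (ev (omega (drop_triple \<tau>)) ws))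
         \<le> A * weight (triple_weight (\<tau> 0)) ws + B"
  shows "real (total_len (k + 3) (omega \<tau>) (ev (omega \<tau>) ws))
      \<le> A * triple_rate (\<tau> 0) ^ 3 * weight (triple_weight (\<tau> 0)) ws + (8 * B + 7 * A)"
proof (cases "\<tau> 0")
  case True
  let ?w0 = "letter_weights (1 - eta^3) (eta^3) (1 - eta^2) (1 - eta)"
  let ?w1 = "letter_weights (1 - eta^3) (1 - eta^2) (1 - eta) (eta^3)"
  let ?w2 = "letter_weights (1 - eta^3) (1 - eta) (eta^3) (1 - eta^2)"
  note e = eta_bounds eta_powers eta_cubic
  have c: "eta * (2 - eta^2 - eta^3) = eta^2" "eta * (2 - eta - eta^3) = eta^3"
  proof -
    have "2 - eta^2 - eta^3 = eta" "2 - eta - eta^3 = eta^2" using eta_cubic by linarith+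
    then show "eta * (2 - eta^2 - eta^3) = eta^2" "eta * (2 - eta - eta^3) = eta^3"
      by (simp_all only: power2_eq_square power3_eq_cube)
  qed
  have 0: "?w1 (Some x) + ?w1 (hom_letter L0 x) \<le> eta * (?w0 (Some x) + ?w0 None)" for x
    using c e by (cases x) (auto simp: hom_letter_def algebra_simps)
  have 1: "?w2 (Some x) + ?w2 (hom_letter L1 x) \<le> eta * (?w1 (Some x) + ?w1 None)" for x
    using c e by (cases x) (auto simp: hom_letter_def algebra_simps)
  have 2: "?w0 (Some x) + ?w0 (hom_letter L2 x) \<le> eta * (?w2 (Some x) + ?w2 None)" for x
    using c e by (cases x) (auto simp: hom_letter_def algebra_simps)
  have H2: "real (total_len (Suc k) (shift (shift (omega \<tau>))) (ev (shift (shift (omega \<tau>))) ws))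
     \<le> A * eta * weight ?w2 ws + (A + 2 * B)" for ws
    by (rule total_len_step[where wt' = ?w0 and wt = ?w2])
       (use e A 2 H True in \<open>auto intro!: letter_weights_mult simp: omega_first shift_omega triple_weight_def\<close>)
  have H1: "real (total_len (Suc (Suc k)) (shift (omega \<tau>)) (ev (shift (omega \<tau>)) ws))
     \<le> A * eta * eta * weight ?w1 ws + (A * eta + 2 * (A + 2 * B))" for ws
    by (rule total_len_step[where wt' = ?w2 and wt = ?w1])
       (use e A 1 H2 True in \<open>auto intro!: letter_weights_mult simp: omega_first\<close>)
  have H0: "real (total_len (Suc (Suc (Suc k))) (omega \<tau>) (ev (omega \<tau>) ws))
     \<le> A * eta * eta * eta * weight ?w0 ws + (A * eta * eta + 2 * (A * eta + 2 * (A + 2 * B)))" for ws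
    by (rule total_len_step[where wt' = ?w1 and wt = ?w0])
       (use e A 0 H1 True in \<open>auto intro!: letter_weights_mult simp: omega_first\<close>)
  have "A * eta \<le> A" "A * eta * eta \<le> A"
    using A e eta_pos by (auto intro!: mult_left_le mult_le_one simp: mult.assoc)
  moreover have k3: "k + 3 = Suc (Suc (Suc k))" by simp
  ultimately show ?thesis
    using H0[of ws] True unfolding k3 triple_weight_def triple_rate_def
    by (simp add: power3_eq_cube mult.assoc del: total_len.simps)
next
  case False
  let ?w = "letter_weights 1 1 1 1"
  have c: "?w (Some x) + ?w (hom_letter L0 x) \<le> 1 * (?w (Some x) + ?w None)" for x
    by (cases x) (auto simp: hom_letter_def)
  have H2: "real (total_len (Suc k) (shift (shift (omega \<tau>))) (ev (shift (shift (omega \<tau>))) ws))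
     \<le> A * 1 * weight ?w ws + (A + 2 * B)" for ws
    by (rule total_len_step[where wt' = ?w and wt = ?w])
       (use A c H False in \<open>auto intro!: letter_weights_mult simp: omega_first shift_omega triple_weight_def\<close>)
  have H1: "real (total_len (Suc (Suc k)) (shift (omega \<tau>)) (ev (shift (omega \<tau>)) ws))
     \<le> A * 1 * 1 * weight ?w ws + (A * 1 + 2 * (A + 2 * B))" for ws
    by (rule total_len_step[where wt' = ?w and wt = ?w])
       (use A c H2 False in \<open>auto intro!: letter_weights_mult simp: omega_first\<close>)
  have H0: "real (total_len (Suc (Suc (Suc k))) (omega \<tau>) (ev (omega \<tau>) ws))
     \<le> A * 1 * 1 * 1 * weight ?w ws + (A * 1 * 1 + 2 * (A * 1 + 2 * (A + 2 * B)))" for ws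
    by (rule total_len_step[where wt' = ?w and wt = ?w])
       (use A c H1 False in \<open>auto intro!: letter_weights_mult simp: omega_first\<close>)
  moreover have k3: "k + 3 = Suc (Suc (Suc k))" by simp
  ultimately show ?thesis
    using H0[of ws] False unfolding k3 triple_weight_def triple_rate_def
    by (simp add: add.commute del: total_len.simps)
qed

lemma klein_option_cases:
  "l = None \<or> l = Some K_id \<or> l = Some K_b \<or> l = Some K_c \<or> l = Some K_d"
  by (metis klein.exhaust option.exhaust)

lemma triple_weight_bounds:
  "0 \<le> triple_weight t l" "triple_weight t l \<le> 1" "triple_weight t l \<le> 6 * triple_weight t' l"
proof -
  note e = eta_bounds eta_powers eta_cubic
  have "0 \<le> triple_weight t l \<and> triple_weight t l \<le> 1" for t
    using e klein_option_cases[of l] by (auto simp: triple_weight_def)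
  moreover have "triple_weight t l \<le> 6 * triple_weight t' l"
    using e klein_option_cases[of l] by (auto simp: triple_weight_def)
  ultimately show "0 \<le> triple_weight t l" "triple_weight t l \<le> 1"
     "triple_weight t l \<le> 6 * triple_weight t' l" by auto
qed

lemma weight_triple_bounds:
  "0 \<le> weight (triple_weight t) ws" "weight (triple_weight t) ws \<le> length ws"
  "weight (triple_weight t) ws \<le> 6 * weight (triple_weight t') ws"
proof -
  show "0 \<le> weight (triple_weight t) ws"
    by (induction ws) (auto intro: add_nonneg_nonneg triple_weight_bounds)
  show "weight (triple_weight t) ws \<le> length ws"
    by (induction ws) (use triple_weight_bounds(2) in \<open>auto intro: add_mono simp: add.commute\<close>)
  show "weight (triple_weight t) ws \<le> 6 * weight (triple_weight t') ws"
  proof (induction ws)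
    case (Cons l ws)
    then show ?case using triple_weight_bounds(3)[of t l t'] by simp
  qed simp
qed

lemma len_weight: "real (len \<omega> (ev \<omega> ws)) \<le> 6 * weight (triple_weight t) ws"
proof -
  have "\<exists>vs. ev \<omega> vs = ev \<omega> ws \<and> real (length vs) \<le> weight (triple_weight False) ws"
  proof (induction ws)
    case (Cons l ws)
    then obtain vs where vs: "ev \<omega> vs = ev \<omega> ws" "real (length vs) \<le> weight (triple_weight False) ws"
      by blast
    show ?case
    proof (cases "l = Some K_id")
      case True
      then show ?thesis using vs by (intro exI[of _ vs]) (auto simp: triple_weight_def fun_eq_iff)
    next
      case False
      then have "triple_weight False l = 1"
        using klein_option_cases[of l] by (auto simp: triple_weight_def)
      then show ?thesis using vs by (intro exI[of _ "l # vs"]) (auto simp: fun_eq_iff)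
    qed
  qed (auto intro!: exI[of _ "[]"])
  then obtain vs where vs: "ev \<omega> vs = ev \<omega> ws" "real (length vs) \<le> weight (triple_weight False) ws"
    by blast
  then show ?thesis
    using len_le[of \<omega> vs] weight_triple_bounds(3)[of False ws t] by auto
qed

text \<open>
  Between equal triples the weights match and nothing is lost. Each change of type costs the factor
  \<open>6\<close> by which the two systems of weights differ. The last summand collects the constants lost
  at each of the vertices above.
\<close>
lemma total_len_bound:
  "real (total_len (3 * I) (omega \<tau>) (ev (omega \<tau>) ws))
    \<le> 6 ^ Suc (switches \<tau> I) * eta ^ (3 * count_012 \<tau> I) * weight (triple_weight (\<tau> 0)) ws
      + 6 ^ Suc (switches \<tau> I) * (real I * 8 ^ I)"
proof (induction I arbitrary: \<tau> ws)
  case 0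
  then show ?case using len_weight by simp
next
  case (Suc I)
  let ?s = "switches (drop_triple \<tau>) I" and ?c = "count_012 (drop_triple \<tau>) I"
  define A where "A = 6 ^ Suc (switches \<tau> (Suc I)) * eta ^ (3 * ?c)"
  define B where "B = 6 ^ Suc ?s * (real I * 8 ^ I)"
  have A: "0 \<le> A" "A \<le> 6 ^ Suc (switches \<tau> (Suc I))"
    using eta_bounds by (auto simp: A_def power_le_one mult_left_le)
  have B: "B \<le> 6 ^ Suc (switches \<tau> (Suc I)) * (real I * 8 ^ I)"
    unfolding B_def by (intro mult_right_mono power_increasing) auto
  have H: "real (total_len (3 * I) (omega (drop_triple \<tau>)) (ev (omega (drop_triple \<tau>)) ws))
         \<le> A * weight (triple_weight (\<tau> 0)) ws + B" for ws
  proof -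
    have "6 ^ Suc ?s * eta ^ (3 * ?c) * weight (triple_weight (\<tau> 1)) ws
        \<le> A * weight (triple_weight (\<tau> 0)) ws"
    proof (cases "\<tau> 0 = \<tau> 1")
      case False
      then have "A * weight (triple_weight (\<tau> 0)) ws
         = 6 ^ Suc ?s * eta ^ (3 * ?c) * (6 * weight (triple_weight (\<tau> 0)) ws)"
        by (simp add: A_def)
      moreover have "6 ^ Suc ?s * eta ^ (3 * ?c) * weight (triple_weight (\<tau> 1)) ws \<le> \<dots>"
        using eta_pos by (intro mult_left_mono weight_triple_bounds) auto
      ultimately show ?thesis by (simp only:)
    qed (simp add: A_def)
    then show ?thesis using Suc.IH[of "drop_triple \<tau>" ws] by (simp add: drop_triple_def B_def)
  qed
  have "real (total_len (3 * I + 3) (omega \<tau>) (ev (omega \<tau>) ws))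
      \<le> A * triple_rate (\<tau> 0) ^ 3 * weight (triple_weight (\<tau> 0)) ws + (8 * B + 7 * A)"
    by (rule total_len_triple[OF A(1) H])
  moreover have "A * triple_rate (\<tau> 0) ^ 3
     = 6 ^ Suc (switches \<tau> (Suc I)) * eta ^ (3 * count_012 \<tau> (Suc I))"
    by (auto simp: A_def triple_rate_def power_add)
  moreover have "8 * B + 7 * A \<le> 6 ^ Suc (switches \<tau> (Suc I)) * (real (Suc I) * 8 ^ Suc I)"
  proof -
    have "6 ^ Suc (switches \<tau> (Suc I)) * 1 \<le> 6 ^ Suc (switches \<tau> (Suc I)) * (8 ^ I :: real)"
      by (rule mult_left_mono) auto
    then have "A \<le> 6 ^ Suc (switches \<tau> (Suc I)) * 8 ^ I" using A(2) by linarith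
    then have "8 * B + 7 * A \<le> 8 * (6 ^ Suc (switches \<tau> (Suc I)) * (real I * 8 ^ I))
      + 8 * (6 ^ Suc (switches \<tau> (Suc I)) * 8 ^ I)"
      using B A by linarith
    then show ?thesis by (simp add: algebra_simps)
  qed
  ultimately show ?case by (simp add: add.commute)
qed

text \<open>
  At this radius the contracted length \<open>\<eta>\<^bsup>3c\<^esup> n\<close> does not exceed the number \<open>8\<^bsup>I\<^esup>\<close> of sections.
\<close>
theorem growth_upper:
  assumes "real n \<le> 8 ^ I * (1 / eta ^ 3) ^ count_012 \<tau> I"
  shows "ln (real (growth (grig (omega \<tau>)) (grig_gens (omega \<tau>)) n))
    \<le> 5 * (real I + 1) * 6 ^ Suc (switches \<tau> I) * 8 ^ I"
proof -
  let ?\<omega> = "omega \<tau>" and ?s = "6 ^ Suc (switches \<tau> I) :: real"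
  define A where "A = ev ?\<omega> ` {ws. length ws \<le> n}"
  define S where "S = ?s * ((real I + 1) * 8 ^ I)"
  have "eta ^ (3 * count_012 \<tau> I) * real n \<le> 8 ^ I"
    using assms eta_pos by (simp add: power_mult power_one_over field_simps)
  then have n: "?s * (eta ^ (3 * count_012 \<tau> I) * real n) \<le> ?s * 8 ^ I"
    by (intro mult_left_mono) auto
  have "real (total_len (3 * I) ?\<omega> g) \<le> S" if gA: "g \<in> A" for g
  proof -
    obtain ws where ws: "g = ev ?\<omega> ws" "length ws \<le> n" using gA by (auto simp: A_def)
    have "real (total_len (3 * I) ?\<omega> g) \<le> ?s * eta ^ (3 * count_012 \<tau> I) * weight (triple_weight (\<tau> 0)) ws
      + ?s * (real I * 8 ^ I)" unfolding ws by (rule total_len_bound)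
    also have "\<dots> \<le> ?s * eta ^ (3 * count_012 \<tau> I) * real n + ?s * (real I * 8 ^ I)"
      using weight_triple_bounds(2)[of "\<tau> 0" ws] ws(2) eta_pos
      by (intro add_right_mono mult_left_mono) auto
    also have "\<dots> \<le> S" using n by (simp add: S_def algebra_simps)
    finally show ?thesis .
  qed
  moreover have "finite A" "A \<subseteq> range (ev ?\<omega>)" by (auto simp: A_def finite_words)
  ultimately have "real (card A) \<le> 10 powr S * 2 powr (2 * 2 ^ (3 * I))"
    by (intro card_total_len_le) auto
  moreover have "(2::real) ^ (3 * I) = 8 ^ I" by (simp add: power_mult)
  ultimately have le: "real (card A) \<le> 10 powr S * 2 powr (2 * 8 ^ I)" by simp
  have "[] \<in> {ws :: klein option list. length ws \<le> n}" by simp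
  then have "card A > 0" unfolding A_def card_gt_0_iff using finite_words by blast
  then have "ln (real (card A)) \<le> ln (10 powr S * 2 powr (2 * 8 ^ I))" using le by simp
  also have "\<dots> = S * ln 10 + 2 * 8 ^ I * ln 2" by (simp add: ln_mult ln_powr)
  also have "\<dots> \<le> S * 3 + 2 * 8 ^ I * 1"
  proof -
    have "ln (10::real) \<le> 3"
    proof -
      have "exp (1::real) ^ 3 \<ge> 2.5 ^ 3"
        using exp_lower_Taylor_quadratic[of 1] by (intro power_mono) auto
      then have "(10::real) \<le> exp 3" by (simp add: exp_of_nat_mult[symmetric] power_divide)
      then show ?thesis using ln_le_cancel_iff[of 10 "exp 3"] by simp
    qed
    moreover have "ln (2::real) \<le> 1" using ln_le_minus_one[of "2::real"] by simp
    ultimately show ?thesis by (intro add_mono mult_left_mono) (auto simp: S_def)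
  qed
  also have "8 ^ I \<le> S"
  proof -
    have "1 * (1 * 8 ^ I) \<le> ?s * ((real I + 1) * 8 ^ I)" 
      by (intro mult_mono) (auto simp: one_le_power simp del: power_Suc)
    then show ?thesis by (simp add: S_def)
  qed
  finally show ?thesis by (simp add: growth_eq A_def S_def algebra_simps)
qed

section \<open>Random subproducts\<close>

text \<open>
  Injective, length preserving and compatible with prefixes: what is needed of a tree automorphism
  in order to follow a path coordinate by coordinate.
\<close>
definition tree_map :: "(word \<Rightarrow> word) \<Rightarrow> bool" where
  "tree_map f \<longleftrightarrow> inj f \<and> (\<forall>p. length (f p) = length p) \<and> (\<forall>p n. take n (f p) = f (take n p))"

text \<open>
  For a tree map the image of \<open>w @ [False]\<close> decides whether the coordinate after \<open>w\<close> is changed,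
  as \<open>w @ [True]\<close> has the other image.
\<close>
definition flips :: "(word \<Rightarrow> word) \<Rightarrow> word \<Rightarrow> bool" where
  "flips f w = f (w @ [False]) ! length w"

lemma tree_map_length: "tree_map f \<Longrightarrow> length (f p) = length p" by (simp add: tree_map_def)
lemma tree_map_take: "tree_map f \<Longrightarrow> take n (f p) = f (take n p)" by (simp add: tree_map_def)

lemma tree_map_snoc:
  assumes "tree_map f"
  shows "f (w @ [x]) = f w @ [x \<noteq> flips f w]"
proof -
  have *: "f (w @ [y]) = f w @ [f (w @ [y]) ! length w]" for y
  proof -
    have l: "length (f (w @ [y])) = Suc (length w)" using assms tree_map_length by force
    have "take (length w) (f (w @ [y])) = f w" using tree_map_take[OF assms, of "length w"] by simp
    then show ?thesis using l
      by (metis lessI order_refl take_Suc_conv_app_nth take_all_iff)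
  qed
  have "f (w @ [True]) \<noteq> f (w @ [False])"
    using assms by (metis injD last_snoc tree_map_def)
  then have "f (w @ [True]) ! length w \<noteq> f (w @ [False]) ! length w"
    using *[of True] *[of False] by metis
  then show ?thesis using *[of x] by (cases x) (auto simp: flips_def)
qed

lemma tree_map_nth:
  assumes "tree_map f" "k < length p"
  shows "f p ! k = (p ! k \<noteq> flips f (take k p))"
proof -
  have "f p ! k = take (Suc k) (f p) ! k" by simp
  also have "\<dots> = f (take k p @ [p ! k]) ! k"
    by (simp add: tree_map_take[OF assms(1)] take_Suc_conv_app_nth[OF assms(2)])
  also have "\<dots> = (p ! k \<noteq> flips f (take k p))"
    using assms by (simp add: tree_map_snoc nth_append tree_map_length)
  finally show ?thesis .
qed

lemma tree_map_id: "tree_map id" by (simp add: tree_map_def)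
lemma tree_map_comp: "tree_map f \<Longrightarrow> tree_map g \<Longrightarrow> tree_map (f \<circ> g)"
  by (auto simp: tree_map_def intro: inj_compose)

lemma tree_map_surj:
  assumes "tree_map f" shows "surj f"
proof -
  have "\<exists>p. f p = w \<and> length p = length w" for w
  proof (induction w rule: rev_induct)
    case Nil then show ?case using tree_map_length[OF assms, of "[]"] by auto
  next
    case (snoc x w)
    then obtain p where "f p = w" "length p = length w" by blast
    then show ?case by (intro exI[of _ "p @ [x \<noteq> flips f p]"]) (auto simp: tree_map_snoc[OF assms])
  qed
  then show ?thesis by (metis surjI)
qed

text \<open>
  \<open>Bit\<close> stands for the element whose exponents carry the information, \<open>Flip r\<close> for \<open>\<Gamma>\<^sub>r\<close>.
\<close>
datatype move = Bit | Flip nat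

primrec run :: "(move \<Rightarrow> word \<Rightarrow> word) \<Rightarrow> move list \<Rightarrow> bool list \<Rightarrow> word \<Rightarrow> word" where
  "run f [] bs p = p"
| "run f (m # ms) bs p = run f ms (tl bs) (if hd bs then f m p else p)"

definition bits :: "nat \<Rightarrow> bool list set" where "bits n = {bs. length bs = n}"

lemma bits_0: "bits 0 = {[]}" by (auto simp: bits_def)
lemma bits_Suc: "bits (Suc n) = (\<Union>b. (#) b ` bits n)"
  by (auto simp: bits_def length_Suc_conv image_iff)
lemma finite_bits: "finite (bits n)"
  by (induction n) (auto simp: bits_0 bits_Suc)
lemma sum_bits_Suc: "(\<Sum>bs\<in>bits (Suc n). h bs) = (\<Sum>bs\<in>bits n. h (False # bs)) + (\<Sum>bs\<in>bits n. h (True # bs))"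
  for h :: "bool list \<Rightarrow> real"
proof -
  have "bits (Suc n) = (#) False ` bits n \<union> (#) True ` bits n" by (auto simp: bits_Suc UNIV_bool)
  then show ?thesis
    by (simp only:, subst sum.union_disjoint) (auto simp: finite_bits sum.reindex)
qed
lemma sum_bits_snoc: "(\<Sum>bs\<in>bits (Suc n). h bs) = (\<Sum>bs\<in>bits n. h (bs @ [False]) + h (bs @ [True]))"
  for h :: "bool list \<Rightarrow> real"
proof (induction n arbitrary: h)
  case 0 then show ?case by (simp add: sum_bits_Suc bits_0)
next
  case (Suc n)
  show ?case
    using Suc.IH[of "\<lambda>bs. h (False # bs)"] Suc.IH[of "\<lambda>bs. h (True # bs)"]
    by (subst (1 2) sum_bits_Suc) (simp add: sum_bits_Suc)
qed
lemma card_bits: "real (card (bits n)) = 2 ^ n"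
  using card_lists_length_eq[of "UNIV :: bool set" n] by (simp add: bits_def)

definition levels :: "move list \<Rightarrow> nat set" where "levels ms = {r. Flip r \<in> set ms}"

lemma levels_simps [simp]: "levels [] = {}" "levels (Bit # ms) = levels ms"
  "levels (Flip r # ms) = insert r (levels ms)" "levels (ms @ ms') = levels ms \<union> levels ms'"
  by (auto simp: levels_def)

lemma finite_levels [simp]: "finite (levels ms)"
proof -
  have "levels ms \<subseteq> (\<lambda>m. case m of Flip r \<Rightarrow> r) ` set ms" by (force simp: levels_def)
  then show ?thesis by (rule finite_subset) simp
qed

primrec after_bits :: "(move list \<Rightarrow> bool) \<Rightarrow> move list \<Rightarrow> bool" where
  "after_bits P [] = True"
| "after_bits P (m # ms) = ((m = Bit \<longrightarrow> P ms) \<and> after_bits P ms)"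

lemma after_bits_append:
  "after_bits P (ms @ ms') \<longleftrightarrow> after_bits (\<lambda>suf. P (suf @ ms')) ms \<and> after_bits P ms'"
  by (induction ms) auto

lemma after_bits_mono: "(\<And>suf. P suf \<Longrightarrow> Q suf) \<Longrightarrow> after_bits P ms \<Longrightarrow> after_bits Q ms"
  by (induction ms) auto

primrec diff_count :: "nat \<Rightarrow> move list \<Rightarrow> bool list \<Rightarrow> bool list \<Rightarrow> nat" where
  "diff_count r [] bs bs' = 0"
| "diff_count r (m # ms) bs bs' =
     (if hd bs \<noteq> hd bs' \<and> m = Flip r then 1 else 0) + diff_count r ms (tl bs) (tl bs')"

lemma diff_count_card:
  assumes "length bs = length ms" "length bs' = length ms"
  shows "diff_count r ms bs bs' = card {i. i < length ms \<and> bs ! i \<noteq> bs' ! i \<and> ms ! i = Flip r}"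
  using assms
proof (induction ms arbitrary: bs bs')
  case (Cons m ms)
  obtain b cs b' cs' where [simp]: "bs = b # cs" "bs' = b' # cs'"
    using Cons.prems by (metis length_Suc_conv list.size(4) add.right_neutral add_Suc_right)
  have "{i. i < length (m # ms) \<and> bs ! i \<noteq> bs' ! i \<and> (m # ms) ! i = Flip r}
     = (if b \<noteq> b' \<and> m = Flip r then {0} else {}) \<union> Suc ` {i. i < length ms \<and> cs ! i \<noteq> cs' ! i \<and> ms ! i = Flip r}"
    (is "?A = ?B \<union> Suc ` ?C")
  proof (rule Set.set_eqI)
    fix i show "i \<in> ?A \<longleftrightarrow> i \<in> ?B \<union> Suc ` ?C" by (cases i) auto
  qed
  moreover have "card (?B \<union> Suc ` ?C) = card ?B + card ?C"
    by (subst card_Un_disjoint) (auto simp: card_image)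
  ultimately show ?case using Cons by auto
qed simp

text \<open>
  The watched coordinate is the one after a prefix of length \<open>M + 1\<close>. \<open>Bit\<close> fixes the vertex \<open>base\<close>,
  a long way down the ray \<open>1\<^sup>\<infinity>\<close>, and flips the watched coordinate below it. Elsewhere a move can
  flip the watched coordinate only below vertices \<open>w\<close> whose first \<open>L\<close> coordinates, or those from
  \<open>r + 1\<close> on in the case of \<open>\<Gamma>\<^sub>r\<close>, are all \<open>1\<close>; only bad \<open>\<Gamma>\<^sub>r\<close> can do so.
\<close>
locale flip_walk =
  fixes f :: "move \<Rightarrow> word \<Rightarrow> word" and L M :: nat and bad :: "nat \<Rightarrow> bool" and base :: word
  defines "base \<equiv> replicate M True @ [False]"
  assumes tm: "tree_map (f m)"
    and flip: "r < L \<Longrightarrow> length w \<le> r \<Longrightarrow> flips (f (Flip r)) w \<longleftrightarrow> length w = r"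
    and LM: "L \<le> M"
    and base_flip: "flips (f Bit) base" and base_fix: "f Bit base = base"
    and Bit_flips: "length w = Suc M \<Longrightarrow> flips (f Bit) w \<Longrightarrow> i < L \<Longrightarrow> w ! i"
    and Flip_flips: "r < L \<Longrightarrow> length w = Suc M \<Longrightarrow> flips (f (Flip r)) w \<Longrightarrow>
          bad r \<and> (\<forall>i. r < i \<longrightarrow> i < L \<longrightarrow> w ! i)"
begin

lemma length_base: "length base = Suc M" by (simp add: base_def)

lemma length_run: "length (run f ms bs p) = length p"
  by (induction ms arbitrary: bs p) (auto simp: tree_map_length[OF tm])

text \<open>
  Suppose two choices of exponents differ only at moves \<open>Flip r\<close> with \<open>r \<ge> \<rho>\<close>. These
  moves leave the first \<open>\<rho>\<close> coordinates alone, so the two paths agree there at all times, and hence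
  every move applied in both flips coordinate \<open>\<rho>\<close> of both or of neither. The only discrepancies at
  coordinate \<open>\<rho>\<close> come from the differing moves \<open>Flip \<rho>\<close>.
\<close>
lemma run_triangular:
  assumes "length bs = length ms" "length bs' = length ms"
    and "\<And>i. i < length ms \<Longrightarrow> bs ! i \<noteq> bs' ! i \<Longrightarrow> \<exists>r. ms ! i = Flip r \<and> \<rho> \<le> r \<and> r < L"
    and "take \<rho> q = take \<rho> q'" "length q = length q'" "\<rho> < length q"
  shows "take \<rho> (run f ms bs q) = take \<rho> (run f ms bs' q') \<and>
    ((run f ms bs q ! \<rho> = run f ms bs' q' ! \<rho>) \<longleftrightarrow>
      ((q ! \<rho> = q' ! \<rho>) \<longleftrightarrow> even (diff_count \<rho> ms bs bs')))"
  using assms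
proof (induction ms arbitrary: bs bs' q q')
  case (Cons m ms)
  obtain b cs b' cs' where [simp]: "bs = b # cs" "bs' = b' # cs'"
    using Cons.prems(1,2) by (metis length_Suc_conv list.size(4) add.right_neutral add_Suc_right)
  define p p' where "p = (if b then f m q else q)" and "p' = (if b' then f m q' else q')"
  have D: "\<exists>r. m = Flip r \<and> \<rho> \<le> r \<and> r < L" if "b \<noteq> b'" using Cons.prems(3)[of 0] that by simp
  have nth: "f m q ! \<rho> = (q ! \<rho> \<noteq> flips (f m) (take \<rho> q))" "f m q' ! \<rho> = (q' ! \<rho> \<noteq> flips (f m) (take \<rho> q'))"
    using Cons.prems(5,6) by (simp_all add: tree_map_nth[OF tm])
  have fx: "take \<rho> (f m q) = take \<rho> q" "take \<rho> (f m q') = take \<rho> q'"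
     "flips (f m) (take \<rho> q) \<longleftrightarrow> m = Flip \<rho>" if bb': "b \<noteq> b'"
  proof -
    obtain r where r: "m = Flip r" "\<rho> \<le> r" "r < L" using D bb' by blast
    have "take \<rho> (f m z) = take \<rho> z" if z: "length z = length q" for z
    proof (rule nth_equalityI)
      show "length (take \<rho> (f m z)) = length (take \<rho> z)" by (simp add: tree_map_length[OF tm])
      fix i assume i: "i < length (take \<rho> (f m z))"
      then have "i < \<rho>" "i < length z" by (simp_all add: tree_map_length[OF tm])
      then show "take \<rho> (f m z) ! i = take \<rho> z ! i"
        using flip[of r "take i z"] r by (simp add: tree_map_nth[OF tm])
    qed
    then show "take \<rho> (f m q) = take \<rho> q" "take \<rho> (f m q') = take \<rho> q'" using Cons.prems(5) by auto
    show "flips (f m) (take \<rho> q) \<longleftrightarrow> m = Flip \<rho>"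
      using flip[of r "take \<rho> q"] r Cons.prems(6) by auto
  qed
  have tk: "take \<rho> p = take \<rho> p'"
  proof (cases "b = b'")
    case True then show ?thesis using Cons.prems(4) by (simp add: p_def p'_def tree_map_take[OF tm])
  next
    case False then show ?thesis using fx Cons.prems(4) by (auto simp: p_def p'_def)
  qed
  have nt: "(p ! \<rho> = p' ! \<rho>) \<longleftrightarrow> ((q ! \<rho> = q' ! \<rho>) \<longleftrightarrow> \<not> (b \<noteq> b' \<and> m = Flip \<rho>))"
  proof (cases "b = b'")
    case True then show ?thesis using Cons.prems(4) nth by (auto simp: p_def p'_def)
  next
    case False then show ?thesis using fx Cons.prems(4) nth by (auto simp: p_def p'_def)
  qed
  have "take \<rho> (run f ms cs p) = take \<rho> (run f ms cs' p') \<and>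
    ((run f ms cs p ! \<rho> = run f ms cs' p' ! \<rho>) \<longleftrightarrow>
      ((p ! \<rho> = p' ! \<rho>) \<longleftrightarrow> even (diff_count \<rho> ms cs cs')))"
  proof (rule Cons.IH)
    show "length p = length p'" "\<rho> < length p"
      using Cons.prems(5,6) by (auto simp: p_def p'_def tree_map_length[OF tm])
    show "\<exists>r. ms ! i = Flip r \<and> \<rho> \<le> r \<and> r < L" if "i < length ms" "cs ! i \<noteq> cs' ! i" for i
      using Cons.prems(3)[of "Suc i"] that by simp
  qed (use Cons.prems tk in auto)
  then show ?case using nt by (auto simp: p_def p'_def)
qed simp

text \<open>
  Single out one occurrence of \<open>Flip r\<close> for each \<open>r\<close> in \<open>A\<close>. Once all other exponents are fixed,
  prescribing the coordinates in \<open>A\<close> of the endpoint determines the exponents singled out: at the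
  least \<open>r\<close> where two choices differ, the endpoints differ by \<open>run_triangular\<close>.
\<close>
lemma card_run_prescribed:
  assumes A: "A \<subseteq> levels ms" "A \<subseteq> {..<L}" and q: "L \<le> length q"
  shows "real (card {bs \<in> bits (length ms). \<forall>r\<in>A. run f ms bs q ! r}) \<le> 2 ^ length ms * (1/2) ^ card A"
proof -
  let ?n = "length ms"
  let ?E = "{bs \<in> bits ?n. \<forall>r\<in>A. run f ms bs q ! r}"
  have "\<forall>r\<in>A. \<exists>i<?n. ms ! i = Flip r" using A(1) by (auto simp: levels_def in_set_conv_nth)
  then obtain idx where idx: "\<And>r. r \<in> A \<Longrightarrow> idx r < ?n \<and> ms ! idx r = Flip r" by metis
  have fA: "finite A" using A(2) finite_subset by blast
  have inj: "inj_on idx A" by (rule inj_onI) (metis idx move.inject)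
  define I where "I = idx ` A"
  define \<phi> where "\<phi> bs = {i. i < ?n \<and> bs ! i} - I" for bs
  have "inj_on \<phi> ?E"
  proof (rule inj_onI, rule ccontr)
    fix bs bs' assume E: "bs \<in> ?E" "bs' \<in> ?E" and eq: "\<phi> bs = \<phi> bs'" and ne: "bs \<noteq> bs'"
    have len: "length bs = ?n" "length bs' = ?n" using E by (auto simp: bits_def)
    \<comment> \<open>The choices differ only at occurrences that were singled out.\<close>
    have DI: "i \<in> I" if "i < ?n" "bs ! i \<noteq> bs' ! i" for i
    proof (rule ccontr)
      assume "i \<notin> I"
      then have "i \<in> \<phi> bs \<longleftrightarrow> bs ! i" "i \<in> \<phi> bs' \<longleftrightarrow> bs' ! i" using that by (auto simp: \<phi>_def)
      then show False using eq that by auto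
    qed
    define R where "R = {r \<in> A. bs ! idx r \<noteq> bs' ! idx r}"
    obtain i where i: "i < ?n" "bs ! i \<noteq> bs' ! i" using ne len by (auto simp: list_eq_iff_nth_eq)
    then obtain r where "r \<in> A" "i = idx r" using DI[OF i] by (auto simp: I_def)
    then have R: "R \<noteq> {}" "finite R" using i(2) fA by (auto simp: R_def)
    define \<rho> where "\<rho> = Min R"
    have \<rho>: "\<rho> \<in> R" "\<And>r. r \<in> R \<Longrightarrow> \<rho> \<le> r" using R by (auto simp: \<rho>_def)
    have lv: "\<exists>r. ms ! i = Flip r \<and> \<rho> \<le> r \<and> r < L" if i: "i < ?n" "bs ! i \<noteq> bs' ! i" for i
    proof -
      obtain r where r: "r \<in> A" "i = idx r" using DI[OF i] by (auto simp: I_def)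
      then have "r \<in> R" using i(2) by (simp add: R_def)
      then show ?thesis using idx[OF r(1)] \<rho>(2)[of r] A(2) r by (intro exI[of _ r]) auto
    qed
    have "{i. i < ?n \<and> bs ! i \<noteq> bs' ! i \<and> ms ! i = Flip \<rho>} = {idx \<rho>}"
    proof -
      have uniq: "i = idx \<rho>" if i: "i < ?n" "bs ! i \<noteq> bs' ! i" "ms ! i = Flip \<rho>" for i
      proof -
        obtain r where r: "r \<in> A" "i = idx r" using DI[OF i(1,2)] by (auto simp: I_def)
        have "Flip r = Flip \<rho>" using idx[OF r(1)] i(3) unfolding r(2) by simp
        then show ?thesis using r by simp
      qed
      have \<rho>': "\<rho> \<in> A" "bs ! idx \<rho> \<noteq> bs' ! idx \<rho>" using \<rho>(1) by (auto simp: R_def)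
      show ?thesis
      proof (intro Set.equalityI subsetI)
        fix i assume "i \<in> {i. i < ?n \<and> bs ! i \<noteq> bs' ! i \<and> ms ! i = Flip \<rho>}"
        then show "i \<in> {idx \<rho>}" using uniq[of i] by blast
      next
        fix i assume "i \<in> {idx \<rho>}"
        then show "i \<in> {i. i < ?n \<and> bs ! i \<noteq> bs' ! i \<and> ms ! i = Flip \<rho>}"
          using idx[OF \<rho>'(1)] \<rho>'(2) by simp
      qed
    qed
    then have "diff_count \<rho> ms bs bs' = 1" using diff_count_card[OF len] by simp
    moreover have "\<rho> < length q" using \<rho>(1) A(2) q by (auto simp: R_def)
    ultimately have "run f ms bs q ! \<rho> \<noteq> run f ms bs' q ! \<rho>"
      using run_triangular[OF len lv, of q q] by simp
    moreover have "\<rho> \<in> A" using \<rho>(1) by (simp add: R_def)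
    then have "run f ms bs q ! \<rho>" "run f ms bs' q ! \<rho>" using E by blast+
    ultimately show False by simp
  qed
  moreover have "\<phi> ` ?E \<subseteq> Pow ({..<?n} - I)" by (auto simp: \<phi>_def)
  ultimately have "card ?E \<le> card (Pow ({..<?n} - I))" by (intro card_inj_on_le) auto
  also have "\<dots> = 2 ^ (?n - card A)"
  proof -
    have "I \<subseteq> {..<?n}" using idx by (auto simp: I_def)
    moreover have "card I = card A" using inj by (simp add: I_def card_image)
    ultimately show ?thesis by (simp add: card_Pow card_Diff_subset finite_subset)
  qed
  finally have "card ?E \<le> 2 ^ (?n - card A)" .
  from of_nat_mono[OF this, where 'a = real] have "real (card ?E) \<le> 2 ^ (?n - card A)" by simp
  moreover have "card A \<le> ?n"
  proof -
    have "card A = card I" using inj by (simp add: I_def card_image)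
    also have "\<dots> \<le> card {..<?n}" using idx by (intro card_mono) (auto simp: I_def)
    finally show ?thesis by simp
  qed
  ultimately show ?thesis by (simp add: power_diff power_one_over)
qed

text \<open>
  Bounds the probability that the move \<open>m\<close> is applied at a point where it flips the watched
  coordinate, if the moves \<open>Flip r\<close> with \<open>r \<in> S\<close> have occurred since the start of the path.
\<close>
definition hit_bound :: "move \<Rightarrow> nat set \<Rightarrow> real" where
  "hit_bound m S = (case m of Bit \<Rightarrow> (1/2) ^ card S
     | Flip r \<Rightarrow> if bad r then (1/2) ^ card {r' \<in> S. r < r'} else 0)"

lemma hit_bound_nonneg: "0 \<le> hit_bound m S"
  by (auto simp: hit_bound_def split: move.splits)

lemma hit_bound_antimono: "finite S' \<Longrightarrow> S \<subseteq> S' \<Longrightarrow> hit_bound m S' \<le> hit_bound m S"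
proof -
  assume S: "finite S'" "S \<subseteq> S'"
  have "(1/2::real) ^ card S' \<le> (1/2) ^ card S"
    by (rule power_decreasing) (use S in \<open>auto simp: card_mono\<close>)
  moreover have "(1/2::real) ^ card {r' \<in> S'. r < r'} \<le> (1/2) ^ card {r' \<in> S. r < r'}" for r
  proof (rule power_decreasing)
    show "card {r' \<in> S. r < r'} \<le> card {r' \<in> S'. r < r'}" by (rule card_mono) (use S in auto)
  qed auto
  ultimately show ?thesis by (simp add: hit_bound_def split: move.splits)
qed

lemma card_flips:
  assumes "levels (ms @ [m]) \<subseteq> {..<L}" "length q = Suc M"
  shows "real (card {bs \<in> bits (length ms). flips (f m) (run f ms bs q)})
     \<le> 2 ^ length ms * hit_bound m (levels ms)"
proof (cases m)
  case Bit
  have "real (card {bs \<in> bits (length ms). flips (f m) (run f ms bs q)})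
     \<le> real (card {bs \<in> bits (length ms). \<forall>r\<in>levels ms. run f ms bs q ! r})"
  proof -
    have "run f ms bs q ! r" if "flips (f m) (run f ms bs q)" "r \<in> levels ms" for bs r
      using Bit_flips[of "run f ms bs q" r] that assms by (auto simp: Bit length_run)
    then have "{bs \<in> bits (length ms). flips (f m) (run f ms bs q)}
       \<subseteq> {bs \<in> bits (length ms). \<forall>r\<in>levels ms. run f ms bs q ! r}" by blast
    then show ?thesis by (simp add: card_mono finite_bits)
  qed
  also have "\<dots> \<le> 2 ^ length ms * (1/2) ^ card (levels ms)"
    using assms LM by (intro card_run_prescribed) auto
  finally show ?thesis by (simp add: hit_bound_def Bit)
next
  case (Flip r)
  have r: "r < L" using assms Flip by simp
  show ?thesis
  proof (cases "bad r")
    case True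
    have "real (card {bs \<in> bits (length ms). flips (f m) (run f ms bs q)})
       \<le> real (card {bs \<in> bits (length ms). \<forall>i\<in>{r' \<in> levels ms. r < r'}. run f ms bs q ! i})"
    proof -
      have "run f ms bs q ! i" if "flips (f m) (run f ms bs q)" "i \<in> levels ms" "r < i" for bs i
        using Flip_flips[OF r, of "run f ms bs q"] that assms by (auto simp: Flip length_run)
      then have "{bs \<in> bits (length ms). flips (f m) (run f ms bs q)}
         \<subseteq> {bs \<in> bits (length ms). \<forall>i\<in>{r' \<in> levels ms. r < r'}. run f ms bs q ! i}" by blast
      then show ?thesis by (simp add: card_mono finite_bits)
    qed
    also have "\<dots> \<le> 2 ^ length ms * (1/2) ^ card {r' \<in> levels ms. r < r'}"
      using assms LM by (intro card_run_prescribed) auto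
    finally show ?thesis by (simp add: hit_bound_def Flip True)
  next
    case False
    then have "\<not> flips (f m) (run f ms bs q)" for bs
      using Flip_flips[OF r, of "run f ms bs q"] assms(2) by (auto simp: Flip length_run)
    then have *: "{bs \<in> bits (length ms). flips (f m) (run f ms bs q)} = {}" by blast
    show ?thesis unfolding * by (simp add: hit_bound_nonneg)
  qed
qed

text \<open>
  Counts the moves that would flip the watched coordinate where the path stands, whether or not their
  exponent is \<open>1\<close>; this only makes the count larger.
\<close>
primrec hits :: "move list \<Rightarrow> bool list \<Rightarrow> word \<Rightarrow> nat" where
  "hits [] bs q = 0"
| "hits (m # ms) bs q = (if flips (f m) q then 1 else 0) + hits ms (tl bs) (if hd bs then f m q else q)"

lemma hits_snoc:
  "length bs = length ms \<Longrightarrow> hits (ms @ [m]) (bs @ [b]) q = hits ms bs q + (if flips (f m) (run f ms bs q) then 1 else 0)"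
proof (induction ms arbitrary: bs q)
  case (Cons m' ms) then show ?case by (cases bs) auto
qed simp

definition expected_hits :: "move list \<Rightarrow> real" where
  "expected_hits ms = (\<Sum>i<length ms. hit_bound (ms ! i) (levels (take i ms)))"

lemma expected_hits_snoc: "expected_hits (ms @ [m]) = expected_hits ms + hit_bound m (levels ms)"
proof -
  have "(\<Sum>i<length ms. hit_bound ((ms @ [m]) ! i) (levels (take i (ms @ [m]))))
      = (\<Sum>i<length ms. hit_bound (ms ! i) (levels (take i ms)))"
    by (intro sum.cong) (auto simp: nth_append)
  then show ?thesis by (simp add: expected_hits_def)
qed

lemma expected_hits_append:
  "expected_hits (ms @ ms') \<le> expected_hits ms + (\<Sum>m\<leftarrow>ms'. hit_bound m (levels ms))"
proof (induction ms' rule: rev_induct)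
  case (snoc m ms')
  have "hit_bound m (levels (ms @ ms')) \<le> hit_bound m (levels ms)"
    by (intro hit_bound_antimono) auto
  then show ?case using snoc expected_hits_snoc[of "ms @ ms'" m] by simp
qed simp

lemma sum_hits:
  assumes "levels ms \<subseteq> {..<L}" "length q = Suc M"
  shows "(\<Sum>bs\<in>bits (length ms). real (hits ms bs q)) \<le> 2 ^ length ms * expected_hits ms"
  using assms(1)
proof (induction ms rule: rev_induct)
  case Nil then show ?case by (simp add: bits_0 expected_hits_def)
next
  case (snoc m ms)
  let ?n = "length ms"
  have "(\<Sum>bs\<in>bits (length (ms @ [m])). real (hits (ms @ [m]) bs q))
     = (\<Sum>bs\<in>bits ?n. 2 * real (hits ms bs q) + 2 * (if flips (f m) (run f ms bs q) then 1 else 0))"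
    by (simp add: sum_bits_snoc) (intro sum.cong refl, simp add: bits_def hits_snoc)
  also have "\<dots> = 2 * (\<Sum>bs\<in>bits ?n. real (hits ms bs q))
      + 2 * real (card {bs \<in> bits ?n. flips (f m) (run f ms bs q)})"
    by (simp add: sum.distrib sum_distrib_left[symmetric] finite_bits sum.If_cases Int_def)
  also have "\<dots> \<le> 2 * (2 ^ ?n * expected_hits ms) + 2 * (2 ^ ?n * hit_bound m (levels ms))"
    using snoc.IH snoc.prems card_flips[of ms m q] assms(2) by (intro add_mono mult_left_mono) auto
  finally show ?case by (simp add: expected_hits_snoc algebra_simps)
qed

lemma run_no_hit:
  assumes "hits ms bs q = 0" shows "run f ms bs (q @ [x]) = run f ms bs q @ [x]"
  using assms
proof (induction ms arbitrary: bs q)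
  case (Cons m ms) then show ?case by (auto simp: tree_map_snoc[OF tm] split: if_splits)
qed simp

text \<open>
  Reads off the exponent of a leading \<open>Bit\<close> from the product, correctly if the path from \<open>base\<close> has
  no later hit.
\<close>
definition guess :: "(word \<Rightarrow> word) \<Rightarrow> bool" where "guess g = g (base @ [False]) ! Suc M"

primrec errors :: "move list \<Rightarrow> bool list \<Rightarrow> nat" where
  "errors [] bs = 0"
| "errors (m # ms) bs = (if m = Bit \<and> guess (run f (m # ms) bs) \<noteq> hd bs then 1 else 0) + errors ms (tl bs)"

lemma guess_run:
  assumes "hits ms bs base = 0" shows "guess (run f (Bit # ms) (b # bs)) = b"
proof -
  have "(if b then f Bit (base @ [False]) else base @ [False]) = base @ [b]"
    using base_flip base_fix by (simp add: tree_map_snoc[OF tm])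
  then show ?thesis using run_no_hit[OF assms, of b]
    by (auto simp: guess_def nth_append length_run length_base)
qed


definition bit_count :: "move list \<Rightarrow> nat" where "bit_count ms = length (filter (\<lambda>m. m = Bit) ms)"

lemma sum_errors:
  assumes "levels ms \<subseteq> {..<L}" "after_bits (\<lambda>ms. expected_hits ms \<le> \<delta>) ms"
  shows "(\<Sum>bs\<in>bits (length ms). real (errors ms bs)) \<le> 2 ^ length ms * (\<delta> * real (bit_count ms))"
  using assms
proof (induction ms)
  case Nil then show ?case by (simp add: bits_0 bit_count_def)
next
  case (Cons m ms)
  let ?n = "length ms"
  have lv: "levels ms \<subseteq> {..<L}" using Cons.prems(1) by (cases m) auto
  have IH: "(\<Sum>bs\<in>bits ?n. real (errors ms bs)) \<le> 2 ^ ?n * (\<delta> * real (bit_count ms))"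
    using Cons lv by simp
  show ?case
  proof (cases m)
    case (Flip r)
    then show ?thesis using IH by (simp add: sum_bits_Suc bit_count_def)
  next
    case Bit
    have e: "real (errors (m # ms) (b # bs)) \<le> real (errors ms bs) + real (hits ms bs base)" for b bs
      using guess_run[of ms bs b] by (cases "hits ms bs base") (auto simp: Bit)
    have s: "(\<Sum>bs\<in>bits ?n. real (errors (m # ms) (b # bs)))
      \<le> (\<Sum>bs\<in>bits ?n. real (errors ms bs) + real (hits ms bs base))" for b
      by (intro sum_mono e)
    have "(\<Sum>bs\<in>bits (length (m # ms)). real (errors (m # ms) bs))
      \<le> 2 * (\<Sum>bs\<in>bits ?n. real (errors ms bs) + real (hits ms bs base))"
      using s[of False] s[of True]
      by (simp add: sum_bits_Suc del: errors.simps)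
    also have "\<dots> \<le> 2 * (2 ^ ?n * (\<delta> * real (bit_count ms)) + 2 ^ ?n * \<delta>)"
    proof -
      have "(\<Sum>bs\<in>bits ?n. real (hits ms bs base)) \<le> 2 ^ ?n * \<delta>"
      proof (rule order_trans[OF sum_hits[OF lv length_base]])
        show "2 ^ ?n * expected_hits ms \<le> 2 ^ ?n * \<delta>" using Cons.prems(2) Bit by simp
      qed
      then show ?thesis using IH by (simp add: sum.distrib)
    qed
    finally show ?thesis by (simp add: Bit bit_count_def algebra_simps)
  qed
qed

text \<open>
  For a given value \<open>x\<close> of the product the guess at a leading \<open>Bit\<close> is determined, so one of its two
  exponents is right and the other is penalised by \<open>exp (-1)\<close>. The remaining moves then have to
  produce a determined value again.
\<close>
lemma sum_exp_errors_fibre: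
  "(\<Sum>bs | bs \<in> bits (length ms) \<and> run f ms bs = x. exp (- real (errors ms bs)))
    \<le> 2 ^ length ms * ((1 + exp (-1)) / 2) ^ bit_count ms"
proof (induction ms arbitrary: x)
  case Nil
  have "(\<Sum>bs | bs \<in> bits (length []) \<and> run f [] bs = x. exp (- real (errors [] bs)))
     \<le> (\<Sum>bs\<in>{[]}. exp (- real (errors [] bs)))"
    by (rule sum_mono2) (auto simp: bits_0)
  also have "\<dots> = 2 ^ length ([] :: move list) * ((1 + exp (-1)) / 2) ^ bit_count []"
    by (simp add: bit_count_def)
  finally show ?case .
next
  case (Cons m ms)
  let ?n = "length ms"
  let ?F = "\<lambda>b. {bs \<in> bits ?n. run f (m # ms) (b # bs) = x}"
  let ?K = "2 ^ ?n * ((1 + exp (-1)) / 2) ^ bit_count ms :: real"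
  have fibre: "(\<Sum>bs\<in>?F b. exp (- real (errors ms bs))) \<le> ?K" for b
  proof -
    define h where "h = (if b then f m else id)"
    have "surj h" using tree_map_surj[OF tm] by (auto simp: h_def)
    then have h: "h (inv_into UNIV h p) = p" for p by (rule surj_f_inv_f)
    have "run f (m # ms) (b # bs) = x \<Longrightarrow> run f ms bs = x \<circ> inv_into UNIV h" for bs
      by (rule ext) (use h in \<open>auto simp: h_def split: if_splits\<close>)
    then have "(\<Sum>bs\<in>?F b. exp (- real (errors ms bs)))
       \<le> (\<Sum>bs | bs \<in> bits ?n \<and> run f ms bs = x \<circ> inv_into UNIV h. exp (- real (errors ms bs)))"
      by (intro sum_mono2) (auto simp: finite_bits)
    also have "\<dots> \<le> ?K" by (rule Cons.IH)
    finally show ?thesis .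
  qed
  have split: "(\<Sum>bs | bs \<in> bits (length (m # ms)) \<and> run f (m # ms) bs = x. exp (- real (errors (m # ms) bs)))
     = (\<Sum>bs\<in>?F False. exp (- real (errors (m # ms) (False # bs))))
     + (\<Sum>bs\<in>?F True. exp (- real (errors (m # ms) (True # bs))))"
    using sum_bits_Suc[of "\<lambda>bs. if run f (m # ms) bs = x then exp (- real (errors (m # ms) bs)) else 0" ?n]
    by (simp add: sum.inter_filter[symmetric] finite_bits del: run.simps errors.simps)
  have part: "(\<Sum>bs\<in>?F b. exp (- real (errors (m # ms) (b # bs))))
     \<le> (if m = Bit \<and> guess x \<noteq> b then exp (-1) else 1) * ?K" for b
  proof -
    have "(\<Sum>bs\<in>?F b. exp (- real (errors (m # ms) (b # bs))))
      = (\<Sum>bs\<in>?F b. (if m = Bit \<and> guess x \<noteq> b then exp (-1) else 1) * exp (- real (errors ms bs)))"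
    proof (intro sum.cong refl)
      fix bs assume "bs \<in> ?F b"
      then have "run f (m # ms) (b # bs) = x" by simp
      then show "exp (- real (errors (m # ms) (b # bs)))
         = (if m = Bit \<and> guess x \<noteq> b then exp (-1) else 1) * exp (- real (errors ms bs))"
        by (simp del: run.simps add: exp_add[symmetric])
    qed
    also have "\<dots> = (if m = Bit \<and> guess x \<noteq> b then exp (-1) else 1) * (\<Sum>bs\<in>?F b. exp (- real (errors ms bs)))"
      by (simp add: sum_distrib_left)
    also have "\<dots> \<le> (if m = Bit \<and> guess x \<noteq> b then exp (-1) else 1) * ?K"
      by (intro mult_left_mono fibre) auto
    finally show ?thesis .
  qed
  show ?case
  proof (cases m)
    case Bit
    have "(\<Sum>bs | bs \<in> bits (length (m # ms)) \<and> run f (m # ms) bs = x. exp (- real (errors (m # ms) bs)))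
       \<le> (1 + exp (-1)) * ?K"
      unfolding split using part[of False] part[of True] by (cases "guess x") (auto simp: Bit algebra_simps)
    also have "\<dots> = 2 ^ length (m # ms) * ((1 + exp (-1)) / 2) ^ bit_count (m # ms)"
      by (simp add: Bit bit_count_def)
    finally show ?thesis .
  next
    case (Flip r)
    then show ?thesis unfolding split using part[of False] part[of True] by (simp add: bit_count_def)
  qed
qed

text \<open>
  Summing \<open>exp (- errors)\<close> over all exponents: it is large because the average number of errors is
  small, by convexity of the exponential, and each value of the product accounts for little of it by
  \<open>sum_exp_errors_fibre\<close>.
\<close>
theorem card_run_ge:
  assumes "levels ms \<subseteq> {..<L}" "after_bits (\<lambda>ms. expected_hits ms \<le> 1/8) ms"
  shows "exp (real (bit_count ms) / 8) \<le> real (card (run f ms ` bits (length ms)))"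
proof -
  let ?B = "bits (length ms)" and ?t = "bit_count ms"
  define \<mu> where "\<mu> = real ?t / 8"
  \<comment> \<open>\<open>exp (- e)\<close> lies above its tangent at \<open>\<mu>\<close>, the bound for the average of the errors \<open>e\<close>.\<close>
  have "2 ^ length ms * exp (- \<mu>) \<le> exp (- \<mu>) * (2 ^ length ms * (1 + \<mu>) - (\<Sum>bs\<in>?B. real (errors ms bs)))"
    using sum_errors[OF assms] by (simp add: \<mu>_def algebra_simps)
  also have "\<dots> = (\<Sum>bs\<in>?B. exp (- \<mu>) * (1 + (\<mu> - real (errors ms bs))))"
    by (simp add: sum_distrib_left[symmetric] sum.distrib sum_subtractf card_bits algebra_simps)
  also have "\<dots> \<le> (\<Sum>bs\<in>?B. exp (- real (errors ms bs)))"
  proof (rule sum_mono)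
    fix bs
    have "exp (- \<mu>) * (1 + (\<mu> - real (errors ms bs))) \<le> exp (- \<mu>) * exp (\<mu> - real (errors ms bs))"
      by (intro mult_left_mono exp_ge_add_one_self) auto
    then show "exp (- \<mu>) * (1 + (\<mu> - real (errors ms bs))) \<le> exp (- real (errors ms bs))"
      by (simp add: exp_add[symmetric])
  qed
  also have "\<dots> = (\<Sum>x\<in>run f ms ` ?B. \<Sum>bs | bs \<in> ?B \<and> run f ms bs = x. exp (- real (errors ms bs)))"
    by (rule sum.image_gen) (rule finite_bits)
  also have "\<dots> \<le> (\<Sum>x\<in>run f ms ` ?B. 2 ^ length ms * ((1 + exp (-1)) / 2) ^ ?t)"
    by (intro sum_mono sum_exp_errors_fibre)
  also have "\<dots> \<le> (\<Sum>x\<in>run f ms ` ?B. 2 ^ length ms * exp (- (1/4)) ^ ?t)"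
  proof (intro sum_mono mult_left_mono power_mono)
    have "exp (-1) \<le> (1/2 :: real)"
      using exp_ge_add_one_self[of "1::real"] by (simp add: exp_minus field_simps)
    moreover have "exp (- (1/4)) \<ge> (3/4 :: real)" using exp_ge_add_one_self[of "- (1/4) :: real"] by simp
    ultimately show "(1 + exp (-1)) / 2 \<le> exp (- (1/4) :: real)" by simp
  qed auto
  also have "\<dots> = real (card (run f ms ` ?B)) * (2 ^ length ms * exp (- (2 * \<mu>)))"
    by (simp add: exp_of_nat_mult[symmetric] \<mu>_def)
  finally have "exp (- \<mu>) \<le> real (card (run f ms ` ?B)) * exp (- (2 * \<mu>))" by simp
  then have "exp (- \<mu>) * exp (2 * \<mu>) \<le> real (card (run f ms ` ?B)) * exp (- (2 * \<mu>)) * exp (2 * \<mu>)"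
    by (rule mult_right_mono) simp
  then show ?thesis by (simp add: mult.assoc exp_add[symmetric] \<mu>_def)
qed

end

section \<open>The schedule of moves\<close>

text \<open>
  Coordinates come in triples. In \<open>schedule s i\<close> the good coordinates of the first \<open>2 s + i\<close> triples,
  but only the bad ones (those \<open>r\<close> with \<open>r mod 3 = 2\<close>) of the first \<open>i\<close> triples, are used. The bad
  coordinates thus lag behind by \<open>2 s\<close> triples.
\<close>
definition initial_moves :: "nat \<Rightarrow> move list" where
  "initial_moves s = map Flip (filter (\<lambda>r. r mod 3 \<noteq> 2) [0..<6 * s])"

definition fresh_moves :: "nat \<Rightarrow> nat \<Rightarrow> move list" where
  "fresh_moves s i = [Flip (3 * (2 * s + i)), Flip (3 * (2 * s + i) + 1), Flip (3 * i + 2)]"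

primrec schedule :: "nat \<Rightarrow> nat \<Rightarrow> move list" where
  "schedule s 0 = Bit # initial_moves s"
| "schedule s (Suc i) = concat (replicate 8 (schedule s i)) @ fresh_moves s i"

text \<open>
  The coordinates used in \<open>schedule s i\<close>, restricted to triples with index at least \<open>a\<close>.
\<close>
definition level_set :: "nat \<Rightarrow> nat \<Rightarrow> nat \<Rightarrow> nat set" where
  "level_set a s i = (\<lambda>k. 3 * k) ` {a..<2 * s + i} \<union> (\<lambda>k. 3 * k + 1) ` {a..<2 * s + i}
     \<union> (\<lambda>k. 3 * k + 2) ` {a..<i}"

lemma card_level_set: "card (level_set a s i) = 2 * (2 * s + i - a) + (i - a)"
proof -
  let ?A = "(\<lambda>k. 3 * k) ` {a..<2 * s + i}" and ?B = "(\<lambda>k. 3 * k + 1) ` {a..<2 * s + i}"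
  let ?C = "(\<lambda>k. 3 * k + 2) ` {a..<i}"
  have "?A \<inter> ?B = {}" "(?A \<union> ?B) \<inter> ?C = {}" by (auto; presburger)+
  then have "card (level_set a s i) = card ?A + card ?B + card ?C"
    unfolding level_set_def by (simp add: card_Un_disjoint)
  also have "\<dots> = (2 * s + i - a) + (2 * s + i - a) + (i - a)"
    by (simp add: card_image inj_on_def)
  finally show ?thesis by simp
qed

lemma level_set_above: "{r \<in> level_set 0 s i. 3 * j + 2 < r} = level_set (Suc j) s i"
proof -
  have "3 * j + 2 < 3 * k \<longleftrightarrow> Suc j \<le> k" "3 * j + 2 < 3 * k + 1 \<longleftrightarrow> Suc j \<le> k"
     "3 * j + 2 < 3 * k + 2 \<longleftrightarrow> Suc j \<le> k" for k by presburger+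
  then show ?thesis by (auto simp: level_set_def image_iff)
qed

lemma levels_concat_replicate: "levels (concat (replicate k ms)) = (if k = 0 then {} else levels ms)"
  by (induction k) auto

lemma level_set_Suc:
  "level_set 0 s (Suc i) = level_set 0 s i \<union> {3 * (2 * s + i), 3 * (2 * s + i) + 1, 3 * i + 2}"
proof -
  have "{0..<2 * s + Suc i} = insert (2 * s + i) {0..<2 * s + i}" "{0..<Suc i} = insert i {0..<i}" by auto
  then show ?thesis unfolding level_set_def by auto
qed

lemma levels_schedule: "levels (schedule s i) = level_set 0 s i"
proof (induction i)
  case 0
  have "levels (map Flip rs) = set rs" for rs by (auto simp: levels_def)
  then have "levels (schedule s 0) = {r. r < 6 * s \<and> r mod 3 \<noteq> 2}"
    by (auto simp: initial_moves_def)
  also have "\<dots> = level_set 0 s 0"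
  proof (rule Set.set_eqI)
    fix r :: nat
    have "r mod 3 = 0 \<or> r mod 3 = 1 \<or> r mod 3 = 2" by presburger
    moreover have "r = 3 * (r div 3) + r mod 3" by simp
    ultimately have "r \<in> {r. r < 6 * s \<and> r mod 3 \<noteq> 2} \<longleftrightarrow>
       (\<exists>k<2 * s. r = 3 * k) \<or> (\<exists>k<2 * s. r = 3 * k + 1)" by (auto; presburger)
    then show "r \<in> {r. r < 6 * s \<and> r mod 3 \<noteq> 2} \<longleftrightarrow> r \<in> level_set 0 s 0"
      by (auto simp: level_set_def)
  qed
  finally show ?case .
next
  case (Suc i)
  show ?case
    by (simp add: levels_concat_replicate Suc fresh_moves_def level_set_Suc) 
qed

lemma level_set_less: "r \<in> level_set 0 s i \<Longrightarrow> r < 3 * (2 * s + i)"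
  by (auto simp: level_set_def)

lemma bit_count_schedule:
  "length (filter (\<lambda>m. m = Bit) (schedule s i)) = 8 ^ i"
proof (induction i)
  case 0
  have "filter (\<lambda>m. m = Bit) (map Flip rs) = []" for rs by (induction rs) auto
  then show ?case by (simp add: initial_moves_def)
next
  case (Suc i)
  have "length (filter (\<lambda>m. m = Bit) (concat (replicate k ms))) = k * length (filter (\<lambda>m. m = Bit) ms)" for k ms
    by (induction k) auto
  then show ?case using Suc by (simp add: fresh_moves_def)
qed

locale scheduled_walk = flip_walk f L M "\<lambda>r. r mod 3 = 2" base for f L M base
begin

lemma hit_bound_Bit: "hit_bound Bit (level_set 0 s i) = (1/16) ^ s * (1/8) ^ i"
proof -
  have "2 * (2 * s + i - 0) + (i - 0) = 4 * s + 3 * i" by simp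
  then show ?thesis
    by (simp add: hit_bound_def card_level_set power_add power_mult power_one_over)
qed

lemma hit_bound_good: "r mod 3 \<noteq> 2 \<Longrightarrow> hit_bound (Flip r) S = 0"
  by (simp add: hit_bound_def)

lemma hit_bound_bad: "hit_bound (Flip (3 * j + 2)) (level_set 0 s i) = (1/2) ^ card (level_set (Suc j) s i)"
proof -
  have "(3 * j + 2) mod 3 = 2" by presburger
  then show ?thesis unfolding hit_bound_def level_set_above[symmetric] by (simp only: move.case if_True simp_thms)
qed

text \<open>
  From one stage to the next three coordinates are added, all of them above every bad one in use, which
  compensates exactly for the eightfold number of occurrences.
\<close>
lemma hit_bound_Suc:
  assumes "m = Bit \<or> m = Flip r \<and> r \<in> level_set 0 s i"
  shows "hit_bound m (level_set 0 s (Suc i)) = hit_bound m (level_set 0 s i) / 8"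
proof -
  consider "m = Bit" | "m = Flip r" "r mod 3 \<noteq> 2" | j where "m = Flip (3 * j + 2)" "j < i"
  proof (cases "m = Bit")
    case False
    then have "m = Flip r" "r \<in> level_set 0 s i" using assms by auto
    then show ?thesis using that(2,3) by (auto simp: level_set_def)
  qed (use that(1) in auto)
  then show ?thesis
  proof cases
    case 1 then show ?thesis by (simp add: hit_bound_Bit)
  next
    case 2 then show ?thesis by (simp add: hit_bound_good)
  next
    case 3
    then have "card (level_set (Suc j) s (Suc i)) = card (level_set (Suc j) s i) + 3"
      by (simp add: card_level_set)
    then show ?thesis unfolding 3 hit_bound_bad by (simp add: power_add power3_eq_cube)
  qed
qed

lemma hit_bound_fresh:
  "(\<Sum>m\<leftarrow>fresh_moves s i. hit_bound m (level_set 0 s (Suc i))) = (1/16) ^ s"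
  "(\<Sum>m\<leftarrow>fresh_moves s i. hit_bound m (level_set 0 s i)) \<le> 4 * (1/16) ^ s"
proof -
  have g: "hit_bound (Flip (3 * k)) S = 0" "hit_bound (Flip (3 * k + 1)) S = 0" for k S
    by (rule hit_bound_good, presburger)+
  have "card (level_set (Suc i) s (Suc i)) = 4 * s" by (simp add: card_level_set)
  then show "(\<Sum>m\<leftarrow>fresh_moves s i. hit_bound m (level_set 0 s (Suc i))) = (1/16) ^ s"
    using g[of "2 * s + i"] unfolding fresh_moves_def
    by (simp only: list.map sum_list.Cons sum_list.Nil hit_bound_bad) (simp add: power_mult power_one_over)
  have "4 * s \<le> card (level_set (Suc i) s i) + 2" by (simp add: card_level_set)
  then have "(1/2 :: real) ^ (card (level_set (Suc i) s i) + 2) \<le> (1/2) ^ (4 * s)"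
    by (rule power_decreasing) auto
  then have "(1/2 :: real) ^ card (level_set (Suc i) s i) \<le> 4 * (1/16) ^ s"
    by (simp add: power_add power_mult power_one_over power2_eq_square)
  then show "(\<Sum>m\<leftarrow>fresh_moves s i. hit_bound m (level_set 0 s i)) \<le> 4 * (1/16) ^ s"
    using g[of "2 * s + i"] unfolding fresh_moves_def
    by (simp only: list.map sum_list.Cons sum_list.Nil hit_bound_bad add_0 add_0_right)
qed

text \<open>
  By the balance just noted, \<open>Bit\<close> and the bad coordinate of each of the \<open>i\<close> triples contribute
  \<open>16\<^bsup>-s\<^esup>\<close> each.
\<close>
lemma sum_hit_bound_schedule:
  "(\<Sum>m\<leftarrow>schedule s i. hit_bound m (level_set 0 s i)) = real (Suc i) * (1/16) ^ s"
proof (induction i)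
  case 0
  have "(\<Sum>m\<leftarrow>initial_moves s. hit_bound m (level_set 0 s 0)) = 0"
    by (rule sum_list_nonneg_eq_0_iff[THEN iffD2]) (auto simp: initial_moves_def hit_bound_good)
  then show ?case using hit_bound_Bit[of s 0] by simp
next
  case (Suc i)
  have "(\<Sum>m\<leftarrow>schedule s i. hit_bound m (level_set 0 s (Suc i)))
      = (\<Sum>m\<leftarrow>schedule s i. hit_bound m (level_set 0 s i) * (1/8))"
  proof (rule arg_cong[of _ _ sum_list], rule map_cong[OF refl])
    fix m assume "m \<in> set (schedule s i)"
    then have "m = Bit \<or> (\<exists>r. m = Flip r \<and> r \<in> level_set 0 s i)"
      unfolding levels_schedule[symmetric] levels_def by (metis mem_Collect_eq move.exhaust)
    then show "hit_bound m (level_set 0 s (Suc i)) = hit_bound m (level_set 0 s i) * (1/8)"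
      using hit_bound_Suc[of m _ s i] by auto
  qed
  also have "\<dots> = real (Suc i) * (1/16) ^ s * (1/8)"
    unfolding sum_list_mult_const Suc ..
  finally have *: "(\<Sum>m\<leftarrow>schedule s i. hit_bound m (level_set 0 s (Suc i))) = real (Suc i) * (1/16) ^ s * (1/8)" .
  have rep: "(\<Sum>m\<leftarrow>concat (replicate k ms). h m) = real k * (\<Sum>m\<leftarrow>ms. h m)" for k ms and h :: "move \<Rightarrow> real"
    by (induction k) (auto simp: algebra_simps)
  have "(\<Sum>m\<leftarrow>schedule s (Suc i). hit_bound m (level_set 0 s (Suc i)))
     = real 8 * (real (Suc i) * (1/16) ^ s * (1/8)) + (1/16) ^ s"
    unfolding schedule.simps map_append sum_list_append rep * hit_bound_fresh ..
  then show ?case by (simp add: algebra_simps)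
qed

text \<open>
  A suffix of the new stage is a suffix of a copy of the old one followed by at most seven more copies
  and the fresh moves. A suffix that follows a \<open>Bit\<close> already contains every coordinate of its copy,
  so the later copies are met with the full set \<open>level_set 0 s i\<close> flipped before.
\<close>
lemma expected_hits_schedule:
  "after_bits (\<lambda>suf. levels suf = level_set 0 s i \<and> expected_hits suf \<le> 11 * (real i)\<^sup>2 * (1/16) ^ s) (schedule s i)"
proof (induction i)
  case 0
  have 1: "levels (initial_moves s) = level_set 0 s 0" using levels_schedule[of s 0] by simp
  have "expected_hits (initial_moves s) = 0" unfolding expected_hits_def
  proof (rule sum.neutral, rule ballI)
    fix j assume "j \<in> {..<length (initial_moves s)}"
    then have "initial_moves s ! j \<in> set (initial_moves s)" by simp
    then show "hit_bound (initial_moves s ! j) (levels (take j (initial_moves s))) = 0"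
      by (auto simp: initial_moves_def hit_bound_good)
  qed
  moreover have "after_bits P (map Flip rs)" for P rs by (induction rs) auto
  ultimately show ?case using 1 by (simp add: initial_moves_def)
next
  case (Suc i)
  let ?q = "(1/16::real) ^ s" and ?R = "level_set 0 s i" and ?X = "schedule s i" and ?C = "fresh_moves s i"
  let ?P = "\<lambda>suf. levels suf = level_set 0 s (Suc i) \<and> expected_hits suf \<le> 11 * (real i)\<^sup>2 * ?q + (7 * real (Suc i) + 4) * ?q"
  have C: "levels ?C \<union> ?R = level_set 0 s (Suc i)" by (auto simp: level_set_Suc fresh_moves_def)
  have rep: "(\<Sum>m\<leftarrow>concat (replicate k ms). h m) = real k * (\<Sum>m\<leftarrow>ms. h m)" for k ms and h :: "move \<Rightarrow> real"
    by (induction k) (auto simp: algebra_simps)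
  have "after_bits ?P (concat (replicate k ?X) @ ?C)" if "k \<le> 8" for k
    using that
  proof (induction k)
    case 0
    then show ?case by (simp add: fresh_moves_def)
  next
    case (Suc k)
    let ?ys = "concat (replicate k ?X) @ ?C"
    have "after_bits (\<lambda>suf. ?P (suf @ ?ys)) ?X"
    proof (rule after_bits_mono[OF _ \<open>after_bits _ ?X\<close>])
      fix suf assume suf: "levels suf = ?R \<and> expected_hits suf \<le> 11 * (real i)\<^sup>2 * ?q"
      have "levels (suf @ ?ys) = level_set 0 s (Suc i)"
        using suf C by (auto simp: levels_concat_replicate levels_schedule)
      moreover have "expected_hits (suf @ ?ys) \<le> expected_hits suf + (\<Sum>m\<leftarrow>?ys. hit_bound m ?R)"
        using expected_hits_append[of suf ?ys] suf by simp
      moreover have "(\<Sum>m\<leftarrow>?ys. hit_bound m ?R) \<le> real k * (real (Suc i) * ?q) + 4 * ?q"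
        unfolding map_append sum_list_append rep sum_hit_bound_schedule
        using hit_bound_fresh(2) by simp
      moreover have "real k * (real (Suc i) * ?q) \<le> 7 * (real (Suc i) * ?q)"
        using Suc.prems by (intro mult_right_mono) auto
      ultimately show "?P (suf @ ?ys)" using suf by (simp add: algebra_simps)
    qed
    moreover have "after_bits ?P ?ys" using Suc by simp
    ultimately show ?case by (simp add: after_bits_append)
  qed
  from this[of 8] have "after_bits ?P (schedule s (Suc i))" by simp
  then show ?case
  proof (rule after_bits_mono[rotated])
    fix suf assume P: "?P suf"
    have "11 * (real i)\<^sup>2 + (7 * real (Suc i) + 4) \<le> 11 * (real (Suc i))\<^sup>2"
      by (simp add: power2_eq_square algebra_simps)
    then have "(11 * (real i)\<^sup>2 + (7 * real (Suc i) + 4)) * ?q \<le> 11 * (real (Suc i))\<^sup>2 * ?q"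
      by (rule mult_right_mono) simp
    then show "levels suf = level_set 0 s (Suc i) \<and> expected_hits suf \<le> 11 * (real (Suc i))\<^sup>2 * ?q"
      using P by (simp add: algebra_simps)
  qed
qed

theorem card_run_schedule:
  assumes "88 * (real I)\<^sup>2 \<le> 16 ^ s" "3 * (2 * s + I) \<le> L"
  shows "exp (8 ^ I / 8) \<le> real (card (run f (schedule s I) ` bits (length (schedule s I))))"
proof -
  have "11 * (real I)\<^sup>2 * (1/16) ^ s \<le> 1/8"
    using assms(1) by (simp add: power_one_over field_simps)
  then have "after_bits (\<lambda>ms. expected_hits ms \<le> 1/8) (schedule s I)"
    using after_bits_mono[OF _ expected_hits_schedule[of s I], of "\<lambda>ms. expected_hits ms \<le> 1/8"] by force
  moreover have "levels (schedule s I) \<subseteq> {..<L}"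
    using assms(2) level_set_less[of _ s I] by (force simp: levels_schedule level_set_def)
  ultimately have "exp (real (bit_count (schedule s I)) / 8)
     \<le> real (card (run f (schedule s I) ` bits (length (schedule s I))))"
    by (intro card_run_ge)
  then show ?thesis by (simp add: bit_count_def bit_count_schedule)
qed

end

section \<open>Elements that flip a whole level\<close>

lemma tree_map_aut_a: "tree_map aut_a"
proof -
  have "inj aut_a" by (metis aut_a_invol injI)
  moreover have "length (aut_a p) = length p" "take n (aut_a p) = aut_a (take n p)" for p n
    by (cases p; cases n; simp)+
  ultimately show ?thesis by (simp add: tree_map_def)
qed

lemma tree_map_letter_hom: "tree_map (letter_hom l x)"
  by (simp add: letter_hom_def tree_map_aut_a tree_map_id)

lemma tree_map_klein_aut: "tree_map (klein_aut \<omega> x)"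
proof -
  have "inj (klein_aut \<omega> x)" by (metis klein_aut_invol injI)
  moreover have "length (klein_aut \<omega> x p) = length p" for p
    by (induction p arbitrary: \<omega>) (auto simp: tree_map_length[OF tree_map_letter_hom])
  moreover have "take n (klein_aut \<omega> x p) = klein_aut \<omega> x (take n p)" for p n
  proof (induction p arbitrary: \<omega> n)
    case (Cons i p)
    then show ?case by (cases n) (auto simp: tree_map_take[OF tree_map_letter_hom])
  qed simp
  ultimately show ?thesis by (simp add: tree_map_def)
qed

lemma tree_map_act: "tree_map (act \<omega> xs)"
proof (induction xs)
  case Nil
  have "act \<omega> [] = id" by auto
  then show ?case using tree_map_id by metis
next
  case (Cons x xs)
  have "act \<omega> (x # xs) = act \<omega> xs \<circ> (klein_aut \<omega> x \<circ> aut_a)" by auto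
  then show ?case using Cons tree_map_comp tree_map_aut_a tree_map_klein_aut by metis
qed

lemma tree_map_twist: "tree_map (twist e)"
  by (simp add: twist_def tree_map_aut_a tree_map_id)

lemma flips_aut_a: "flips aut_a w \<longleftrightarrow> w = []"
  by (cases w) (auto simp: flips_def nth_append)

lemma flips_twist: "w \<noteq> [] \<Longrightarrow> \<not> flips (twist e) w"
  by (cases w) (auto simp: flips_def nth_append)

lemma flips_comp:
  assumes "tree_map f" "tree_map g"
  shows "flips (g \<circ> f) w \<longleftrightarrow> flips f w \<noteq> flips g (f w)"
  unfolding flips_def[of "g \<circ> f"]
  by (auto simp: tree_map_snoc assms nth_append tree_map_length)

lemma flips_section:
  assumes "\<And>q. f (u @ q) = u @ h q" shows "flips f (u @ w) \<longleftrightarrow> flips h w"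
  using assms[of "w @ [False]"] by (simp add: flips_def nth_append)

lemma flips_klein_aut:
  assumes "length w = Suc n"
  shows "flips (klein_aut \<omega> x) w \<longleftrightarrow> w = replicate n True @ [False] \<and> x \<noteq> K_id \<and> x \<noteq> vanishes_on (\<omega> n)"
  using assms
proof (induction n arbitrary: \<omega> w)
  case 0
  then obtain i where "w = [i]" by (cases w) auto
  then show ?case by (auto simp: flips_def letter_hom_def)
next
  case (Suc n)
  then obtain i v where w: "w = i # v" "length v = Suc n" by (cases w) auto
  have "flips (klein_aut \<omega> x) w \<longleftrightarrow> (if i then flips (klein_aut (shift \<omega>) x) v else flips (letter_hom (\<omega> 0) x) v)"
    by (simp add: w flips_def)
  moreover have "\<not> flips (letter_hom (\<omega> 0) x) v"
    using w(2) by (cases v) (auto simp: letter_hom_def flips_def nth_append)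
  ultimately show ?case using Suc.IH[OF w(2), of "shift \<omega>"] by (auto simp: w shift_def)
qed

lemma klein_aut_base: "klein_aut \<omega> x (replicate n True @ [False]) = replicate n True @ [False]"
  by (induction n arbitrary: \<omega>) (auto simp: letter_hom_def)

text \<open>
  Inverse to taking sections. For \<open>x\<close> not vanishing, \<open>a x a x\<close> puts \<open>x\<close> and an \<open>a\<close> into either
  section. The vanishing letter \<open>v\<close> appears by itself in one section; in the other one its two
  neighbours get multiplied, and they are chosen with product \<open>v\<close>.
\<close>
definition expand :: "letter \<Rightarrow> klein \<Rightarrow> klein list" where
  "expand l x = (if x = vanishes_on l
     then (case l of L0 \<Rightarrow> [K_b, K_d, K_c] | L1 \<Rightarrow> [K_b, K_c, K_d] | L2 \<Rightarrow> [K_c, K_b, K_d]) else [x, x])"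

definition subst :: "letter \<Rightarrow> klein list \<Rightarrow> klein list" where
  "subst l u = concat (map (expand l) u)"

lemma subst_simps [simp]: "subst l [] = []" "subst l (x # u) = expand l x @ subst l u"
  by (simp_all add: subst_def)

lemma act_expand:
  assumes "x \<noteq> K_id"
  shows "act \<omega> (expand (\<omega> 0) x) (i # q) =
    (let e = (i \<noteq> (x = vanishes_on (\<omega> 0))) in e # twist (\<not> e) (klein_aut (shift \<omega>) x (aut_a (twist (\<not> i) q))))"
proof (cases "x = vanishes_on (\<omega> 0)")
  case False
  then have "letter_hom (\<omega> 0) x = aut_a" using assms by (simp add: letter_hom_def)
  then show ?thesis using False by (cases i) (auto simp: expand_def aut_a_invol)
next
  case True
  then show ?thesis
    by (cases "\<omega> 0"; cases i)
       (auto simp: expand_def letter_hom_def klein_aut_mult klein_mult_def aut_a_invol doubleton_eq_iff)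
qed

text \<open>
  Both sections of the expanded word are the original word, up to factors \<open>a\<close> at the ends. The block
  of three letters for the vanishing letter reverses the role of the two sections, whence the parity.
\<close>
lemma act_subst:
  assumes "K_id \<notin> set u"
  shows "act \<omega> (subst (\<omega> 0) u) (i # q) =
    (let e = (i \<noteq> odd (count_list u (vanishes_on (\<omega> 0)))) in e # twist (\<not> e) (act (shift \<omega>) u (twist (\<not> i) q)))"
  using assms
proof (induction u arbitrary: i q)
  case (Cons x u)
  then have "x \<noteq> K_id" "K_id \<notin> set u" by auto
  then show ?case
    using Cons.IH by (auto simp: act_append act_expand Let_def)
qed (simp add: Let_def)

lemma count_subst:
  assumes "K_id \<notin> set u"
  shows "count_list (subst l u) z = (if z = K_id then 0 else if z = vanishes_on l then count_list u z
     else 2 * count_list u z + count_list u (vanishes_on l))"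
  using assms by (induction u) (cases l; auto simp: expand_def; cases z; auto)+

lemma K_id_subst: "K_id \<notin> set u \<Longrightarrow> K_id \<notin> set (subst l u)"
  by (cases l) (auto simp: subst_def expand_def)

primrec iter_subst :: "(nat \<Rightarrow> letter) \<Rightarrow> nat \<Rightarrow> klein list \<Rightarrow> klein list" where
  "iter_subst \<omega> 0 u = u"
| "iter_subst \<omega> (Suc r) u = subst (\<omega> 0) (iter_subst (shift \<omega>) r u)"

lemma K_id_iter_subst: "K_id \<notin> set u \<Longrightarrow> K_id \<notin> set (iter_subst \<omega> r u)"
  by (induction r arbitrary: \<omega>) (auto simp: K_id_subst)

text \<open>
  This parity is what makes all expanded words fix the first level.
\<close>
lemma even_iter_subst:
  assumes "x \<noteq> K_id" "x \<noteq> vanishes_on (\<omega> r)"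
  shows "even (count_list (iter_subst \<omega> (Suc r) [x]) z)"
  using assms(2)
proof (induction r arbitrary: \<omega> z)
  case 0
  then show ?case by (simp add: expand_def)
next
  case (Suc r)
  have "even (count_list (iter_subst (shift \<omega>) (Suc r) [x]) z)" for z
    by (rule Suc.IH) (use Suc.prems in \<open>simp add: shift_def\<close>)
  moreover have "K_id \<notin> set (iter_subst (shift \<omega>) (Suc r) [x])"
    using assms(1) by (intro K_id_iter_subst) auto
  ultimately show ?case
    by (subst iter_subst.simps(2)) (simp add: count_subst del: iter_subst.simps)
qed

definition drop_seq :: "nat \<Rightarrow> (nat \<Rightarrow> letter) \<Rightarrow> nat \<Rightarrow> letter" where
  "drop_seq r \<omega> = (\<lambda>n. \<omega> (n + r))"

lemma drop_seq_shift: "drop_seq r (shift \<omega>) = drop_seq (Suc r) \<omega>"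
  by (simp add: drop_seq_def shift_def)

text \<open>
  Expanding a single letter \<open>r\<close> times gives an element fixing level \<open>r\<close> with section \<open>a x\<close> or \<open>x a\<close> at each
  vertex of that level. The letter must not vanish at level \<open>r - 1\<close>; otherwise the first
  expansion would have odd parity.
\<close>
lemma act_iter_subst:
  assumes "x \<noteq> K_id" "r > 0 \<Longrightarrow> x \<noteq> vanishes_on (\<omega> (r - 1))" "length w = r"
  shows "\<exists>c. \<forall>q. act \<omega> (iter_subst \<omega> r [x]) (w @ q)
     = w @ twist c (klein_aut (drop_seq r \<omega>) x (aut_a (twist c q)))"
  using assms(2,3)
proof (induction r arbitrary: \<omega> w)
  case 0
  then show ?case by (intro exI[of _ False]) (auto simp: drop_seq_def)
next
  case (Suc r)
  obtain i w' where w: "w = i # w'" "length w' = r" using Suc.prems(2) by (cases w) auto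
  let ?u = "iter_subst (shift \<omega>) r [x]"
  have "K_id \<notin> set ?u" using assms(1) by (intro K_id_iter_subst) auto
  moreover have "even (count_list ?u (vanishes_on (\<omega> 0)))"
  proof (cases r)
    case 0 then show ?thesis using Suc.prems(1) by simp
  next
    case (Suc r')
    then show ?thesis using even_iter_subst[OF assms(1), of "shift \<omega>" r'] \<open>0 < Suc r \<Longrightarrow> _\<close>
      by (simp add: shift_def)
  qed
  ultimately have step: "act \<omega> (iter_subst \<omega> (Suc r) [x]) (i # q)
      = i # twist (\<not> i) (act (shift \<omega>) ?u (twist (\<not> i) q))" for q
    by (simp add: act_subst Let_def)
  have IH: "\<exists>c. \<forall>q. act (shift \<omega>) ?u (v @ q)
     = v @ twist c (klein_aut (drop_seq (Suc r) \<omega>) x (aut_a (twist c q)))" if "length v = r" for v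
  proof -
    have "r > 0 \<Longrightarrow> x \<noteq> vanishes_on (shift \<omega> (r - 1))" using Suc.prems(1) by (simp add: shift_def)
    then show ?thesis using Suc.IH[of "shift \<omega>" v] that unfolding drop_seq_shift by blast
  qed
  show ?case
  proof (cases w')
    case Nil
    then have r: "r = 0" using w by simp
    have sh: "drop_seq (Suc r) \<omega> = shift \<omega>" by (simp add: r drop_seq_def shift_def)
    have "act \<omega> (iter_subst \<omega> (Suc r) [x]) (w @ q)
         = w @ twist (\<not> i) (klein_aut (drop_seq (Suc r) \<omega>) x (aut_a (twist (\<not> i) q)))" for q
      unfolding w Nil append_Cons append_Nil step sh by (simp add: r)
    then show ?thesis by blast
  next
    case (Cons j v)
    let ?v = "(j \<noteq> (\<not> i)) # v"
    obtain c where c: "\<And>q. act (shift \<omega>) ?u (?v @ q)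
        = ?v @ twist c (klein_aut (drop_seq (Suc r) \<omega>) x (aut_a (twist c q)))"
      using IH[of ?v] w Cons by auto
    have t: "twist (\<not> i) (w' @ q) = ?v @ q" "twist (\<not> i) (?v @ q) = w' @ q" for q
      by (auto simp: Cons)
    show ?thesis
    proof (intro exI[of _ c] allI)
      fix q
      let ?X = "twist c (klein_aut (drop_seq (Suc r) \<omega>) x (aut_a (twist c q)))"
      have "act \<omega> (iter_subst \<omega> (Suc r) [x]) (w @ q)
         = i # twist (\<not> i) (act (shift \<omega>) ?u (twist (\<not> i) (w' @ q)))"
        unfolding w append_Cons by (rule step)
      also have "\<dots> = i # twist (\<not> i) (?v @ ?X)" by (simp only: t c)
      also have "\<dots> = i # (w' @ ?X)" by (simp only: t)
      also have "\<dots> = w @ ?X" by (simp add: w)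
      finally show "act \<omega> (iter_subst \<omega> (Suc r) [x]) (w @ q) = w @ ?X" .
    qed
  qed
qed

text \<open>
  For a triple \<open>012\<close> the letter vanishing at the middle level is \<open>c\<close>, which excludes \<open>c\<close> for
  \<open>r mod 3 = 2\<close>; \<open>b\<close> is admissible there for both types of triple.
\<close>
definition flip_letter :: "nat \<Rightarrow> klein" where
  "flip_letter r = (if r mod 3 = 2 then K_b else K_c)"

definition flip_word :: "(nat \<Rightarrow> letter) \<Rightarrow> nat \<Rightarrow> klein list" where
  "flip_word \<omega> r = iter_subst \<omega> r [flip_letter r]"

primrec move_map :: "(nat \<Rightarrow> letter) \<Rightarrow> move \<Rightarrow> word \<Rightarrow> word" where
  "move_map \<omega> Bit = klein_aut \<omega> K_b"
| "move_map \<omega> (Flip r) = act \<omega> (flip_word \<omega> r)"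

lemma flip_letter_omega: "r > 0 \<Longrightarrow> flip_letter r \<noteq> vanishes_on (omega \<tau> (r - 1))"
proof -
  assume "r > 0"
  then obtain n where n: "r = Suc n" by (cases r) auto
  have "n mod 3 < 3" by simp
  then consider "n mod 3 = 0" | "n mod 3 = 1" | "n mod 3 = 2" by linarith
  then show ?thesis
    by cases (auto simp: n flip_letter_def omega_def mod_Suc)
qed

lemma flip_section:
  assumes "length w = r"
  shows "\<exists>c. \<forall>q. move_map (omega \<tau>) (Flip r) (w @ q)
     = w @ twist c (klein_aut (drop_seq r (omega \<tau>)) (flip_letter r) (aut_a (twist c q)))"
  using act_iter_subst[of "flip_letter r" r "omega \<tau>" w] flip_letter_omega[of r \<tau>] assms
  by (auto simp: flip_word_def flip_letter_def split: if_splits)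

text \<open>
  At a level \<open>M\<close> where \<open>c\<close> vanishes, a Klein letter flips the watched coordinate below \<open>1\<^bsup>M\<^esup>0\<close> exactly
  if it is \<open>b\<close> or \<open>d\<close>. The section of \<open>\<Gamma>\<^sub>r\<close> meets its only Klein letter when the
  coordinates after \<open>r\<close> are those of the ray.
\<close>
lemma scheduled_walk_omega:
  assumes M: "omega \<tau> M = L1" and LM: "L \<le> M"
  shows "scheduled_walk (move_map (omega \<tau>)) L M"
proof
  let ?f = "move_map (omega \<tau>)"
  show tm: "tree_map (?f m)" for m
    by (cases m) (simp_all add: tree_map_klein_aut tree_map_act)
  show "L \<le> M" by fact
  show "flips (?f (Flip r)) w \<longleftrightarrow> length w = r" if r: "r < L" "length w \<le> r" for r w
  proof (cases "length w = r")
    case True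
    then obtain c where "\<And>q. ?f (Flip r) (w @ q)
       = w @ twist c (klein_aut (drop_seq r (omega \<tau>)) (flip_letter r) (aut_a (twist c q)))"
      using flip_section by blast
    from this[of "[False]"] True show ?thesis
      by (cases c) (simp_all add: flips_def nth_append)
  next
    case False
    define v where "v = (w @ [False]) @ replicate (r - Suc (length w)) False"
    have "length v = r" using r False by (simp add: v_def)
    from flip_section[OF this, of \<tau>] obtain c where
      "\<And>q. ?f (Flip r) (v @ q)
       = v @ twist c (klein_aut (drop_seq r (omega \<tau>)) (flip_letter r) (aut_a (twist c q)))" by blast
    from this[of "[]"] have "?f (Flip r) v = v" by simp
    moreover have "take (Suc (length w)) v = w @ [False]" by (simp add: v_def)
    ultimately have "?f (Flip r) (w @ [False]) = w @ [False]"
      using tree_map_take[OF tm, of "Suc (length w)" "Flip r" v] by simp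
    then show ?thesis using False by (simp add: flips_def)
  qed
  show "flips (?f Bit) (replicate M True @ [False])"
    by (simp add: flips_klein_aut M)
  show "?f Bit (replicate M True @ [False]) = replicate M True @ [False]"
    by (simp add: klein_aut_base)
  show "w ! i" if "length w = Suc M" "flips (?f Bit) w" "i < L" for w i
    using that LM by (auto simp: flips_klein_aut nth_append)
  show "r mod 3 = 2 \<and> (\<forall>i>r. i < L \<longrightarrow> w ! i)"
    if r: "r < L" "length w = Suc M" "flips (?f (Flip r)) w" for r w
  proof -
    define u v where "u = take r w" and "v = drop r w"
    have uv: "w = u @ v" "length u = r" "length v = Suc (M - r)" using r LM by (auto simp: u_def v_def)
    obtain j v' where v: "v = j # v'" using uv(3) by (cases v) auto
    from flip_section[OF uv(2), of \<tau>] obtain c where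
      c: "\<And>q. ?f (Flip r) (u @ q)
       = u @ twist c (klein_aut (drop_seq r (omega \<tau>)) (flip_letter r) (aut_a (twist c q)))" by blast
    let ?k = "klein_aut (drop_seq r (omega \<tau>)) (flip_letter r)"
    have "flips (twist c \<circ> (?k \<circ> (aut_a \<circ> twist c))) v"
      using r(3) flips_section[of "?f (Flip r)" u "twist c \<circ> (?k \<circ> (aut_a \<circ> twist c))" v] c uv(1)
      by (simp del: move_map.simps)
    moreover have "v \<noteq> []" "aut_a (twist c v) \<noteq> []" "twist c v \<noteq> []" "?k (aut_a (twist c v)) \<noteq> []"
      by (simp_all add: v)
    ultimately have "flips ?k (aut_a (twist c v))"
      by (simp add: flips_comp tree_map_twist tree_map_aut_a tree_map_klein_aut tree_map_comp flips_twist flips_aut_a)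
    moreover have "length (aut_a (twist c v)) = Suc (M - r)"
      using uv(3) by (simp add: tree_map_length[OF tree_map_twist] tree_map_length[OF tree_map_aut_a])
    ultimately have *: "aut_a (twist c v) = replicate (M - r) True @ [False]"
       "flip_letter r \<noteq> vanishes_on (drop_seq r (omega \<tau>) (M - r))"
      using flips_klein_aut by blast+
    have "r mod 3 = 2" using *(2) r LM M by (auto simp: drop_seq_def flip_letter_def split: if_splits)
    moreover have "w ! i" if "r < i" "i < L" for i
    proof -
      have "w ! i = v' ! (i - r - 1)" using that uv by (simp add: nth_append v nth_Cons')
      also have "\<dots> = (replicate (M - r) True @ [False]) ! (i - r)"
        unfolding *(1)[symmetric] using that by (simp add: v nth_Cons')
      also have "\<dots>" using that LM by (simp add: nth_append)
      finally show ?thesis by simp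
    qed
    ultimately show ?thesis by blast
  qed
qed

definition move_word :: "(nat \<Rightarrow> letter) \<Rightarrow> move \<Rightarrow> klein option list" where
  "move_word \<omega> m = (case m of Bit \<Rightarrow> [Some K_b] | Flip r \<Rightarrow> concat (map (\<lambda>x. [None, Some x]) (flip_word \<omega> r)))"

lemma ev_move_word: "ev \<omega> (move_word \<omega> m) p = move_map \<omega> m p"
proof -
  have "ev \<omega> (concat (map (\<lambda>x. [None, Some x]) xs)) p = act \<omega> xs p" for xs
    by (induction xs arbitrary: p) auto
  then show ?thesis by (cases m) (auto simp: move_word_def)
qed

definition cost :: "(nat \<Rightarrow> letter) \<Rightarrow> move list \<Rightarrow> nat" where
  "cost \<omega> ms = (\<Sum>m\<leftarrow>ms. length (move_word \<omega> m))"

lemma run_word: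
  "\<exists>ws. length ws \<le> cost \<omega> ms \<and> ev \<omega> ws = run (move_map \<omega>) ms bs"
proof (induction ms arbitrary: bs)
  case Nil
  show ?case by (intro exI[of _ "[]"]) (auto simp: fun_eq_iff)
next
  case (Cons m ms)
  obtain ws where ws: "length ws \<le> cost \<omega> ms" "ev \<omega> ws = run (move_map \<omega>) ms (tl bs)"
    using Cons by blast
  show ?case
    by (intro exI[of _ "(if hd bs then move_word \<omega> m else []) @ ws"])
       (use ws in \<open>auto simp: cost_def fun_eq_iff ev_append ev_move_word\<close>)
qed

theorem growth_lower_schedule:
  assumes "omega \<tau> M = L1" "3 * (2 * s + I) \<le> M" "88 * (real I)\<^sup>2 \<le> 16 ^ s"
    and "cost (omega \<tau>) (schedule s I) \<le> n"
  shows "exp (8 ^ I / 8) \<le> real (growth (grig (omega \<tau>)) (grig_gens (omega \<tau>)) n)"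
proof -
  interpret scheduled_walk "move_map (omega \<tau>)" "3 * (2 * s + I)" M "replicate M True @ [False]"
    by (rule scheduled_walk_omega) fact+
  let ?X = "run (move_map (omega \<tau>)) (schedule s I) ` bits (length (schedule s I))"
  have "exp (8 ^ I / 8) \<le> real (card ?X)" using card_run_schedule[OF assms(3)] by simp
  also have "?X \<subseteq> ev (omega \<tau>) ` {ws. length ws \<le> n}"
  proof
    fix g assume "g \<in> ?X"
    then obtain bs where "g = run (move_map (omega \<tau>)) (schedule s I) bs" by blast
    then obtain ws where "length ws \<le> cost (omega \<tau>) (schedule s I)" "ev (omega \<tau>) ws = g"
      using run_word by blast
    then show "g \<in> ev (omega \<tau>) ` {ws. length ws \<le> n}" using assms(4) by force
  qed
  then have "card ?X \<le> card (ev (omega \<tau>) ` {ws. length ws \<le> n})"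
    by (intro card_mono finite_imageI finite_words)
  finally show ?thesis by (simp add: growth_eq)
qed

section \<open>The lower bound\<close>

lemma count_012_Suc: "count_012 \<tau> (Suc I) = count_012 \<tau> I + (if \<tau> I then 1 else 0)"
proof (induction I arbitrary: \<tau>)
  case (Suc I)
  show ?case using Suc[of "drop_triple \<tau>"] by (subst (1 2) count_012.simps(2)) (simp add: drop_triple_def)
qed simp

lemma switches_Suc: "switches \<tau> (Suc I) = switches \<tau> I + (if \<tau> I \<noteq> \<tau> (Suc I) then 1 else 0)"
proof (induction I arbitrary: \<tau>)
  case (Suc I)
  show ?case using Suc[of "drop_triple \<tau>"] by (subst (1 2) switches.simps(2)) (simp add: drop_triple_def)
qed simp

lemma count_012_add: "count_012 \<tau> I \<le> count_012 \<tau> (I + k)" "count_012 \<tau> (I + k) \<le> count_012 \<tau> I + k"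
  by (induction k) (auto simp: count_012_Suc simp del: count_012.simps)

lemma switches_mono: "I \<le> J \<Longrightarrow> switches \<tau> I \<le> switches \<tau> J"
  by (rule lift_Suc_mono_le[of "switches \<tau>"]) (auto simp: switches_Suc simp del: switches.simps)

definition xi :: real where "xi = 1 / eta ^ 3"

lemma xi_bounds: "1 < xi" "xi \<le> 2"
proof -
  show "1 < xi" using eta_powers by (simp add: xi_def)
  have "(4/5) ^ 3 \<le> eta ^ 3" using eta_bounds by (intro power_mono) auto
  then show "xi \<le> 2" using eta_powers by (simp add: xi_def power_divide field_simps)
qed

text \<open>
  The weight of the expansion of a letter, so that weighing an expanded word amounts to weighing the
  original one with the pulled back weights.
\<close>
definition pull :: "letter \<Rightarrow> (klein \<Rightarrow> real) \<Rightarrow> klein \<Rightarrow> real" where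
  "pull l w x = (\<Sum>y\<leftarrow>expand l x. w y)"

lemma sum_subst: "(\<Sum>y\<leftarrow>subst l u. w y) = (\<Sum>x\<leftarrow>u. pull l w x)"
  by (induction u) (auto simp: pull_def)

text \<open>
  Eigenvectors of the pull-back along a whole triple, see \<open>pull_triple\<close>.
\<close>
fun length_weight :: "bool \<Rightarrow> klein \<Rightarrow> real" where
  "length_weight t K_id = 0"
| "length_weight t K_b = 1"
| "length_weight t K_c = (if t then eta else 1)"
| "length_weight t K_d = (if t then eta ^ 2 else 2)"

lemma eta_square: "16/25 < eta ^ 2" "eta ^ 2 < 1"
proof -
  have "(4/5) ^ 2 < eta ^ 2" using eta_bounds by (intro power_strict_mono) auto
  then show "16/25 < eta ^ 2" by (simp add: power_divide)
  show "eta ^ 2 < 1" using eta_powers eta_bounds by linarith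
qed

lemma length_weight_bounds:
  "0 \<le> length_weight t x" "x \<noteq> K_id \<Longrightarrow> 1 \<le> 2 * length_weight t x" "length_weight t x \<le> 2"
  "length_weight t x \<le> 4 * length_weight t' x"
  using eta_bounds eta_square by (cases x; auto)+

lemma pull_triple:
  "pull L2 (pull L1 (pull L0 (length_weight True))) x = 8 * xi * length_weight True x"
  "pull L0 (pull L0 (pull L0 (length_weight False))) x = 8 * length_weight False x"
proof -
  have e3: "eta ^ 3 = 2 - eta ^ 2 - eta" using eta_cubic by simp
  have inv: "y = 8 * xi * z" if "y * eta ^ 3 = 8 * z" for y z
    using that eta_powers by (simp add: xi_def field_simps)
  have "eta * (eta ^ 3 + eta ^ 2 + eta) = eta ^ 4 + eta ^ 3 + eta ^ 2"
    "eta ^ 2 * (eta ^ 3 + eta ^ 2 + eta) = eta ^ 5 + eta ^ 4 + eta ^ 3"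
    by (simp_all add: algebra_simps eval_nat_numeral)
  then have e45: "eta ^ 4 + eta ^ 3 + eta ^ 2 = 2 * eta" "eta ^ 5 + eta ^ 4 + eta ^ 3 = 2 * eta ^ 2"
    unfolding eta_cubic by simp_all
  have b: "(9 + 5 * eta + 3 * eta ^ 2) * eta ^ 3 = 8 * 1"
  proof -
    have "(9 + 5 * eta + 3 * eta ^ 2) * eta ^ 3 = 9 * eta ^ 3 + 5 * eta ^ 4 + 3 * eta ^ 5"
      by (simp add: algebra_simps eval_nat_numeral)
    then show ?thesis using e3 e45 by linarith
  qed
  have c: "(6 + 6 * eta + 2 * eta ^ 2) * eta ^ 3 = 8 * eta"
  proof -
    have "(6 + 6 * eta + 2 * eta ^ 2) * eta ^ 3 = 6 * eta ^ 3 + 6 * eta ^ 4 + 2 * eta ^ 5"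
      by (simp add: algebra_simps eval_nat_numeral)
    then show ?thesis using e3 e45 by linarith
  qed
  have d: "(4 + 4 * eta + 4 * eta ^ 2) * eta ^ 3 = 8 * eta ^ 2"
  proof -
    have "(4 + 4 * eta + 4 * eta ^ 2) * eta ^ 3 = 4 * eta ^ 3 + 4 * eta ^ 4 + 4 * eta ^ 5"
      by (simp add: algebra_simps eval_nat_numeral)
    then show ?thesis using e3 e45 by linarith
  qed
  show "pull L2 (pull L1 (pull L0 (length_weight True))) x = 8 * xi * length_weight True x"
    using inv[OF b] inv[OF c] inv[OF d] by (cases x) (simp_all add: pull_def expand_def)
  show "pull L0 (pull L0 (pull L0 (length_weight False))) x = 8 * length_weight False x"
    by (cases x) (simp_all add: pull_def expand_def)
qed

definition total_weight :: "bool \<Rightarrow> klein list \<Rightarrow> real" where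
  "total_weight t u = (\<Sum>x\<leftarrow>u. length_weight t x)"

lemma total_weight_bounds:
  "0 \<le> total_weight t u" "K_id \<notin> set u \<Longrightarrow> real (length u) \<le> 2 * total_weight t u"
  "total_weight t u \<le> 2 * real (length u)" "total_weight t u \<le> 4 * total_weight t' u"
proof -
  show "0 \<le> total_weight t u"
    unfolding total_weight_def by (rule sum_list_nonneg) (auto simp: length_weight_bounds)
  show "K_id \<notin> set u \<Longrightarrow> real (length u) \<le> 2 * total_weight t u"
  proof (induction u)
    case (Cons x u)
    then have "x \<noteq> K_id" by auto
    from length_weight_bounds(2)[OF this, of t] Cons show ?case by (simp add: total_weight_def)
  qed (simp add: total_weight_def)
  show "total_weight t u \<le> 2 * real (length u)"
  proof (induction u)
    case (Cons x u)
    then show ?case using length_weight_bounds(3)[of t x] by (simp add: total_weight_def)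
  qed (simp add: total_weight_def)
  show "total_weight t u \<le> 4 * total_weight t' u"
  proof (induction u)
    case (Cons x u)
    then show ?case using length_weight_bounds(4)[of t x t'] by (simp add: total_weight_def)
  qed (simp add: total_weight_def)
qed

lemma total_weight_triple:
  "total_weight (\<tau> 0) (iter_subst (omega \<tau>) (Suc (Suc (Suc r))) u)
    = 8 * xi ^ (if \<tau> 0 then 1 else 0) * total_weight (\<tau> 0) (iter_subst (omega (drop_triple \<tau>)) r u)"
proof -
  let ?v = "iter_subst (omega (drop_triple \<tau>)) r u"
  have const: "(\<Sum>x\<leftarrow>v. k * w x) = k * (\<Sum>x\<leftarrow>v. w x)" for v :: "klein list" and k :: real and w
    by (rule sum_list_const_mult)
  show ?thesis
  proof (cases "\<tau> 0")
    case True
    then have "total_weight (\<tau> 0) (iter_subst (omega \<tau>) (Suc (Suc (Suc r))) u)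
      = (\<Sum>y\<leftarrow>subst L0 (subst L1 (subst L2 ?v)). length_weight True y)"
      by (simp only: iter_subst.simps omega_first shift_omega total_weight_def if_True)
    then show ?thesis unfolding sum_subst pull_triple const using True by (simp add: total_weight_def)
  next
    case False
    then have "total_weight (\<tau> 0) (iter_subst (omega \<tau>) (Suc (Suc (Suc r))) u)
      = (\<Sum>y\<leftarrow>subst L0 (subst L0 (subst L0 ?v)). length_weight False y)"
      by (simp only: iter_subst.simps omega_first shift_omega total_weight_def if_False)
    then show ?thesis unfolding sum_subst pull_triple const using False by (simp add: total_weight_def)
  qed
qed

text \<open>
  As for the upper bound, equal consecutive triples use the same weights and a change of type costs a
  bounded factor; the at most two levels after the last complete triple are estimated crudely.
\<close>
lemma total_weight_iter_subst:
  "total_weight (\<tau> 0) (iter_subst (omega \<tau>) (3 * I + j) u)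
    \<le> 4 ^ switches \<tau> I * 8 ^ I * xi ^ count_012 \<tau> I * (2 * 3 ^ j * real (length u))"
proof (induction I arbitrary: \<tau>)
  case 0
  have l: "length (subst l v) \<le> 3 * length v" for l v
    by (induction v) (auto simp: expand_def split: letter.splits)
  have "length (iter_subst \<omega> j u) \<le> 3 ^ j * length u" for \<omega>
  proof (induction j arbitrary: \<omega>)
    case (Suc j)
    show ?case using l[of "\<omega> 0" "iter_subst (shift \<omega>) j u"] Suc[of "shift \<omega>"] by simp
  qed simp
  from of_nat_mono[OF this[of "omega \<tau>"], where 'a = real]
  have "2 * real (length (iter_subst (omega \<tau>) j u)) \<le> 2 * 3 ^ j * real (length u)" by simp
  then show ?case using total_weight_bounds(3)[of "\<tau> 0" "iter_subst (omega \<tau>) j u"] by simp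
next
  case (Suc I)
  let ?\<tau>' = "drop_triple \<tau>" and ?l = "2 * 3 ^ j * real (length u)"
  let ?v = "iter_subst (omega ?\<tau>') (3 * I + j) u"
  have "total_weight (\<tau> 0) ?v \<le> 4 ^ (if \<tau> 0 \<noteq> \<tau> 1 then 1 else 0) * total_weight (?\<tau>' 0) ?v"
    using total_weight_bounds(4)[of "\<tau> 0" ?v "\<tau> 1"] by (auto simp: drop_triple_def)
  also have "\<dots> \<le> 4 ^ (if \<tau> 0 \<noteq> \<tau> 1 then 1 else 0) *
      (4 ^ switches ?\<tau>' I * 8 ^ I * xi ^ count_012 ?\<tau>' I * ?l)"
    by (intro mult_left_mono Suc) auto
  finally have le: "8 * xi ^ (if \<tau> 0 then 1 else 0) * total_weight (\<tau> 0) ?v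
     \<le> 8 * xi ^ (if \<tau> 0 then 1 else 0) * (4 ^ (if \<tau> 0 \<noteq> \<tau> 1 then 1 else 0) *
      (4 ^ switches ?\<tau>' I * 8 ^ I * xi ^ count_012 ?\<tau>' I * ?l))"
    using xi_bounds by (intro mult_left_mono) auto
  have k3: "3 * Suc I + j = Suc (Suc (Suc (3 * I + j)))" by simp
  show ?case unfolding k3 total_weight_triple using le by (simp add: power_add mult_ac)
qed

lemma length_flip_word:
  "real (length (flip_word (omega \<tau>) r))
     \<le> 36 * (4 ^ switches \<tau> (r div 3) * 8 ^ (r div 3) * xi ^ count_012 \<tau> (r div 3))"
proof -
  let ?K = "4 ^ switches \<tau> (r div 3) * 8 ^ (r div 3) * xi ^ count_012 \<tau> (r div 3)"
  have "K_id \<notin> set (flip_word (omega \<tau>) r)"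
    unfolding flip_word_def by (rule K_id_iter_subst) (simp add: flip_letter_def)
  then have "real (length (flip_word (omega \<tau>) r)) \<le> 2 * total_weight (\<tau> 0) (flip_word (omega \<tau>) r)"
    by (rule total_weight_bounds)
  also have "total_weight (\<tau> 0) (flip_word (omega \<tau>) r) \<le> ?K * (2 * 3 ^ (r mod 3) * 1)"
    using total_weight_iter_subst[of \<tau> "r div 3" "r mod 3" "[flip_letter r]"] by (simp add: flip_word_def)
  also have "\<dots> \<le> ?K * (2 * 3 ^ 2 * 1)"
    using xi_bounds by (intro mult_left_mono mult_right_mono power_increasing) auto
  finally show ?thesis by simp
qed

lemma cost_append: "cost \<omega> (ms @ ms') = cost \<omega> ms + cost \<omega> ms'" by (simp add: cost_def)

text \<open>
  A move \<open>Flip r\<close> introduced at stage \<open>k\<close> has length about \<open>8\<^bsup>k\<^esup>\<close>, up to \<open>\<xi>\<^bsup>c\<^esup>\<close> and the factors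
  caused by \<open>s\<close> and the changes of type, and is repeated \<open>8\<^bsup>i-k\<^esup>\<close> times in stage \<open>i\<close>. All
  stages get the same bound.
\<close>
lemma cost_schedule:
  assumes "i \<le> I"
  shows "real (cost (omega \<tau>) (schedule s i))
    \<le> 8 ^ i * (4 ^ switches \<tau> (2 * s + I) * 8 ^ (2 * s) * xi ^ (count_012 \<tau> I + 2 * s)) * (1 + 432 * real s + 27 * real i)"
proof -
  define P where "P = 4 ^ switches \<tau> (2 * s + I) * 8 ^ (2 * s) * xi ^ (count_012 \<tau> I + 2 * s)"
  have P1: "1 \<le> P"
  proof -
    have "1 * 1 * 1 \<le> P" unfolding P_def using xi_bounds
      by (intro mult_mono one_le_power) auto
    then show ?thesis by simp
  qed
  have mw: "real (length (move_word (omega \<tau>) (Flip r))) \<le> 72 * (8 ^ k * P)"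
    if r: "r div 3 \<le> 2 * s + k" "k \<le> I" for r k
  proof -
    let ?q = "r div 3"
    have "real (length (move_word (omega \<tau>) (Flip r))) = 2 * real (length (flip_word (omega \<tau>) r))"
      by (simp add: move_word_def length_concat comp_def sum_list_triv)
    also have "\<dots> \<le> 72 * (4 ^ switches \<tau> ?q * 8 ^ ?q * xi ^ count_012 \<tau> ?q)"
      using length_flip_word[of \<tau> r] by linarith
    also have "4 ^ switches \<tau> ?q * 8 ^ ?q * xi ^ count_012 \<tau> ?q
      \<le> 4 ^ switches \<tau> (2 * s + I) * 8 ^ (2 * s + k) * xi ^ (count_012 \<tau> I + 2 * s)"
    proof -
      have "count_012 \<tau> ?q \<le> count_012 \<tau> I + 2 * s"
        using count_012_add(1)[of \<tau> ?q "I + 2 * s - ?q"] count_012_add(2)[of \<tau> I "2 * s"] r by simp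
      moreover have "switches \<tau> ?q \<le> switches \<tau> (2 * s + I)" using r by (intro switches_mono) simp
      ultimately show ?thesis using r xi_bounds
        by (intro mult_mono power_increasing) auto
    qed
    also have "\<dots> = 8 ^ k * P" by (simp add: P_def power_add)
    finally show ?thesis by simp
  qed
  have "real (cost (omega \<tau>) (schedule s i)) \<le> 8 ^ i * P * (1 + 432 * real s + 27 * real i)"
    using assms
  proof (induction i)
    case 0
    have init: "real (cost (omega \<tau>) (map Flip rs)) \<le> real (length rs) * (72 * P)"
      if "\<forall>r\<in>set rs. r < 6 * s" for rs
      using that
    proof (induction rs)
      case (Cons r rs)
      then have "r div 3 \<le> 2 * s + 0" by auto
      from mw[OF this] have "real (length (move_word (omega \<tau>) (Flip r))) \<le> 72 * P" by simp
      then show ?case using Cons by (simp add: cost_def algebra_simps)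
    qed (simp add: cost_def)
    have "real (cost (omega \<tau>) (initial_moves s)) \<le> real (length (filter (\<lambda>r. r mod 3 \<noteq> 2) [0..<6 * s])) * (72 * P)"
      unfolding initial_moves_def by (rule init) auto
    also have "\<dots> \<le> real (6 * s) * (72 * P)"
      using length_filter_le[of "\<lambda>r. r mod 3 \<noteq> 2" "[0..<6 * s]"] P1
      by (intro mult_right_mono of_nat_mono) auto
    finally have "real (cost (omega \<tau>) (initial_moves s)) \<le> 432 * real s * P" by simp
    moreover have "cost (omega \<tau>) (schedule s 0) = 1 + cost (omega \<tau>) (initial_moves s)"
      by (simp add: cost_def move_word_def)
    ultimately show ?case using P1 by (simp add: algebra_simps)
  next
    case (Suc i)
    have rep: "cost (omega \<tau>) (concat (replicate k ms)) = k * cost (omega \<tau>) ms" for k ms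
      by (induction k) (auto simp: cost_def)
    have "3 * (2 * s + i) div 3 \<le> 2 * s + i" "(3 * (2 * s + i) + 1) div 3 \<le> 2 * s + i"
      "(3 * i + 2) div 3 \<le> 2 * s + i" by presburger+
    then have m: "real (length (move_word (omega \<tau>) (Flip (3 * (2 * s + i))))) \<le> 72 * (8 ^ i * P)"
      "real (length (move_word (omega \<tau>) (Flip (3 * (2 * s + i) + 1)))) \<le> 72 * (8 ^ i * P)"
      "real (length (move_word (omega \<tau>) (Flip (3 * i + 2)))) \<le> 72 * (8 ^ i * P)"
      using mw Suc.prems by (meson Suc_leD)+
    have "real (cost (omega \<tau>) (fresh_moves s i))
       = real (length (move_word (omega \<tau>) (Flip (3 * (2 * s + i)))))
       + real (length (move_word (omega \<tau>) (Flip (3 * (2 * s + i) + 1))))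
       + real (length (move_word (omega \<tau>) (Flip (3 * i + 2))))"
      unfolding fresh_moves_def cost_def by (simp only: list.map sum_list.Cons sum_list.Nil of_nat_add of_nat_0)
    then have "real (cost (omega \<tau>) (fresh_moves s i)) \<le> 3 * (72 * (8 ^ i * P))"
      using m by linarith
    moreover have "real (cost (omega \<tau>) (schedule s i)) \<le> 8 ^ i * P * (1 + 432 * real s + 27 * real i)"
      using Suc by simp
    ultimately have "8 * real (cost (omega \<tau>) (schedule s i)) + real (cost (omega \<tau>) (fresh_moves s i))
       \<le> 8 * (8 ^ i * P * (1 + 432 * real s + 27 * real i)) + 3 * (72 * (8 ^ i * P))" by linarith
    moreover have "cost (omega \<tau>) (schedule s (Suc i)) = 8 * cost (omega \<tau>) (schedule s i) + cost (omega \<tau>) (fresh_moves s i)"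
      unfolding schedule.simps cost_append rep ..
    ultimately show ?case by (simp add: algebra_simps)
  qed
  then show ?thesis by (simp add: P_def)
qed

theorem growth_lower:
  assumes inf: "\<And>N. \<exists>q\<ge>N. \<tau> q" and s: "88 * (real I)\<^sup>2 \<le> 16 ^ s"
    and n: "8 ^ I * xi ^ count_012 \<tau> I * (4 ^ switches \<tau> (2 * s + I) * 256 ^ s * (1 + 432 * real s + 27 * real I)) \<le> real n"
  shows "exp (8 ^ I / 8) \<le> real (growth (grig (omega \<tau>)) (grig_gens (omega \<tau>)) n)"
proof -
  obtain q where q: "2 * s + I \<le> q" "\<tau> q" using inf by blast
  have div: "(3 * q + 1) div 3 = q" "(3 * q + 1) mod 3 = 1" by presburger+
  have M: "omega \<tau> (3 * q + 1) = L1" unfolding omega_def div using q by simp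
  have "real (cost (omega \<tau>) (schedule s I))
     \<le> 8 ^ I * (4 ^ switches \<tau> (2 * s + I) * 8 ^ (2 * s) * xi ^ (count_012 \<tau> I + 2 * s)) * (1 + 432 * real s + 27 * real I)"
    by (rule cost_schedule) simp
  also have "\<dots> \<le> 8 ^ I * (4 ^ switches \<tau> (2 * s + I) * 8 ^ (2 * s) * (xi ^ count_012 \<tau> I * 2 ^ (2 * s))) * (1 + 432 * real s + 27 * real I)"
    unfolding power_add using xi_bounds
    by (intro mult_right_mono mult_left_mono power_mono) auto
  also have "\<dots> = 8 ^ I * xi ^ count_012 \<tau> I * (4 ^ switches \<tau> (2 * s + I) * 256 ^ s * (1 + 432 * real s + 27 * real I))"
  proof -
    have "(8::real) ^ (2 * s) * 2 ^ (2 * s) = 256 ^ s" by (simp add: power_mult power_mult_distrib[symmetric])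
    then show ?thesis by (simp add: mult_ac)
  qed
  also note n
  finally have "cost (omega \<tau>) (schedule s I) \<le> n" by simp
  then show ?thesis using growth_lower_schedule[OF M _ s] q by simp
qed

section \<open>Triples with prescribed density\<close>

text \<open>
  The density keeps one value while \<open>j\<close> runs from \<open>fact r\<close> to \<open>fact (r + 1)\<close> and then switches. The
  stages grow faster than any geometric sequence, so at the end of a stage its own density dominates the
  average.
\<close>
definition density :: "real \<Rightarrow> real \<Rightarrow> nat \<Rightarrow> real" where
  "density p m j = (if even (LEAST r. j < fact r) then p else m)"

text \<open>
  The triples \<open>j\<^sup>2, \<dots>, (j + 1)\<^sup>2 - 1\<close> form a block, which starts with the triples \<open>012\<close>. Only two
  changes of type per block make \<open>O(\<surd>I)\<close> changes among \<open>I\<close> triples, and the average density still follows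
  \<open>density\<close>. As the comparison is not strict, each block contains a triple \<open>012\<close>, even if the
  density is \<open>0\<close>; the lower bound needs infinitely many of them.
\<close>
definition pattern :: "real \<Rightarrow> real \<Rightarrow> nat \<Rightarrow> bool" where
  "pattern p m q \<longleftrightarrow> real (q - (floor_sqrt q)\<^sup>2) \<le> density p m (floor_sqrt q) * real (2 * floor_sqrt q + 1)"

lemma density_stage:
  assumes "fact r \<le> j" "j < fact (Suc r)"
  shows "density p m j = (if even (Suc r) then p else m)"
proof -
  have "(LEAST r. j < fact r) = Suc r"
  proof (rule Least_equality)
    fix y assume "j < fact y"
    then show "Suc r \<le> y"
      using assms(1) fact_mono_nat[of y r] by (meson leD le_less_trans not_less_eq_eq order.trans)
  qed fact
  then show ?thesis by (simp add: density_def)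
qed

lemma real_floor_sqrt: "real (floor_sqrt I) \<le> sqrt (real I)"
  using floor_sqrt_power2_le[of I] by (metis of_nat_le_iff of_nat_power real_le_rsqrt)

lemma sum_odd_real: "(\<Sum>j<J. real (2 * j + 1)) = (real J)\<^sup>2"
  by (induction J) (auto simp: power2_eq_square algebra_simps)

context
  fixes p m :: real
  assumes pm: "0 \<le> m" "m \<le> p" "p \<le> 1"
begin

lemma density_bounds: "m \<le> density p m j" "density p m j \<le> p"
  using pm by (auto simp: density_def)

lemma pattern_block:
  assumes "i < 2 * j + 1"
  shows "pattern p m (j\<^sup>2 + i) \<longleftrightarrow> real i \<le> density p m j * real (2 * j + 1)"
proof -
  have "floor_sqrt (j\<^sup>2 + i) = j"
    by (rule floor_sqrt_unique) (use assms in \<open>auto simp: power2_eq_square\<close>)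
  then show ?thesis by (simp add: pattern_def)
qed

lemma count_block:
  assumes "k \<le> 2 * j + 1"
  shows "count_012 (pattern p m) (j\<^sup>2 + k)
    = count_012 (pattern p m) (j\<^sup>2) + min k (Suc (nat \<lfloor>density p m j * real (2 * j + 1)\<rfloor>))"
  using assms
proof (induction k)
  case (Suc k)
  have "0 \<le> density p m j * real (2 * j + 1)" using density_bounds(1)[of j] pm by simp
  then have "pattern p m (j\<^sup>2 + k) \<longleftrightarrow> k < Suc (nat \<lfloor>density p m j * real (2 * j + 1)\<rfloor>)"
    using pattern_block[of k j] Suc.prems by (simp add: le_nat_floor less_Suc_eq_le le_nat_iff le_floor_iff)
  then show ?case using Suc count_012_Suc[of "pattern p m" "j\<^sup>2 + k"] by (simp del: count_012.simps)
qed simp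

lemma count_square:
  "(\<Sum>j<J. density p m j * real (2 * j + 1)) \<le> real (count_012 (pattern p m) (J\<^sup>2))"
  "real (count_012 (pattern p m) (J\<^sup>2)) \<le> (\<Sum>j<J. density p m j * real (2 * j + 1)) + real J"
proof (induction J)
  case (Suc j)
  let ?x = "density p m j * real (2 * j + 1)"
  have "?x \<le> 1 * real (2 * j + 1)" using density_bounds(2)[of j] pm by (intro mult_right_mono) auto
  moreover have "0 \<le> ?x" using density_bounds(1)[of j] pm by simp
  ultimately have "?x \<le> real (min (2 * j + 1) (Suc (nat \<lfloor>?x\<rfloor>)))"
     "real (min (2 * j + 1) (Suc (nat \<lfloor>?x\<rfloor>))) \<le> ?x + 1"
    by (auto simp: min_def) linarith+
  moreover have "(Suc j)\<^sup>2 = j\<^sup>2 + (2 * j + 1)" by (simp add: power2_eq_square)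
  moreover note count_block[of "2 * j + 1" j]
  ultimately show "(\<Sum>j<Suc j. density p m j * real (2 * j + 1)) \<le> real (count_012 (pattern p m) ((Suc j)\<^sup>2))"
     "real (count_012 (pattern p m) ((Suc j)\<^sup>2)) \<le> (\<Sum>j<Suc j. density p m j * real (2 * j + 1)) + real (Suc j)"
    using Suc by (simp_all del: of_nat_add of_nat_Suc)
qed (simp_all)

lemma switches_block:
  assumes "k \<le> 2 * j"
  shows "switches (pattern p m) (j\<^sup>2 + k) \<le> switches (pattern p m) (j\<^sup>2)
     + (if real k \<le> density p m j * real (2 * j + 1) then 0 else 1)"
  using assms
proof (induction k)
  case (Suc k)
  have "pattern p m (j\<^sup>2 + k) \<longleftrightarrow> real k \<le> density p m j * real (2 * j + 1)"
    "pattern p m (Suc (j\<^sup>2 + k)) \<longleftrightarrow> real (Suc k) \<le> density p m j * real (2 * j + 1)"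
    using pattern_block[of k j] pattern_block[of "Suc k" j] Suc.prems by simp_all
  then show ?case using Suc switches_Suc[of "pattern p m" "j\<^sup>2 + k"]
    by (auto split: if_splits simp del: switches.simps)
qed simp

lemma switches_bound: "real (switches (pattern p m) I) \<le> 2 * sqrt (real I) + 2"
proof -
  have sq: "switches (pattern p m) (J\<^sup>2) \<le> 2 * J" for J
  proof (induction J)
    case (Suc j)
    have "(Suc j)\<^sup>2 = Suc (j\<^sup>2 + 2 * j)" by (simp add: power2_eq_square)
    then have "switches (pattern p m) ((Suc j)\<^sup>2) \<le> switches (pattern p m) (j\<^sup>2 + 2 * j) + 1"
      using switches_Suc[of "pattern p m" "j\<^sup>2 + 2 * j"] by (simp del: switches.simps)
    also have "switches (pattern p m) (j\<^sup>2 + 2 * j) \<le> switches (pattern p m) (j\<^sup>2) + 1"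
      using switches_block[of "2 * j" j] by (simp split: if_splits)
    finally show ?case using Suc by simp
  qed simp
  have "switches (pattern p m) I \<le> switches (pattern p m) ((Suc (floor_sqrt I))\<^sup>2)"
    using Suc_floor_sqrt_power2_gt[of I] by (intro switches_mono) simp
  also have "\<dots> \<le> 2 * Suc (floor_sqrt I)" by (rule sq)
  finally have "real (switches (pattern p m) I) \<le> 2 * real (floor_sqrt I) + 2" by simp
  then show ?thesis using real_floor_sqrt[of I] by simp
qed

lemma count_bounds:
  "m * real I - 2 * sqrt (real I) \<le> real (count_012 (pattern p m) I)"
  "real (count_012 (pattern p m) I) \<le> p * real I + 3 * sqrt (real I)"
proof -
  define J where "J = floor_sqrt I"
  have J: "J\<^sup>2 \<le> I" "I \<le> J\<^sup>2 + 2 * J" "real J \<le> sqrt (real I)"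
    using Suc_floor_sqrt_power2_gt[of I] real_floor_sqrt[of I] floor_sqrt_power2_le[of I]
    by (auto simp: J_def power2_eq_square)
  from of_nat_mono[OF J(1), where 'a = real] of_nat_mono[OF J(2), where 'a = real]
  have JR: "(real J)\<^sup>2 \<le> real I" "real I \<le> (real J)\<^sup>2 + 2 * real J" by simp_all
  obtain k where k: "I = J\<^sup>2 + k" "k \<le> 2 * J" using J by (metis add_le_cancel_left le_add_diff_inverse)
  have s: "m * (real J)\<^sup>2 \<le> (\<Sum>j<J. density p m j * real (2 * j + 1))"
     "(\<Sum>j<J. density p m j * real (2 * j + 1)) \<le> p * (real J)\<^sup>2"
    unfolding sum_odd_real[symmetric] sum_distrib_left using density_bounds
    by (intro sum_mono mult_right_mono; simp)+
  have "m * real I \<le> m * ((real J)\<^sup>2 + 2 * real J)" using JR pm by (intro mult_left_mono) auto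
  also have "\<dots> \<le> m * (real J)\<^sup>2 + 2 * real J"
    using pm mult_right_mono[of m 1 "2 * real J"] by (simp add: distrib_left)
  finally show "m * real I - 2 * sqrt (real I) \<le> real (count_012 (pattern p m) I)"
    using s(1) count_square(1)[of J] count_012_add(1)[of "pattern p m" "J\<^sup>2" k] J(3) k by simp
  have "p * (real J)\<^sup>2 \<le> p * real I" using JR pm by (intro mult_left_mono) auto
  then show "real (count_012 (pattern p m) I) \<le> p * real I + 3 * sqrt (real I)"
    using s(2) count_square(2)[of J] count_012_add(2)[of "pattern p m" "J\<^sup>2" k] J(3) k by simp
qed

lemma sum_stage:
  "(\<Sum>j<fact (Suc r). density p m j * real (2 * j + 1)) =
     (\<Sum>j<fact r. density p m j * real (2 * j + 1)) +
     (if even (Suc r) then p else m) * ((fact (Suc r))\<^sup>2 - (fact r)\<^sup>2)"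
proof -
  let ?h = "\<lambda>j. density p m j * real (2 * j + 1)" and ?c = "if even (Suc r) then p else m"
  have le: "fact r \<le> (fact (Suc r) :: nat)" by (rule fact_mono_nat) simp
  have un: "{..<fact (Suc r)} = {..<fact r} \<union> {fact r..<fact (Suc r) :: nat}" using le by auto
  have split: "(\<Sum>j<fact (Suc r). h j) = (\<Sum>j<fact r. h j) + (\<Sum>j\<in>{fact r..<fact (Suc r)}. h j)" for h :: "nat \<Rightarrow> real"
    unfolding un by (rule sum.union_disjoint) auto
  have "(\<Sum>j\<in>{fact r..<fact (Suc r)}. ?h j) = (\<Sum>j\<in>{fact r..<fact (Suc r)}. ?c * real (2 * j + 1))"
    by (rule sum.cong[OF refl]) (simp add: density_stage[of r] del: fact_Suc)
  also have "\<dots> = ?c * (\<Sum>j\<in>{fact r..<fact (Suc r)}. real (2 * j + 1))" by (rule sum_distrib_left[symmetric])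
  also have "(\<Sum>j\<in>{fact r..<fact (Suc r)}. real (2 * j + 1)) = (fact (Suc r))\<^sup>2 - (fact r)\<^sup>2"
    using split[of "\<lambda>j. real (2 * j + 1)"] unfolding sum_odd_real of_nat_fact by simp
  finally show ?thesis using split[of ?h] by simp
qed

lemma count_frequent_high:
  assumes "\<epsilon> > 0" shows "\<exists>I\<ge>N. (p - \<epsilon>) * real I \<le> real (count_012 (pattern p m) I)"
proof -
  have "eventually (\<lambda>n. 1 / (real n)\<^sup>2 \<le> \<epsilon> \<and> n \<ge> N \<and> n \<ge> 1) sequentially"
  proof (intro eventually_conj eventually_ge_at_top)
    have "(\<lambda>n. 1 / (real n)\<^sup>2) \<longlonglongrightarrow> 0" by real_asymp
    from order_tendstoD(2)[OF this assms] show "eventually (\<lambda>n. 1 / (real n)\<^sup>2 \<le> \<epsilon>) sequentially"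
      by (rule eventually_mono) simp
  qed
  then obtain n0 where n0: "\<And>n. n \<ge> n0 \<Longrightarrow> 1 / (real n)\<^sup>2 \<le> \<epsilon> \<and> n \<ge> N \<and> n \<ge> 1"
    by (auto simp: eventually_sequentially)
  \<comment> \<open>An odd \<open>r\<close>, so that the stage ending at \<open>fact (r + 1)\<close> has density \<open>p\<close>.\<close>
  define r where "r = Suc (2 * n0)"
  define J where "J = (fact (Suc r) :: nat)"
  have R: "1 / (real (Suc r))\<^sup>2 \<le> \<epsilon>" "N \<le> Suc r" using n0[of "Suc r"] by (auto simp: r_def)
  have JR: "real J = real (Suc r) * fact r" by (simp add: J_def algebra_simps)
  have "(fact r :: real)\<^sup>2 = (real J)\<^sup>2 * (1 / (real (Suc r))\<^sup>2)"
    unfolding JR by (simp add: power_mult_distrib del: of_nat_Suc)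
  also have "\<dots> \<le> (real J)\<^sup>2 * \<epsilon>" using R(1) by (intro mult_left_mono) auto
  finally have f: "(fact r :: real)\<^sup>2 \<le> \<epsilon> * (real J)\<^sup>2" by (simp add: mult.commute)
  have "0 \<le> (\<Sum>j<fact r. density p m j * real (2 * j + 1))"
    using density_bounds(1) pm by (intro sum_nonneg mult_nonneg_nonneg) (auto intro: order_trans)
  then have "p * ((real J)\<^sup>2 - (fact r)\<^sup>2) \<le> real (count_012 (pattern p m) (J\<^sup>2))"
    using count_square(1)[of J] sum_stage[of r] by (simp add: J_def r_def del: fact_Suc)
  moreover have "p * (fact r)\<^sup>2 \<le> 1 * (\<epsilon> * (real J)\<^sup>2)" using f pm by (intro mult_mono) auto
  ultimately have "(p - \<epsilon>) * real (J\<^sup>2) \<le> real (count_012 (pattern p m) (J\<^sup>2))"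
    by (simp add: algebra_simps)
  moreover have "N \<le> J\<^sup>2"
  proof -
    have "Suc r \<le> J" unfolding J_def by (rule fact_ge_self)
    then show ?thesis using R(2) power2_nat_le_imp_le[of J "J\<^sup>2"]
      by (metis le_trans power2_eq_square le_square)
  qed
  ultimately show ?thesis by blast
qed

lemma count_frequent_low:
  assumes "\<epsilon> > 0" shows "\<exists>I\<ge>N. real (count_012 (pattern p m) I) \<le> (m + \<epsilon>) * real I"
proof -
  have "eventually (\<lambda>n. 1 / (real n)\<^sup>2 + 1 / real n \<le> \<epsilon> \<and> n \<ge> N \<and> n \<ge> 1) sequentially"
  proof (intro eventually_conj eventually_ge_at_top)
    have "(\<lambda>n. 1 / (real n)\<^sup>2 + 1 / real n) \<longlonglongrightarrow> 0" by real_asymp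
    from order_tendstoD(2)[OF this assms] show "eventually (\<lambda>n. 1 / (real n)\<^sup>2 + 1 / real n \<le> \<epsilon>) sequentially"
      by (rule eventually_mono) simp
  qed
  then obtain n0 where n0: "\<And>n. n \<ge> n0 \<Longrightarrow> 1 / (real n)\<^sup>2 + 1 / real n \<le> \<epsilon> \<and> n \<ge> N \<and> n \<ge> 1"
    by (auto simp: eventually_sequentially)
  \<comment> \<open>An even \<open>r\<close>, so that the stage ending at \<open>fact (r + 1)\<close> has density \<open>m\<close>.\<close>
  define r where "r = 2 * n0"
  define J where "J = (fact (Suc r) :: nat)"
  have R: "1 / (real (Suc r))\<^sup>2 + 1 / real (Suc r) \<le> \<epsilon>" "N \<le> Suc r" using n0[of "Suc r"] by (auto simp: r_def)
  have JR: "real J = real (Suc r) * fact r" by (simp add: J_def algebra_simps)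
  have J: "Suc r \<le> J" unfolding J_def by (rule fact_ge_self)
  have "(fact r :: real)\<^sup>2 + real J \<le> (real J)\<^sup>2 * (1 / (real (Suc r))\<^sup>2 + 1 / real (Suc r))"
  proof -
    have "(fact r :: real)\<^sup>2 = (real J)\<^sup>2 * (1 / (real (Suc r))\<^sup>2)"
      unfolding JR by (simp add: power_mult_distrib del: of_nat_Suc)
    moreover have "real J * real (Suc r) \<le> real J * real J"
      using J by (intro mult_left_mono of_nat_mono) auto
    then have "real J \<le> (real J)\<^sup>2 * (1 / real (Suc r))"
      by (simp add: power2_eq_square pos_le_divide_eq del: of_nat_Suc)
    ultimately show ?thesis by (simp add: distrib_left)
  qed
  also have "\<dots> \<le> (real J)\<^sup>2 * \<epsilon>" using R(1) by (intro mult_left_mono) auto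
  finally have f: "(fact r :: real)\<^sup>2 + real J \<le> \<epsilon> * (real J)\<^sup>2" by (simp add: mult.commute)
  have "(\<Sum>j<fact r. density p m j * real (2 * j + 1)) \<le> (\<Sum>j<fact r. 1 * real (2 * j + 1))"
    using density_bounds(2) pm by (intro sum_mono mult_right_mono) (auto intro: order_trans)
  also have "\<dots> = (fact r)\<^sup>2" using sum_odd_real[of "fact r"] by simp
  finally have "real (count_012 (pattern p m) (J\<^sup>2)) \<le> (fact r)\<^sup>2 + m * ((real J)\<^sup>2 - (fact r)\<^sup>2) + real J"
    using count_square(2)[of J] sum_stage[of r] by (simp add: J_def r_def del: fact_Suc)
  moreover have "0 \<le> m * (fact r)\<^sup>2" using pm by simp
  ultimately have "real (count_012 (pattern p m) (J\<^sup>2)) \<le> (m + \<epsilon>) * real (J\<^sup>2)"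
    using f by (simp add: algebra_simps)
  moreover have "N \<le> J\<^sup>2" using R(2) J by (metis le_trans power2_eq_square le_square)
  ultimately show ?thesis by blast
qed

lemma pattern_infinite: "\<exists>q\<ge>N. pattern p m q"
proof (intro exI conjI)
  show "N \<le> N\<^sup>2" by (simp add: power2_eq_square)
  show "pattern p m (N\<^sup>2)" using pattern_block[of 0 N] density_bounds(1)[of N] pm by simp
qed

end

section \<open>From growth to liminf_limsup_pattern\<close>

text \<open>
  The bound \<open>v I\<close> for \<open>ln n \<le> T I\<close> is applied to the first \<open>I\<close> with \<open>ln n \<le> T I\<close>, so that
  \<open>ln n\<close> exceeds \<open>T (I - 1)\<close>. The lower bound is treated in the mirror image way; for the bounds that
  hold infinitely often, \<open>n\<close> is taken next to \<open>exp (T I)\<close>.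
\<close>
lemma eventually_ratio_le:
  fixes T v L :: "nat \<Rightarrow> real"
  assumes T: "filterlim T at_top sequentially"
    and H: "eventually (\<lambda>I. \<forall>n\<ge>1. ln (real n) \<le> T I \<longrightarrow> L n \<le> v I) sequentially"
    and v: "eventually (\<lambda>I. v (Suc I) \<le> B * T I) sequentially" and B: "B \<ge> 0"
  shows "eventually (\<lambda>n. L n / ln (real n) \<le> B) sequentially"
proof -
  obtain I0 where I0: "\<And>I. I \<ge> I0 \<Longrightarrow> (\<forall>n\<ge>1. ln (real n) \<le> T I \<longrightarrow> L n \<le> v I) \<and> v (Suc I) \<le> B * T I"
    using eventually_conj[OF H v] by (auto simp: eventually_sequentially)
  have "filterlim (\<lambda>n. ln (real n)) at_top sequentially" by real_asymp
  then have "eventually (\<lambda>n. ln (real n) > T I) sequentially" for I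
    by (simp add: filterlim_at_top_dense)
  then have "eventually (\<lambda>n. \<forall>I\<in>{..I0}. ln (real n) > T I) sequentially"
    by (intro eventually_ball_finite) auto
  moreover have "eventually (\<lambda>n::nat. n \<ge> 2) sequentially" by (rule eventually_ge_at_top)
  ultimately show ?thesis
  proof eventually_elim
    case (elim n)
    have ex: "\<exists>J. ln (real n) \<le> T J" using T by (metis eventually_sequentially filterlim_at_top order_refl)
    define J where "J = (LEAST J. ln (real n) \<le> T J)"
    have J: "ln (real n) \<le> T J" "I < J \<Longrightarrow> T I < ln (real n)" for I
      using LeastI_ex[OF ex] not_less_Least[of I "\<lambda>J. ln (real n) \<le> T J"] by (auto simp: J_def not_le)
    have "J > I0" using J(1) elim(1) by (meson atMost_iff leD not_le)
    then obtain I where I: "J = Suc I" "I \<ge> I0" by (cases J) auto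
    have "L n \<le> v J" using I0[of J] J(1) elim(2) I by auto
    also have "\<dots> \<le> B * T I" using I0[of I] I by auto
    also have "\<dots> \<le> B * ln (real n)" using J(2)[of I] I B by (intro mult_left_mono) auto
    finally show ?case using elim(2) by (simp add: divide_le_eq)
  qed
qed

lemma eventually_ratio_ge:
  fixes Y w L :: "nat \<Rightarrow> real"
  assumes Y: "filterlim Y at_top sequentially"
    and H: "eventually (\<lambda>I. \<forall>n\<ge>1. Y I \<le> ln (real n) \<longrightarrow> w I \<le> L n) sequentially"
    and w: "eventually (\<lambda>I. B * Y (Suc I) \<le> w I) sequentially" and B: "B \<ge> 0"
  shows "eventually (\<lambda>n. B \<le> L n / ln (real n)) sequentially"
proof -
  obtain I0 where I0: "\<And>I. I \<ge> I0 \<Longrightarrow> (\<forall>n\<ge>1. Y I \<le> ln (real n) \<longrightarrow> w I \<le> L n) \<and> B * Y (Suc I) \<le> w I"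
    using eventually_conj[OF H w] by (auto simp: eventually_sequentially)
  have "filterlim (\<lambda>n. ln (real n)) at_top sequentially" by real_asymp
  then have "eventually (\<lambda>n. ln (real n) > Y I) sequentially" for I
    by (simp add: filterlim_at_top_dense)
  then have "eventually (\<lambda>n. \<forall>I\<in>{..I0}. ln (real n) > Y I) sequentially"
    by (intro eventually_ball_finite) auto
  moreover have "eventually (\<lambda>n::nat. n \<ge> 2) sequentially" by (rule eventually_ge_at_top)
  ultimately show ?thesis
  proof eventually_elim
    case (elim n)
    have ex: "\<exists>J. ln (real n) \<le> Y J" using Y by (metis eventually_sequentially filterlim_at_top order_refl)
    define J where "J = (LEAST J. ln (real n) \<le> Y J)"
    have J: "ln (real n) \<le> Y J" "I < J \<Longrightarrow> Y I < ln (real n)" for I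
      using LeastI_ex[OF ex] not_less_Least[of I "\<lambda>J. ln (real n) \<le> Y J"] by (auto simp: J_def not_le)
    have "J > I0" using J(1) elim(1) by (meson atMost_iff leD not_le)
    then obtain I where I: "J = Suc I" "I \<ge> I0" by (cases J) auto
    have "B * ln (real n) \<le> B * Y J" using J(1) B by (rule mult_left_mono)
    also have "\<dots> \<le> w I" using I0[of I] I by auto
    also have "\<dots> \<le> L n" using I0[of I] J(2)[of I] elim(2) I by auto
    finally show ?case using elim(2) by (simp add: le_divide_eq)
  qed
qed

lemma frequent_ratio_le:
  fixes T v L :: "nat \<Rightarrow> real"
  assumes T: "filterlim T at_top sequentially"
    and H: "eventually (\<lambda>I. \<forall>n\<ge>1. ln (real n) \<le> T I \<longrightarrow> L n \<le> v I) sequentially"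
    and v: "\<And>N. \<exists>I\<ge>N. v I \<le> B * (T I - 1)" and B: "B \<ge> 0"
  shows "\<exists>n\<ge>N. L n / ln (real n) \<le> B"
proof -
  have "eventually (\<lambda>I. ln (real N + 1) + 2 \<le> T I) sequentially"
    using T by (simp add: filterlim_at_top)
  from eventually_conj[OF H this] obtain I0 where
    I0: "\<And>I. I \<ge> I0 \<Longrightarrow> (\<forall>n\<ge>1. ln (real n) \<le> T I \<longrightarrow> L n \<le> v I) \<and> ln (real N + 1) + 2 \<le> T I"
    by (auto simp: eventually_sequentially)
  obtain I where I: "I \<ge> I0" "v I \<le> B * (T I - 1)" using v by blast
  define n where "n = nat \<lfloor>exp (T I)\<rfloor>"
  have T2: "ln (real N + 1) + 2 \<le> T I" using I0 I by blast
  have "exp (T I - 1) * 2 \<le> exp (T I - 1) * exp 1"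
    using exp_ge_add_one_self[of "1::real"] by (intro mult_left_mono) auto
  also have "\<dots> = exp (T I)" by (simp add: exp_add[symmetric])
  finally have e: "exp (T I - 1) * 2 \<le> exp (T I)" .
  have "real N + 1 = exp (ln (real N + 1))" by simp
  also have "\<dots> \<le> exp (T I - 1)" using T2 by (subst exp_le_cancel_iff) simp
  finally have N: "real N + 1 \<le> exp (T I - 1)" .
  have n: "exp (T I) - 1 \<le> real n" "real n \<le> exp (T I)" 
    using of_nat_floor[of "exp (T I)"] by (simp_all add: n_def)
  have n1: "exp (T I - 1) \<le> real n" using n e N by linarith
  then have nN: "real N + 1 \<le> real n" using N by linarith
  then have n2: "n \<ge> N" "n \<ge> 1" by auto
  have "ln (real n) \<le> ln (exp (T I))" using n n2 by (subst ln_le_cancel_iff) auto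
  then have "L n \<le> v I" using I0[OF I(1)] n2 by simp
  also have "\<dots> \<le> B * (T I - 1)" by fact
  also have "\<dots> \<le> B * ln (real n)"
  proof (rule mult_left_mono[OF _ B])
    have "ln (exp (T I - 1)) \<le> ln (real n)" using n1 n2 by (subst ln_le_cancel_iff) auto
    then show "T I - 1 \<le> ln (real n)" by simp
  qed
  finally have le: "L n \<le> B * ln (real n)" .
  have "T I - 1 \<le> ln (real n)"
    using n1 n2 ln_le_cancel_iff[of "exp (T I - 1)" "real n"] by simp
  moreover have "0 \<le> ln (real N + 1)" by simp
  ultimately have "0 < ln (real n)" using T2 by linarith
  with le have "L n / ln (real n) \<le> B" by (simp add: divide_le_eq)
  then show ?thesis using n2 by blast
qed

lemma frequent_ratio_ge:
  fixes Y w L :: "nat \<Rightarrow> real"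
  assumes Y: "filterlim Y at_top sequentially"
    and H: "eventually (\<lambda>I. \<forall>n\<ge>1. Y I \<le> ln (real n) \<longrightarrow> w I \<le> L n) sequentially"
    and w: "\<And>N. \<exists>I\<ge>N. B * (Y I + 1) \<le> w I" and B: "B \<ge> 0"
  shows "\<exists>n\<ge>N. B \<le> L n / ln (real n)"
proof -
  have "eventually (\<lambda>I. ln (real N + 1) + 1 \<le> Y I) sequentially"
    using Y by (simp add: filterlim_at_top)
  from eventually_conj[OF H this] obtain I0 where
    I0: "\<And>I. I \<ge> I0 \<Longrightarrow> (\<forall>n\<ge>1. Y I \<le> ln (real n) \<longrightarrow> w I \<le> L n) \<and> ln (real N + 1) + 1 \<le> Y I"
    by (auto simp: eventually_sequentially)
  obtain I where I: "I \<ge> I0" "B * (Y I + 1) \<le> w I" using w by blast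
  define n where "n = nat \<lceil>exp (Y I)\<rceil>"
  have Y1: "ln (real N + 1) + 1 \<le> Y I" using I0 I by blast
  have "real N + 1 = exp (ln (real N + 1))" by simp
  also have "\<dots> \<le> exp (Y I)" using Y1 by (subst exp_le_cancel_iff) simp
  finally have N: "real N + 1 \<le> exp (Y I)" .
  have n: "exp (Y I) \<le> real n" "real n \<le> exp (Y I) + 1"
  proof -
    have "real n = real_of_int \<lceil>exp (Y I)\<rceil>" by (simp add: n_def order_less_imp_le)
    then show "exp (Y I) \<le> real n" "real n \<le> exp (Y I) + 1"
      using of_int_ceiling_le_add_one[of "exp (Y I)"] by simp_all
  qed
  then have "real N + 1 \<le> real n" using N by linarith
  then have n2: "n \<ge> N" "n \<ge> 1" by auto
  have Yn: "Y I \<le> ln (real n)" using n(1) n2 ln_le_cancel_iff[of "exp (Y I)" "real n"] by simp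
  have "real n \<le> exp (Y I) * 2" using n N by linarith
  also have "\<dots> \<le> exp (Y I) * exp 1"
    using exp_ge_add_one_self[of "1::real"] by (intro mult_left_mono) auto
  also have "\<dots> = exp (Y I + 1)" by (simp add: exp_add)
  finally have "ln (real n) \<le> Y I + 1" using n2 ln_le_cancel_iff[of "real n" "exp (Y I + 1)"] by simp
  then have "B * ln (real n) \<le> B * (Y I + 1)" using B by (rule mult_left_mono)
  also have "\<dots> \<le> w I" by fact
  also have "\<dots> \<le> L n" using I0[OF I(1)] n2 Yn by blast
  finally have le: "B * ln (real n) \<le> L n" .
  have "0 \<le> ln (real N + 1)" by simp
  then have "0 < ln (real n)" using Yn Y1 by linarith
  with le have "B \<le> L n / ln (real n)" by (simp add: le_divide_eq)
  then show ?thesis using n2 by blast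
qed

lemma liminf_limsup_eqI:
  fixes h :: "nat \<Rightarrow> real"
  assumes "\<And>\<epsilon>. \<epsilon> > 0 \<Longrightarrow> eventually (\<lambda>n. \<alpha> - \<epsilon> \<le> h n) sequentially"
    and "\<And>\<epsilon> N. \<epsilon> > 0 \<Longrightarrow> \<exists>n\<ge>N. h n \<le> \<alpha> + \<epsilon>"
    and "\<And>\<epsilon>. \<epsilon> > 0 \<Longrightarrow> eventually (\<lambda>n. h n \<le> \<beta> + \<epsilon>) sequentially"
    and "\<And>\<epsilon> N. \<epsilon> > 0 \<Longrightarrow> \<exists>n\<ge>N. \<beta> - \<epsilon> \<le> h n"
  shows "liminf (\<lambda>n. ereal (h n)) = ereal \<alpha> \<and> limsup (\<lambda>n. ereal (h n)) = ereal \<beta>"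
proof (intro conjI antisym)
  show "ereal \<alpha> \<le> liminf (\<lambda>n. ereal (h n))"
    unfolding le_Liminf_iff
  proof (intro allI impI)
    fix y assume "y < ereal \<alpha>"
    then obtain x where x: "y < ereal x" "x < \<alpha>" by (metis ereal_dense2 less_ereal.simps(1))
    from assms(1)[of "\<alpha> - x"] x(2) have "eventually (\<lambda>n. x \<le> h n) sequentially" by simp
    then show "eventually (\<lambda>n. y < ereal (h n)) sequentially"
      by (rule eventually_mono) (use x(1) in \<open>auto intro: less_le_trans\<close>)
  qed
  show "liminf (\<lambda>n. ereal (h n)) \<le> ereal \<alpha>"
  proof (rule ccontr)
    assume "\<not> ?thesis"
    then have "ereal \<alpha> < liminf (\<lambda>n. ereal (h n))" by simp
    then obtain y where y: "\<alpha> < y" "ereal y < liminf (\<lambda>n. ereal (h n))"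
      by (metis ereal_dense2 less_ereal.simps(1))
    then have "eventually (\<lambda>n. ereal y < ereal (h n)) sequentially"
      using le_Liminf_iff[of "liminf (\<lambda>n. ereal (h n))" sequentially "\<lambda>n. ereal (h n)"] by blast
    then obtain N where "\<And>n. n \<ge> N \<Longrightarrow> y < h n" by (auto simp: eventually_sequentially)
    moreover obtain n where "n \<ge> N" "h n \<le> \<alpha> + (y - \<alpha>)" using assms(2)[of "y - \<alpha>" N] y by auto
    ultimately show False by force
  qed
  show "limsup (\<lambda>n. ereal (h n)) \<le> ereal \<beta>"
    unfolding Limsup_le_iff
  proof (intro allI impI)
    fix y assume "ereal \<beta> < y"
    then obtain x where x: "ereal x < y" "\<beta> < x" by (metis ereal_dense2 less_ereal.simps(1))
    from assms(3)[of "x - \<beta>"] x(2) have "eventually (\<lambda>n. h n \<le> x) sequentially" by simp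
    then show "eventually (\<lambda>n. ereal (h n) < y) sequentially"
      by (rule eventually_mono) (metis x(1) ereal_less_eq(3) le_less_trans)
  qed
  show "ereal \<beta> \<le> limsup (\<lambda>n. ereal (h n))"
  proof (rule ccontr)
    assume "\<not> ?thesis"
    then have "limsup (\<lambda>n. ereal (h n)) < ereal \<beta>" by simp
    then obtain y where y: "y < \<beta>" "limsup (\<lambda>n. ereal (h n)) < ereal y"
      by (metis ereal_dense2 less_ereal.simps(1))
    then have "eventually (\<lambda>n. ereal (h n) < ereal y) sequentially"
      using Limsup_le_iff[of sequentially "\<lambda>n. ereal (h n)" "limsup (\<lambda>n. ereal (h n))"] by blast
    then obtain N where "\<And>n. n \<ge> N \<Longrightarrow> h n < y" by (auto simp: eventually_sequentially)
    moreover obtain n where "n \<ge> N" "\<beta> - (\<beta> - y) \<le> h n" using assms(4)[of "\<beta> - y" N] y by auto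
    ultimately show False by force
  qed
qed

text \<open>
  The quantity \<open>T(I)\<close> of the introduction; \<open>length_excess\<close> bounds the logarithm of what the lower bound
  loses in length.
\<close>
definition log_size :: "(nat \<Rightarrow> bool) \<Rightarrow> nat \<Rightarrow> real" where
  "log_size \<tau> I = real I * ln 8 + real (count_012 \<tau> I) * ln xi"

definition upper_exponent :: "nat \<Rightarrow> real" where
  "upper_exponent I = real I * ln 8 + (ln 5 + ln (real I + 1) + (2 * sqrt (real I) + 3) * ln 6)"

definition lower_exponent :: "nat \<Rightarrow> real" where
  "lower_exponent I = real I * ln 8 - ln 8"

definition length_excess :: "nat \<Rightarrow> real" where
  "length_excess I = (2 * sqrt (real I + 2 * sqrt (real I)) + 2) * ln 4 + sqrt (real I) * ln 256
     + ln (1 + 432 * sqrt (real I) + 27 * real I)"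

lemma growth_pos: "1 \<le> growth (grig \<omega>) (grig_gens \<omega>) n"
proof -
  have "[] \<in> {ws :: klein option list. length ws \<le> n}" by simp
  then have "ev \<omega> ` {ws. length ws \<le> n} \<noteq> {}" by blast
  then have "0 < card (ev \<omega> ` {ws. length ws \<le> n})"
    unfolding card_gt_0_iff using finite_words by blast
  then show ?thesis by (simp add: growth_eq)
qed

lemma lnln_growth_upper:
  assumes sw: "real (switches \<tau> I) \<le> 2 * sqrt (real I) + 2"
    and n: "1 \<le> n" "ln (real n) \<le> log_size \<tau> I"
  shows "ln (ln (real (growth (grig (omega \<tau>)) (grig_gens (omega \<tau>)) n))) \<le> upper_exponent I"
proof -
  let ?g = "ln (real (growth (grig (omega \<tau>)) (grig_gens (omega \<tau>)) n))"
  let ?V = "5 * (real I + 1) * 6 ^ Suc (switches \<tau> I) * 8 ^ I"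
  have "ln (8 ^ I * xi ^ count_012 \<tau> I) = log_size \<tau> I"
    using xi_bounds by (simp add: log_size_def ln_mult ln_realpow)
  then have "ln (real n) \<le> ln (8 ^ I * xi ^ count_012 \<tau> I)" using n(2) by simp
  then have "real n \<le> 8 ^ I * xi ^ count_012 \<tau> I"
    using n(1) xi_bounds by (subst (asm) ln_le_cancel_iff) auto
  then have g: "?g \<le> ?V" using growth_upper[of n I \<tau>] by (simp add: xi_def)
  have lnV: "ln ?V = real I * ln 8 + (ln 5 + ln (real I + 1) + real (Suc (switches \<tau> I)) * ln 6)"
  proof -
    have "ln (5 * x * 6 ^ a * 8 ^ b) = real b * ln 8 + (ln 5 + ln x + real a * ln 6)" if "0 < x" for x :: real and a b
      using that by (simp add: ln_mult ln_realpow)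
    then show ?thesis by this simp
  qed
  have "ln ?V \<le> upper_exponent I"
    unfolding lnV upper_exponent_def using sw by (intro add_left_mono mult_right_mono) auto
  moreover have "ln ?g \<le> ln ?V"
  proof (cases "?g > 0")
    case True then show ?thesis using g by simp
  next
    case False
    then have "?g = 0" using growth_pos[of "omega \<tau>" n] by (simp add: not_less antisym)
    moreover have "1 \<le> ?V"
    proof -
      have "1 * 1 * 1 * 1 \<le> ?V" by (intro mult_mono one_le_power) auto
      then show ?thesis by simp
    qed
    then have "0 \<le> ln ?V" by simp
    ultimately show ?thesis by simp
  qed
  ultimately show ?thesis by linarith
qed

lemma lnln_growth_lower:
  assumes sw: "\<And>I. real (switches \<tau> I) \<le> 2 * sqrt (real I) + 2"
    and inf: "\<And>N. \<exists>q\<ge>N. \<tau> q"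
    and I: "88 * (real I)\<^sup>2 \<le> 16 ^ floor_sqrt I"
    and n: "1 \<le> n" "log_size \<tau> I + length_excess I \<le> ln (real n)"
  shows "lower_exponent I \<le> ln (ln (real (growth (grig (omega \<tau>)) (grig_gens (omega \<tau>)) n)))"
proof -
  let ?s = "floor_sqrt I"
  let ?E = "4 ^ switches \<tau> (2 * ?s + I) * 256 ^ ?s * (1 + 432 * real ?s + 27 * real I)"
  have s: "real ?s \<le> sqrt (real I)" by (rule real_floor_sqrt)
  have lnE: "ln ?E = real (switches \<tau> (2 * ?s + I)) * ln 4 + real ?s * ln 256 + ln (1 + 432 * real ?s + 27 * real I)"
    by (simp add: ln_mult ln_realpow add_pos_nonneg)
  have "ln ?E \<le> length_excess I"
    unfolding lnE length_excess_def
  proof (intro add_mono mult_right_mono)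
    have "sqrt (real (2 * ?s + I)) \<le> sqrt (real I + 2 * sqrt (real I))" using s by simp
    then show "real (switches \<tau> (2 * ?s + I)) \<le> 2 * sqrt (real I + 2 * sqrt (real I)) + 2"
      using sw[of "2 * ?s + I"] by linarith
    show "ln (1 + 432 * real ?s + 27 * real I) \<le> ln (1 + 432 * sqrt (real I) + 27 * real I)"
      using s by (subst ln_le_cancel_iff) (auto intro: add_pos_nonneg)
  qed (use s in auto)
  moreover have "ln (8 ^ I * xi ^ count_012 \<tau> I * ?E) = log_size \<tau> I + ln ?E"
    using xi_bounds by (simp add: log_size_def ln_mult ln_realpow add_pos_nonneg)
  ultimately have "ln (8 ^ I * xi ^ count_012 \<tau> I * ?E) \<le> ln (real n)" using n(2) by linarith
  moreover have "0 < 8 ^ I * xi ^ count_012 \<tau> I * ?E"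
    using xi_bounds by (intro mult_pos_pos zero_less_power add_pos_nonneg) auto
  ultimately have "8 ^ I * xi ^ count_012 \<tau> I * ?E \<le> real n"
    using n(1) by (subst (asm) ln_le_cancel_iff) auto
  from growth_lower[OF inf I this]
  have g: "exp (8 ^ I / 8) \<le> real (growth (grig (omega \<tau>)) (grig_gens (omega \<tau>)) n)" .
  then have "ln (exp (8 ^ I / 8)) \<le> ln (real (growth (grig (omega \<tau>)) (grig_gens (omega \<tau>)) n))"
    using growth_pos[of "omega \<tau>" n] by (subst ln_le_cancel_iff) auto
  then have "8 ^ I / 8 \<le> ln (real (growth (grig (omega \<tau>)) (grig_gens (omega \<tau>)) n))" by simp
  moreover have "(0::real) < 8 ^ I / 8" by simp
  ultimately have "ln (8 ^ I / 8) \<le> ln (ln (real (growth (grig (omega \<tau>)) (grig_gens (omega \<tau>)) n)))"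
    by (meson less_le_trans ln_le_cancel_iff)
  then show ?thesis by (simp add: lower_exponent_def ln_div ln_realpow)
qed

lemma eventually_floor_sqrt: "eventually (\<lambda>I. 88 * (real I)\<^sup>2 \<le> 16 ^ floor_sqrt I) sequentially"
proof -
  have "eventually (\<lambda>J. 88 * (real J + 1) ^ 4 \<le> 16 ^ J) sequentially" by real_asymp
  then obtain J0 where J0: "\<And>J. J \<ge> J0 \<Longrightarrow> 88 * (real J + 1) ^ 4 \<le> 16 ^ J"
    by (auto simp: eventually_sequentially)
  have "88 * (real I)\<^sup>2 \<le> 16 ^ floor_sqrt I" if "I \<ge> J0\<^sup>2" for I
  proof -
    have "real I \<le> real ((Suc (floor_sqrt I))\<^sup>2)" using Suc_floor_sqrt_power2_gt[of I] by linarith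
    then have "real I \<le> (real (floor_sqrt I) + 1)\<^sup>2" by (simp add: add.commute)
    then have "(real I)\<^sup>2 \<le> ((real (floor_sqrt I) + 1)\<^sup>2)\<^sup>2" by (rule power_mono) simp
    also have "\<dots> = (real (floor_sqrt I) + 1) ^ 4" by (simp flip: power_mult)
    finally show ?thesis using J0[of "floor_sqrt I"] that by (simp add: le_floor_sqrt_iff)
  qed
  then show ?thesis by (auto simp: eventually_sequentially)
qed

text \<open>
  By the choice of \<open>\<alpha>\<close> and \<open>\<beta>\<close>, the ratio \<open>I ln 8 / T(I)\<close> is \<open>\<alpha>\<close> where the density of triples \<open>012\<close>
  is \<open>p\<close>, its largest value, and \<open>\<beta>\<close> where it is \<open>m\<close>.
\<close>
theorem liminf_limsup_pattern:
  fixes m p \<alpha> \<beta> :: real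
  assumes pm: "0 \<le> m" "m \<le> p" "p \<le> 1"
    and \<alpha>: "\<alpha> * (ln 8 + p * ln xi) = ln 8" and \<beta>: "\<beta> * (ln 8 + m * ln xi) = ln 8"
  defines "\<tau> \<equiv> pattern p m"
  defines "h \<equiv> \<lambda>n. ln (ln (real (growth (grig (omega \<tau>)) (grig_gens (omega \<tau>)) n))) / ln (real n)"
  shows "liminf (\<lambda>n. ereal (h n)) = ereal \<alpha> \<and> limsup (\<lambda>n. ereal (h n)) = ereal \<beta>"
proof -
  let ?L = "\<lambda>n. ln (ln (real (growth (grig (omega \<tau>)) (grig_gens (omega \<tau>)) n)))"
  define z c where "z = ln (8::real)" and "c = ln xi"
  define T Y where "T = log_size \<tau>" and "Y I = log_size \<tau> I + length_excess I" for I
  have z: "0 < z" and c: "0 < c" using xi_bounds by (simp_all add: z_def c_def)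
  have zp: "0 < z + p * c" "0 < z + m * c" using z c pm by (auto intro!: add_pos_nonneg)
  have \<alpha>': "\<alpha> * (z + p * c) = z" and \<beta>': "\<beta> * (z + m * c) = z" using \<alpha> \<beta> by (simp_all add: z_def c_def)
  have pos: "0 < \<alpha>" "0 < \<beta>" using \<alpha>' \<beta>' z zp by (metis zero_less_mult_pos2)+
  have sw: "real (switches \<tau> I) \<le> 2 * sqrt (real I) + 2" for I
    unfolding \<tau>_def by (rule switches_bound[OF pm])
  have inf: "\<exists>q\<ge>N. \<tau> q" for N unfolding \<tau>_def by (rule pattern_infinite[OF pm])
  have Tz: "T I \<ge> real I * z" for I using c by (simp add: T_def log_size_def z_def c_def)
  have "filterlim (\<lambda>I. real I * z) at_top sequentially" using z by real_asymp
  then have Tlim: "filterlim T at_top sequentially"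
    by (rule filterlim_at_top_mono) (use Tz in auto)
  have "length_excess I \<ge> 0" for I unfolding length_excess_def by (intro add_nonneg_nonneg mult_nonneg_nonneg) auto
  then have Ylim: "filterlim Y at_top sequentially"
    by (intro filterlim_at_top_mono[OF Tlim]) (auto simp: Y_def T_def)
  have H1: "eventually (\<lambda>I. \<forall>n\<ge>1. ln (real n) \<le> T I \<longrightarrow> ?L n \<le> upper_exponent I) sequentially"
    using lnln_growth_upper[OF sw] by (auto simp: T_def)
  have H2: "eventually (\<lambda>I. \<forall>n\<ge>1. Y I \<le> ln (real n) \<longrightarrow> lower_exponent I \<le> ?L n) sequentially"
    using eventually_floor_sqrt by eventually_elim (use lnln_growth_lower[OF sw inf] in \<open>auto simp: Y_def\<close>)
  have count: "m * real I - 2 * sqrt (real I) \<le> real (count_012 \<tau> I)"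
     "real (count_012 \<tau> I) \<le> p * real I + 3 * sqrt (real I)" for I
    unfolding \<tau>_def by (rule count_bounds[OF pm])+
  have T_low: "real I * (z + m * c) - 2 * sqrt (real I) * c \<le> T I" for I
    using mult_right_mono[OF count(1)[of I], of c] c by (simp add: T_def log_size_def z_def c_def algebra_simps)
  have T_up: "T I \<le> real I * (z + p * c) + 3 * sqrt (real I) * c" for I
    using mult_right_mono[OF count(2)[of I], of c] c by (simp add: T_def log_size_def z_def c_def algebra_simps)
  show ?thesis
    unfolding h_def
  proof (rule liminf_limsup_eqI)
    fix \<epsilon> :: real assume \<epsilon>: "0 < \<epsilon>"
    show "eventually (\<lambda>n. ?L n / ln (real n) \<le> \<beta> + \<epsilon>) sequentially"
    proof (rule eventually_ratio_le[OF Tlim H1])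
      have "eventually (\<lambda>I. upper_exponent (Suc I) \<le> real I * z + (\<epsilon> * (z + m * c) / 2) * real I) sequentially"
        using \<epsilon> zp(2) unfolding upper_exponent_def z_def c_def by real_asymp
      moreover have "eventually (\<lambda>I. (\<beta> + \<epsilon>) * (2 * sqrt (real I) * c) \<le> (\<epsilon> * (z + m * c) / 2) * real I) sequentially"
        using \<epsilon> zp(2) by real_asymp
      ultimately show "eventually (\<lambda>I. upper_exponent (Suc I) \<le> (\<beta> + \<epsilon>) * T I) sequentially"
      proof eventually_elim
        case (elim I)
        have "(\<beta> + \<epsilon>) * (real I * (z + m * c)) = real I * (\<beta> * (z + m * c)) + \<epsilon> * (z + m * c) * real I"
          by (simp add: algebra_simps)
        moreover have "(\<beta> + \<epsilon>) * (real I * (z + m * c) - 2 * sqrt (real I) * c) \<le> (\<beta> + \<epsilon>) * T I"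
          using T_low pos \<epsilon> by (intro mult_left_mono) auto
        ultimately show ?case unfolding \<beta>' using elim by (simp add: right_diff_distrib)
      qed
    qed (use pos \<epsilon> in auto)
  next
    fix \<epsilon> :: real assume \<epsilon>0: "0 < \<epsilon>"
    \<comment> \<open>Shrinking \<open>\<epsilon>\<close> keeps the coefficient \<open>\<alpha> - \<delta>\<close> non-negative.\<close>
    define \<delta> where "\<delta> = min \<epsilon> \<alpha>"
    have \<epsilon>: "0 < \<delta>" "\<delta> \<le> \<alpha>" "\<delta> \<le> \<epsilon>" using \<epsilon>0 pos by (auto simp: \<delta>_def)
    have "eventually (\<lambda>n. \<alpha> - \<delta> \<le> ?L n / ln (real n)) sequentially"
    proof (rule eventually_ratio_ge[OF Ylim H2])
      have "eventually (\<lambda>I. (\<alpha> - \<delta>) * (z + p * c + 3 * sqrt (real (Suc I)) * c + length_excess (Suc I))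
           + z \<le> (\<delta> * (z + p * c)) * real I) sequentially"
        using \<epsilon> zp(1) unfolding length_excess_def z_def c_def by real_asymp
      then show "eventually (\<lambda>I. (\<alpha> - \<delta>) * Y (Suc I) \<le> lower_exponent I) sequentially"
      proof eventually_elim
        case (elim I)
        have "(\<alpha> - \<delta>) * Y (Suc I) \<le> (\<alpha> - \<delta>) * (real (Suc I) * (z + p * c) + 3 * sqrt (real (Suc I)) * c + length_excess (Suc I))"
          using T_up[of "Suc I"] \<epsilon> by (intro mult_left_mono) (auto simp: Y_def T_def)
        also have "\<dots> = (\<alpha> - \<delta>) * (real I * (z + p * c)) +
            (\<alpha> - \<delta>) * (z + p * c + 3 * sqrt (real (Suc I)) * c + length_excess (Suc I))"
          by (simp add: algebra_simps)
        also have "(\<alpha> - \<delta>) * (real I * (z + p * c)) 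
            = real I * (\<alpha> * (z + p * c)) - (\<delta> * (z + p * c)) * real I"
          by (simp add: algebra_simps)
        finally show ?case unfolding \<alpha>' using elim by (simp add: lower_exponent_def z_def)
      qed
    qed (use \<epsilon> in auto)
    then show "eventually (\<lambda>n. \<alpha> - \<epsilon> \<le> ?L n / ln (real n)) sequentially"
      by (rule eventually_mono) (use \<epsilon> in linarith)
  next
    fix \<epsilon> :: real and N :: nat assume \<epsilon>: "0 < \<epsilon>"
    show "\<exists>n\<ge>N. ?L n / ln (real n) \<le> \<alpha> + \<epsilon>"
    proof (rule frequent_ratio_le[OF Tlim H1])
      fix N
      \<comment> \<open>This deviation of the density uses up a quarter of the margin \<open>\<epsilon>\<close>; lower order terms use up half of it.\<close>
      define \<delta> where "\<delta> = \<epsilon> * (z + p * c) / (4 * (\<alpha> + \<epsilon>) * c)"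
      have \<delta>: "0 < \<delta>" "(\<alpha> + \<epsilon>) * (\<delta> * c) = \<epsilon> * (z + p * c) / 4"
      proof -
        have K: "0 < (\<alpha> + \<epsilon>) * c" using \<epsilon> pos c by (intro mult_pos_pos) auto
        show "0 < \<delta>" unfolding \<delta>_def using \<epsilon> zp pos c by (intro divide_pos_pos mult_pos_pos) (auto simp: mult.assoc)
        have "\<delta> = \<epsilon> * (z + p * c) / 4 / ((\<alpha> + \<epsilon>) * c)" by (simp add: \<delta>_def mult.assoc)
        moreover have "(\<alpha> + \<epsilon>) * c \<noteq> 0" using K by (rule less_imp_neq[symmetric])
        ultimately have "\<delta> * ((\<alpha> + \<epsilon>) * c) = \<epsilon> * (z + p * c) / 4" by (metis nonzero_eq_divide_eq)
        then show "(\<alpha> + \<epsilon>) * (\<delta> * c) = \<epsilon> * (z + p * c) / 4" by (simp only: mult_ac)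
      qed
      have "eventually (\<lambda>I. upper_exponent I + (\<alpha> + \<epsilon>) \<le> real I * z + (\<epsilon> * (z + p * c) / 2) * real I) sequentially"
        using \<epsilon> zp(1) unfolding upper_exponent_def z_def c_def by real_asymp
      then obtain N' where N': "\<And>I. I \<ge> N' \<Longrightarrow> upper_exponent I + (\<alpha> + \<epsilon>) \<le> real I * z + (\<epsilon> * (z + p * c) / 2) * real I"
        by (auto simp: eventually_sequentially)
      obtain I where I: "I \<ge> max N N'" "(p - \<delta>) * real I \<le> real (count_012 \<tau> I)"
        using count_frequent_high[OF pm \<delta>(1)] unfolding \<tau>_def by blast
      have "real I * (z + p * c) - \<delta> * c * real I \<le> T I"
        using mult_right_mono[OF I(2), of c] c by (simp add: T_def log_size_def z_def c_def algebra_simps)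
      then have "(\<alpha> + \<epsilon>) * (real I * (z + p * c) - \<delta> * c * real I) \<le> (\<alpha> + \<epsilon>) * T I"
        using pos \<epsilon> by (intro mult_left_mono) auto
      moreover have "(\<alpha> + \<epsilon>) * (real I * (z + p * c) - \<delta> * c * real I)
         = real I * (\<alpha> * (z + p * c)) + (\<epsilon> * (z + p * c)) * real I - ((\<alpha> + \<epsilon>) * (\<delta> * c)) * real I"
        by (simp add: algebra_simps)
      moreover define E where "E = \<epsilon> * (z + p * c) * real I"
      moreover have "0 \<le> E" using \<epsilon> zp by (simp add: E_def)
      moreover have "\<epsilon> * (z + p * c) / 4 * real I = E / 4" "\<epsilon> * (z + p * c) / 2 * real I = E / 2"
        by (simp_all add: E_def)
      moreover have "upper_exponent I + (\<alpha> + \<epsilon>) \<le> real I * z + \<epsilon> * (z + p * c) / 2 * real I"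
        using N'[of I] I(1) by simp
      moreover have "(\<alpha> + \<epsilon>) * (T I - 1) = (\<alpha> + \<epsilon>) * T I - (\<alpha> + \<epsilon>)" by (simp add: right_diff_distrib)
      ultimately have "upper_exponent I \<le> (\<alpha> + \<epsilon>) * (T I - 1)"
        unfolding \<delta>(2) \<alpha>' by linarith
      then show "\<exists>I\<ge>N. upper_exponent I \<le> (\<alpha> + \<epsilon>) * (T I - 1)" using I(1) by (intro exI[of _ I]) auto
    qed (use pos \<epsilon> in auto)
  next
    fix \<epsilon> :: real and N :: nat assume \<epsilon>0: "0 < \<epsilon>"
    \<comment> \<open>Shrinking \<open>\<epsilon>\<close> keeps the coefficient \<open>\<beta> - \<theta>\<close> positive.\<close>
    define \<theta> where "\<theta> = min \<epsilon> (\<beta> / 2)"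
    have \<epsilon>: "0 < \<theta>" "\<theta> < \<beta>" "\<theta> \<le> \<epsilon>" using \<epsilon>0 pos by (auto simp: \<theta>_def)
    have "\<exists>n\<ge>N. \<beta> - \<theta> \<le> ?L n / ln (real n)"
    proof (rule frequent_ratio_ge[OF Ylim H2])
      fix N
      define \<delta> where "\<delta> = \<theta> * (z + m * c) / (4 * (\<beta> - \<theta>) * c)"
      have \<delta>: "0 < \<delta>" "(\<beta> - \<theta>) * (\<delta> * c) = \<theta> * (z + m * c) / 4"
      proof -
        have K: "0 < (\<beta> - \<theta>) * c" using \<epsilon> c by (intro mult_pos_pos) auto
        show "0 < \<delta>" unfolding \<delta>_def using \<epsilon> zp pos c by (intro divide_pos_pos mult_pos_pos) (auto simp: mult.assoc)
        have "\<delta> = \<theta> * (z + m * c) / 4 / ((\<beta> - \<theta>) * c)" by (simp add: \<delta>_def mult.assoc)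
        moreover have "(\<beta> - \<theta>) * c \<noteq> 0" using K by (rule less_imp_neq[symmetric])
        ultimately have "\<delta> * ((\<beta> - \<theta>) * c) = \<theta> * (z + m * c) / 4" by (metis nonzero_eq_divide_eq)
        then show "(\<beta> - \<theta>) * (\<delta> * c) = \<theta> * (z + m * c) / 4" by (simp only: mult_ac)
      qed
      have "eventually (\<lambda>I. (\<beta> - \<theta>) * (length_excess I + 1) + z \<le> (\<theta> * (z + m * c) / 2) * real I) sequentially"
        using \<epsilon> zp(2) unfolding length_excess_def z_def c_def by real_asymp
      then obtain N' where N': "\<And>I. I \<ge> N' \<Longrightarrow> (\<beta> - \<theta>) * (length_excess I + 1) + z \<le> (\<theta> * (z + m * c) / 2) * real I"
        by (auto simp: eventually_sequentially)
      obtain I where I: "I \<ge> max N N'" "real (count_012 \<tau> I) \<le> (m + \<delta>) * real I"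
        using count_frequent_low[OF pm \<delta>(1)] unfolding \<tau>_def by blast
      have "T I \<le> real I * (z + m * c) + \<delta> * c * real I"
        using mult_right_mono[OF I(2), of c] c by (simp add: T_def log_size_def z_def c_def algebra_simps)
      then have 1: "(\<beta> - \<theta>) * T I \<le> (\<beta> - \<theta>) * (real I * (z + m * c) + \<delta> * c * real I)"
        using \<epsilon> by (intro mult_left_mono) auto
      define E where "E = \<theta> * (z + m * c) * real I"
      have E: "0 \<le> E" "\<theta> * (z + m * c) / 4 * real I = E / 4" "\<theta> * (z + m * c) / 2 * real I = E / 2"
        using \<epsilon> zp by (simp_all add: E_def)
      have "(\<beta> - \<theta>) * (real I * (z + m * c) + \<delta> * c * real I)
         = real I * (\<beta> * (z + m * c)) - E + ((\<beta> - \<theta>) * (\<delta> * c)) * real I"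
        by (simp add: E_def algebra_simps)
      then have 2: "(\<beta> - \<theta>) * T I \<le> real I * z - E + E / 4" using 1 unfolding \<delta>(2) \<beta>' E(2) by simp
      have 3: "(\<beta> - \<theta>) * (length_excess I + 1) + z \<le> E / 2" using N'[of I] I(1) unfolding E(3) by simp
      have "(\<beta> - \<theta>) * (Y I + 1) = (\<beta> - \<theta>) * T I + (\<beta> - \<theta>) * (length_excess I + 1)"
        by (simp add: Y_def T_def algebra_simps)
      also have "\<dots> \<le> (real I * z - E + E / 4) + (E / 2 - z)" using 2 3 by (intro add_mono) simp_all
      also have "\<dots> \<le> lower_exponent I" using E(1) by (simp add: lower_exponent_def z_def)
      finally have "(\<beta> - \<theta>) * (Y I + 1) \<le> lower_exponent I" .
      then show "\<exists>I\<ge>N. (\<beta> - \<theta>) * (Y I + 1) \<le> lower_exponent I" using I(1) by (intro exI[of _ I]) auto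
    qed (use \<epsilon> in auto)
    then show "\<exists>n\<ge>N. \<beta> - \<epsilon> \<le> ?L n / ln (real n)"
      using \<epsilon>(3) by (meson diff_left_mono order.trans)
  qed
qed

theorem theorem3:
  fixes \<alpha> \<beta> :: real
  assumes "ln 2 / ln lambda0 \<le> \<alpha>" and "\<alpha> \<le> \<beta>" and "\<beta> \<le> 1"
  shows "\<exists>\<omega> :: nat \<Rightarrow> letter.
    liminf (\<lambda>n. ereal (ln (ln (real (growth (grig \<omega>) (grig_gens \<omega>) n))) / ln (real n))) = ereal \<alpha> \<and>
    limsup (\<lambda>n. ereal (ln (ln (real (growth (grig \<omega>) (grig_gens \<omega>) n))) / ln (real n))) = ereal \<beta>"
proof -
  have "ln eta = ln 2 - ln lambda0" using lambda0_root(1) by (simp add: eta_def ln_div)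
  then have ll: "ln lambda0 = ln 2 - ln eta" by simp
  have lx: "ln xi = - 3 * ln eta" using eta_pos by (simp add: xi_def ln_div ln_realpow)
  have l8: "ln (8::real) = 3 * ln 2" using ln_realpow[of 2 3] by simp
  have c: "0 < ln xi" using xi_bounds by simp
  then have ll0: "0 < ln lambda0" unfolding ll lx using ln_gt_zero[of "2::real"] by linarith
  then have \<alpha>0: "0 < ln 2 / ln lambda0" by simp
  \<comment> \<open>The density of triples \<open>012\<close> at which the exponent is \<open>x\<close>.\<close>
  define F where "F x = (ln 8 / x - ln 8) / ln xi" for x :: real
  have F: "x * (ln 8 + F x * ln xi) = ln 8" if "0 < x" for x
    using that c by (simp add: F_def field_simps)
  have mono: "F y \<le> F x" if "0 < x" "x \<le> y" for x y
    using that c unfolding F_def by (intro divide_right_mono diff_right_mono divide_left_mono) auto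
  have "F 1 = 0" by (simp add: F_def)
  have "F (ln 2 / ln lambda0) = 1"
    using c ll0 unfolding F_def l8 lx ll by (simp add: field_simps)
  then have "0 \<le> F \<beta>" "F \<beta> \<le> F \<alpha>" "F \<alpha> \<le> 1"
    using mono[of \<beta> 1] mono[of \<alpha> \<beta>] mono[of "ln 2 / ln lambda0" \<alpha>] assms \<alpha>0 \<open>F 1 = 0\<close> by auto
  from liminf_limsup_pattern[OF this F F] show ?thesis using assms \<alpha>0 by (intro exI) auto
qed

end
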